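(* Let $\kappa$ be a singular cardinal of cofinality $\lambda>\omega$ and let $\mathbb{P}$ be any of $\mathbb{M}_\kappa$, $\mathbb{L}_\kappa$, $\mathbb{M}^{\mathrm{stat}}_\kappa$, or $\mathbb{L}^{\mathrm{stat}}_\kappa$. Then $\mathrm{ro}(\mathbb{P})$ is not $(\omega,\cdot,\lambda^+)$-distributive.
   Context: Fix a strictly increasing sequence $\langle\kappa_\alpha:\alpha<\lambda\rangle$ of regular infinite cardinals with supremum $\kappa$. Let $N=\bigcup_{\alpha<\lambda}\prod_{\beta<\alpha}\kappa_\beta$ (functions $t$ with $\mathrm{dom}(t)$ an ordinal $<\lambda$ and $t(\beta)<\kappa_\beta$), ordered by end-extension $\sqsubseteq$. A tree is a nonempty $T\subseteq N$ closed under initial segments; $\mathrm{Succ}_T(t)$ is the set of immediate successors of $t$ and $\mathrm{OSucc}_T(t)=\{\beta:t^\frown\langle\beta\rangle\in T\}$. $T$ is $(<\lambda)$-closed if every node has a proper extension in $T$ and whenever $\delta<\lambda$ is a limit and $f$ has domain $\delta$ with $f\restriction\beta\in T$ for all $\beta<\delta$, then $f\in T$. $T$ is ever-branching if for all $s\in T$ and $\alpha<\lambda$ there is $t\in T$ with $s\sqsubseteq t$ and $|\mathrm{Succ}_T(t)|\ge\kappa_\alpha$; perfect means $(<\lambda)$-closed and ever-branching. $\mathbb{M}_\kappa$: perfect trees; $\mathbb{M}^{\mathrm{stat}}_\kappa$: perfect trees $p$ such that every node has an extension $t\in p$ with $\mathrm{OSucc}_p(t)$ a stationary subset of $\{\beta<\kappa_{\mathrm{dom}(t)}:\operatorname{cf}\beta=\omega\}$.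 $\mathbb{L}_\kappa$: $(<\lambda)$-closed trees $p$ with a node $s$ (the stem) comparable with every node of $p$ such that every $t\in p$ with $s\sqsubseteq t$ has $|\mathrm{Succ}_p(t)|=\kappa_{\mathrm{dom}(t)}$; $\mathbb{L}^{\mathrm{stat}}_\kappa$ additionally requires $\mathrm{OSucc}_p(t)$ to be stationary in $\{\beta<\kappa_{\mathrm{dom}(t)}:\operatorname{cf}\beta=\omega\}$ for all such $t$. All ordered by inclusion. $\mathrm{ro}(\mathbb{P})$ is the regular open (complete Boolean) algebra of $\mathbb{P}$. For a Boolean algebra $B$, a matrix is a family of maximal pairwise disjoint subsets of $B\setminus\{0\}$. $B$ is $(\theta,\nu,\mu)$-distributive if for every matrix $\{P_\alpha:\alpha<\theta\}$ with $|P_\alpha|\le\nu$ there is a maximal disjoint $Q\subseteq B\setminus\{0\}$ such that for all $q\in Q$ and $\alpha<\theta$, $|\{p\in P_\alpha: p\wedge q\neq 0\}|<\mu$. $B$ is $(\theta,\cdot,\mu)$-distributive if it is $(\theta,\nu,\mu)$-distributive for every cardinal $\nu$. *)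

theory Defs
  imports "HOL-Algebra.Lattice" "HOL-Analysis.Abstract_Topology"
begin

unbundle cardinal_syntax

section \<open>Ordinals below a fixed cardinal\<close>

text \<open>
  The cardinal \<open>\<kappa>\<close> is a cardinal order \<open>r\<close>, and the ordinals below \<open>\<kappa>\<close> are the elements of
  \<open>Field r\<close>. As usual an ordinal \<open>a < \<kappa>\<close> is identified with its set of predecessors: \<open>underS r a\<close>
  as a set, \<open>seg r a\<close> as a well-order. In particular \<open>a\<close> is a cardinal iff
  \<open>Card_order (seg r a)\<close>.
\<close>

definition seg :: "'a rel \<Rightarrow> 'a \<Rightarrow> 'a rel" where
  "seg r a = Restr r (underS r a)"

lemma Field_seg:
  assumes "Well_order r"
  shows "Field (seg r a) = underS r a"
proof -
  have "Refl r"
    using assms by (simp add: order_on_defs)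
  then have "(b, b) \<in> r" if "b \<in> underS r a" for b
    using that by (auto simp: underS_def refl_on_def Field_def)
  then show ?thesis
    by (auto simp: seg_def Field_def)
qed

definition singular_card :: "'a rel \<Rightarrow> bool" where
  "singular_card r \<longleftrightarrow> Card_order r \<and> infinite (Field r) \<and> \<not> regularCard r"

definition regular_inf_card :: "'a rel \<Rightarrow> bool" where
  "regular_inf_card r \<longleftrightarrow> Card_order r \<and> infinite (Field r) \<and> regularCard r"

text \<open>
  \<open>has_cof r c\<close>: the cofinality of the well-order \<open>r\<close> is the cardinal \<open>c\<close>. The library notion
  \<open>cofinal\<close> is strict, so this is meant for limit ordinals; for a successor ordinal it holds for
  no \<open>c\<close>.
\<close>

definition has_cof :: "'a rel \<Rightarrow> 'b rel \<Rightarrow> bool" where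
  "has_cof r c \<longleftrightarrow> Card_order c \<and>
     (\<exists>K \<subseteq> Field r. cofinal K r \<and> |K| =o c) \<and>
     (\<forall>K \<subseteq> Field r. cofinal K r \<longrightarrow> c \<le>o |K| )"

definition limit_ord :: "'a rel \<Rightarrow> 'a \<Rightarrow> bool" where
  "limit_ord r d \<longleftrightarrow> d \<in> Field r \<and> underS r d \<noteq> {} \<and>
     (\<forall>b \<in> underS r d. \<exists>c \<in> underS r d. b \<in> underS r c)"

definition club_in :: "'a rel \<Rightarrow> 'a set \<Rightarrow> bool" where
  "club_in c C \<longleftrightarrow> C \<subseteq> Field c \<and> cofinal C c \<and>
     (\<forall>d \<in> Field c. limit_ord c d \<and> cofinal (C \<inter> underS c d) (seg c d) \<longrightarrow> d \<in> C)"

definition stationary_in :: "'a rel \<Rightarrow> 'a set \<Rightarrow> bool" where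
  "stationary_in c S \<longleftrightarrow> S \<subseteq> Field c \<and> (\<forall>C. club_in c C \<longrightarrow> S \<inter> C \<noteq> {})"

definition cof_omega_below :: "'a rel \<Rightarrow> 'a \<Rightarrow> 'a set" where
  "cof_omega_below r a = {b \<in> underS r a. has_cof (seg r b) natLeq}"

section \<open>Trees\<close>

text \<open>
  Throughout, \<open>r\<close> is \<open>\<kappa>\<close>, \<open>l \<in> Field r\<close> is \<open>\<lambda>\<close>, and \<open>k\<close> is the sequence \<open>\<langle>\<kappa>\<^sub>\<alpha> : \<alpha> < \<lambda>\<rangle>\<close>.
  Nodes are partial functions whose domain is an ordinal below \<open>\<lambda>\<close>; between nodes, end-extension is
  \<open>\<subseteq>\<^sub>m\<close>.
\<close>

type_synonym 'a node = "'a \<rightharpoonup> 'a"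

definition nodes :: "'a rel \<Rightarrow> 'a \<Rightarrow> ('a \<Rightarrow> 'a) \<Rightarrow> 'a node set" where
  "nodes r l k = {t. \<exists>a \<in> underS r l. dom t = underS r a \<and>
     (\<forall>b \<in> underS r a. the (t b) \<in> underS r (k b))}"

definition ht :: "'a rel \<Rightarrow> 'a node \<Rightarrow> 'a" where
  "ht r t = (THE a. a \<in> Field r \<and> dom t = underS r a)"

definition is_tree :: "'a rel \<Rightarrow> 'a \<Rightarrow> ('a \<Rightarrow> 'a) \<Rightarrow> 'a node set \<Rightarrow> bool" where
  "is_tree r l k T \<longleftrightarrow> T \<noteq> {} \<and> T \<subseteq> nodes r l k \<and>
     (\<forall>t \<in> T. \<forall>s \<in> nodes r l k. s \<subseteq>\<^sub>m t \<longrightarrow> s \<in> T)"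

definition Succs :: "'a node set \<Rightarrow> 'a node \<Rightarrow> 'a node set" where
  "Succs T t = {s \<in> T. t \<subseteq>\<^sub>m s \<and> s \<noteq> t \<and>
     (\<forall>u \<in> T. t \<subseteq>\<^sub>m u \<and> u \<subseteq>\<^sub>m s \<longrightarrow> u = t \<or> u = s)}"

definition OSucc :: "'a rel \<Rightarrow> 'a node set \<Rightarrow> 'a node \<Rightarrow> 'a set" where
  "OSucc r T t = {b. t(ht r t \<mapsto> b) \<in> T}"

definition lt_closed :: "'a rel \<Rightarrow> 'a \<Rightarrow> 'a node set \<Rightarrow> bool" where
  "lt_closed r l T \<longleftrightarrow>
     (\<forall>s \<in> T. \<exists>t \<in> T. s \<subseteq>\<^sub>m t \<and> t \<noteq> s) \<and>
     (\<forall>d \<in> underS r l. \<forall>f. limit_ord r d \<and> dom f = underS r d \<and>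
        (\<forall>b \<in> underS r d. f |` underS r b \<in> T) \<longrightarrow> f \<in> T)"

definition ever_branching :: "'a rel \<Rightarrow> 'a \<Rightarrow> ('a \<Rightarrow> 'a) \<Rightarrow> 'a node set \<Rightarrow> bool" where
  "ever_branching r l k T \<longleftrightarrow>
     (\<forall>s \<in> T. \<forall>a \<in> underS r l. \<exists>t \<in> T. s \<subseteq>\<^sub>m t \<and> seg r (k a) \<le>o |Succs T t| )"

definition perfect_tree :: "'a rel \<Rightarrow> 'a \<Rightarrow> ('a \<Rightarrow> 'a) \<Rightarrow> 'a node set \<Rightarrow> bool" where
  "perfect_tree r l k T \<longleftrightarrow> is_tree r l k T \<and> lt_closed r l T \<and> ever_branching r l k T"

definition stat_branching :: "'a rel \<Rightarrow> ('a \<Rightarrow> 'a) \<Rightarrow> 'a node set \<Rightarrow> 'a node \<Rightarrow> bool" where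
  "stat_branching r k p t \<longleftrightarrow>
     OSucc r p t \<subseteq> cof_omega_below r (k (ht r t)) \<and>
     stationary_in (seg r (k (ht r t))) (OSucc r p t)"

section \<open>The forcing notions\<close>

definition Miller :: "'a rel \<Rightarrow> 'a \<Rightarrow> ('a \<Rightarrow> 'a) \<Rightarrow> 'a node set set" where
  "Miller r l k = {p. perfect_tree r l k p}"

definition Miller_stat :: "'a rel \<Rightarrow> 'a \<Rightarrow> ('a \<Rightarrow> 'a) \<Rightarrow> 'a node set set" where
  "Miller_stat r l k =
     {p. perfect_tree r l k p \<and> (\<forall>s \<in> p. \<exists>t \<in> p. s \<subseteq>\<^sub>m t \<and> stat_branching r k p t)}"

definition Laver_stem :: "'a rel \<Rightarrow> ('a \<Rightarrow> 'a) \<Rightarrow> 'a node set \<Rightarrow> 'a node \<Rightarrow> bool" where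
  "Laver_stem r k p s \<longleftrightarrow> s \<in> p \<and> (\<forall>t \<in> p. s \<subseteq>\<^sub>m t \<or> t \<subseteq>\<^sub>m s) \<and>
     (\<forall>t \<in> p. s \<subseteq>\<^sub>m t \<longrightarrow> |Succs p t| =o seg r (k (ht r t)))"

definition Laver :: "'a rel \<Rightarrow> 'a \<Rightarrow> ('a \<Rightarrow> 'a) \<Rightarrow> 'a node set set" where
  "Laver r l k = {p. is_tree r l k p \<and> lt_closed r l p \<and> (\<exists>s. Laver_stem r k p s)}"

definition Laver_stat :: "'a rel \<Rightarrow> 'a \<Rightarrow> ('a \<Rightarrow> 'a) \<Rightarrow> 'a node set set" where
  "Laver_stat r l k = {p. is_tree r l k p \<and> lt_closed r l p \<and>
     (\<exists>s. Laver_stem r k p s \<and> (\<forall>t \<in> p. s \<subseteq>\<^sub>m t \<longrightarrow> stat_branching r k p t))}"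

section \<open>Regular open algebras\<close>

definition forcing_topology :: "'p set \<Rightarrow> ('p \<Rightarrow> 'p \<Rightarrow> bool) \<Rightarrow> 'p topology" where
  "forcing_topology P leq = topology (\<lambda>U. U \<subseteq> P \<and> (\<forall>p \<in> U. \<forall>q \<in> P. leq q p \<longrightarrow> q \<in> U))"

lemma openin_forcing_topology:
  "openin (forcing_topology P leq) U \<longleftrightarrow> U \<subseteq> P \<and> (\<forall>p \<in> U. \<forall>q \<in> P. leq q p \<longrightarrow> q \<in> U)"
proof -
  have "istopology (\<lambda>U. U \<subseteq> P \<and> (\<forall>p \<in> U. \<forall>q \<in> P. leq q p \<longrightarrow> q \<in> U))"
    unfolding istopology_def by blast
  then show ?thesis
    unfolding forcing_topology_def by (simp add: topology_inverse')
qed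

definition ro :: "'p set \<Rightarrow> ('p \<Rightarrow> 'p \<Rightarrow> bool) \<Rightarrow> 'p set gorder" where
  "ro P leq =
     \<lparr>carrier = {U. openin (forcing_topology P leq) U \<and>
        forcing_topology P leq interior_of (forcing_topology P leq closure_of U) = U},
      eq = (=), le = (\<subseteq>)\<rparr>"

lemma bottom_ro: "\<bottom>\<^bsub>ro P leq\<^esub> = {}"
proof -
  have "{} \<in> carrier (ro P leq)"
    by (simp add: ro_def)
  then show ?thesis
    unfolding bottom_def least_def Upper_def
    by (intro some_equality) (auto simp: ro_def)
qed

lemma meet_ro:
  assumes U: "U \<in> carrier (ro P leq)" and V: "V \<in> carrier (ro P leq)"
  shows "U \<sqinter>\<^bsub>ro P leq\<^esub> V = U \<inter> V"
proof -
  let ?X = "forcing_topology P leq"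
  have "?X interior_of (?X closure_of (U \<inter> V)) \<subseteq> U \<inter> V"
  proof -
    have "?X interior_of (?X closure_of (U \<inter> V)) \<subseteq> ?X interior_of (?X closure_of W)"
      if "U \<inter> V \<subseteq> W" for W
      using that by (intro interior_of_mono closure_of_mono)
    from this[of U] this[of V] U V show ?thesis
      by (auto simp: ro_def)
  qed
  moreover have "openin ?X (U \<inter> V)"
    using U V by (auto simp: ro_def intro: openin_Int)
  moreover from this have "U \<inter> V \<subseteq> ?X interior_of (?X closure_of (U \<inter> V))"
    by (meson closure_of_subset interior_of_maximal openin_subset)
  ultimately have W: "U \<inter> V \<in> carrier (ro P leq)"
    by (auto simp: ro_def)
  then have "greatest (ro P leq) (U \<inter> V) (Lower (ro P leq) {U, V})"
    using U V by (auto simp: greatest_def Lower_def ro_def)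
  moreover have "W = U \<inter> V" if "greatest (ro P leq) W (Lower (ro P leq) {U, V})" for W
    using that calculation by (auto simp: greatest_def ro_def)
  ultimately show ?thesis
    unfolding meet_def inf_def by (intro some_equality)
qed

section \<open>Distributivity\<close>

definition pairwise_disjoint :: "('b, 'm) gorder_scheme \<Rightarrow> 'b set \<Rightarrow> bool" where
  "pairwise_disjoint B A \<longleftrightarrow> A \<subseteq> carrier B - {\<bottom>\<^bsub>B\<^esub>} \<and>
     (\<forall>p \<in> A. \<forall>q \<in> A. p \<noteq> q \<longrightarrow> p \<sqinter>\<^bsub>B\<^esub> q = \<bottom>\<^bsub>B\<^esub>)"

definition maximal_disjoint :: "('b, 'm) gorder_scheme \<Rightarrow> 'b set \<Rightarrow> bool" where
  "maximal_disjoint B A \<longleftrightarrow> pairwise_disjoint B A \<and>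
     (\<forall>A'. pairwise_disjoint B A' \<and> A \<subseteq> A' \<longrightarrow> A' = A)"

text \<open>The cardinals \<open>\<theta>\<close>, \<open>\<nu>\<close>, \<open>\<mu>\<close> are cardinal orders, possibly on different types.\<close>

definition distributive ::
  "('b, 'm) gorder_scheme \<Rightarrow> 'i rel \<Rightarrow> 'n rel \<Rightarrow> 'u rel \<Rightarrow> bool" where
  "distributive B \<theta> \<nu> \<mu> \<longleftrightarrow>
     (\<forall>P. (\<forall>i \<in> Field \<theta>. maximal_disjoint B (P i) \<and> |P i| \<le>o \<nu>) \<longrightarrow>
        (\<exists>Q. maximal_disjoint B Q \<and>
           (\<forall>q \<in> Q. \<forall>i \<in> Field \<theta>. |{p \<in> P i. p \<sqinter>\<^bsub>B\<^esub> q \<noteq> \<bottom>\<^bsub>B\<^esub>}| <o \<mu>)))"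

text \<open>
  In the \<open>(\<theta>, \<cdot>, \<mu>)\<close> version it suffices to let \<open>\<nu>\<close> range over the cardinals on the type of elements
  of \<open>B\<close>: every subset of \<open>B\<close> has size at most one of these.
\<close>

definition distributive_any :: "('b, 'm) gorder_scheme \<Rightarrow> 'i rel \<Rightarrow> 'u rel \<Rightarrow> bool" where
  "distributive_any B \<theta> \<mu> \<longleftrightarrow> (\<forall>\<nu> :: 'b rel. Card_order \<nu> \<longrightarrow> distributive B \<theta> \<nu> \<mu>)"

end

theory Submission
  imports Defs
begin

text \<open>
  Every condition \<open>p\<close> is refined by a condition \<open>p'\<close> whose successor sets are thinned out at each
  node with more than \<open>\<lambda>\<close> successors. For the plain Miller and Laver trees only the points that are
  successors within the old successor set are kept; this preserves the size and lowers the rank of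
  every surviving point. For the stationary variants every ordinal \<open>\<beta>\<close> of cofinality \<open>\<omega>\<close> gets a cofinal sequence
  \<open>\<langle>e\<^sub>n(\<beta>) : n < \<omega>\<rangle>\<close>, and at stage \<open>n\<close> Fodor's lemma makes \<open>e\<^sub>n\<close> constant on the new successor set.

  Iterating \<open>\<omega>\<close> times gives maximal antichains \<open>A\<^sub>n\<close>, each refining the previous one. If \<open>q\<close> were
  compatible with at most \<open>\<lambda>\<close> members of every \<open>A\<^sub>n\<close>, fix \<open>t \<in> q\<close> with more than \<open>\<lambda>\<close> successors and
  discard the at most \<open>\<lambda>\<close> many \<open>y\<close> that lie in a successor set of size at most \<open>\<lambda>\<close> of \<open>t\<close> in one of these
  members. Strengthening \<open>q\<close> above \<open>t\<close> extended by any other \<open>y\<close> yields a decreasing chain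
  \<open>a\<^sub>n \<in> A\<^sub>n\<close> in which \<open>y\<close> stays a successor of \<open>t\<close>. In the first case the ranks of \<open>y\<close> descend
  infinitely often. In the second case each \<open>e\<^sub>n(y)\<close> is one of at most \<open>\<lambda>\<close> constants, so that all these
  \<open>y\<close> are bounded below \<open>\<kappa>\<^bsub>dom(t)\<^esub>\<close>, although a stationary set has size \<open>\<kappa>\<^bsub>dom(t)\<^esub>\<close>.
\<close>

section \<open>Maximal antichains and distributivity\<close>

text \<open>The two cases cannot exchange their thinnings. A successor set of full size may be
  nonstationary, so Fodor's lemma has nothing to act on in the plain trees. Conversely, passing to
  points with an immediate predecessor in Y destroys stationarity: the limit points of an unbounded
  Y form a club that avoids all of them.

  Distributivity gives little information about \<open>q\<close>: it meets few members of each
  antichain but need not lie below any of them. Hence no fusion is attempted, and everything happens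
  at a single node. What ties \<open>q\<close> to the members a_n is \<open>below_cone\<close>: a
  condition contained in the cone of a node must contain that node.

  The bound lambda enters through counting. Countably many families of at most lambda sets of size
  at most lambda cover at most lambda points, whereas from some height on the cardinals of the
  sequence exceed lambda. In the stationary case the same count makes the set of all constants
  smaller than a regular cardinal.

  Thinning has to respect closure at limits. Therefore a node that does not branch is given a target
  which stays the same along the path to it.\<close>

definition compatible :: "'p set \<Rightarrow> ('p \<Rightarrow> 'p \<Rightarrow> bool) \<Rightarrow> 'p \<Rightarrow> 'p \<Rightarrow> bool" where
  "compatible P leq p q \<longleftrightarrow> (\<exists>w \<in> P. leq w p \<and> leq w q)"

definition max_antichain :: "'p set \<Rightarrow> ('p \<Rightarrow> 'p \<Rightarrow> bool) \<Rightarrow> 'p set \<Rightarrow> bool" where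
  "max_antichain P leq A \<longleftrightarrow> A \<subseteq> P \<and>
     (\<forall>a \<in> A. \<forall>b \<in> A. compatible P leq a b \<longrightarrow> a = b) \<and>
     (\<forall>p \<in> P. \<exists>a \<in> A. compatible P leq p a)"

text \<open>Zorn's lemma for cliques of an arbitrary relation \<open>Q\<close>; no symmetry is
  assumed, so both directions appear. It yields antichains here and the family of splitting nodes in
  \<open>Miller_rank_drop\<close>.\<close>

lemma max_clique:
  "\<exists>F \<subseteq> X. (\<forall>v \<in> F. \<forall>t \<in> F. Q v t) \<and>
     (\<forall>x \<in> X. Q x x \<and> (\<forall>v \<in> F. Q v x \<and> Q x v) \<longrightarrow> x \<in> F)"
proof -
  let ?F = "{F. F \<subseteq> X \<and> (\<forall>a \<in> F. \<forall>b \<in> F. Q a b)}"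
  have U: "\<Union>C \<in> ?F" if "subset.chain ?F C" for C
  proof -
    have "Q a b" if "Y \<in> C" "Z \<in> C" "a \<in> Y" "b \<in> Z" for Y Z a b
    proof -
      have "Y \<subseteq> Z \<or> Z \<subseteq> Y" "Y \<in> ?F" "Z \<in> ?F"
        using \<open>subset.chain ?F C\<close> that by (auto simp: subset_chain_def)
      then show ?thesis using that by blast
    qed
    moreover have "\<Union>C \<subseteq> X" using that by (auto simp: subset_chain_def)
    ultimately show ?thesis by blast
  qed
  obtain F where F: "F \<in> ?F" "\<forall>Y \<in> ?F. F \<subseteq> Y \<longrightarrow> Y = F"
    using subset_Zorn'[of ?F] U by (metis (no_types, lifting))
  have "x \<in> F" if "x \<in> X" "Q x x" "\<forall>v \<in> F. Q v x \<and> Q x v" for x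
  proof -
    have "insert x F \<in> ?F" using F(1) that by auto
    then have "insert x F = F" using F(2) by blast
    then show ?thesis by blast
  qed
  with F(1) show ?thesis by blast
qed

text \<open>An antichain that is maximal inside the dense set \<open>D\<close> is maximal in
  \<open>P\<close>: a condition incompatible with all of it would have an extension in
  \<open>D\<close> that could be added.\<close>

lemma max_antichain_in_dense:
  assumes leq: "reflp leq" "transp leq"
    and D: "D \<subseteq> P" "\<And>p. p \<in> P \<Longrightarrow> \<exists>d \<in> D. leq d p"
  obtains A where "max_antichain P leq A" "A \<subseteq> D"
proof -
  note refl = reflpD[OF leq(1)] and trans = transpD[OF leq(2)]
  obtain A where A: "A \<subseteq> D" "\<forall>a \<in> A. \<forall>b \<in> A. compatible P leq a b \<longrightarrow> a = b"
    "\<forall>x \<in> D. (compatible P leq x x \<longrightarrow> x = x) \<and>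
      (\<forall>v \<in> A. (compatible P leq v x \<longrightarrow> v = x) \<and> (compatible P leq x v \<longrightarrow> x = v)) \<longrightarrow> x \<in> A"
    using max_clique[of D "\<lambda>a b. compatible P leq a b \<longrightarrow> a = b"] by (elim exE conjE)
  have "\<exists>a \<in> A. compatible P leq p a" if p: "p \<in> P" for p
  proof (rule ccontr)
    assume no: "\<not> ?thesis"
    obtain d where d: "d \<in> D" "leq d p" using D p by blast
    have nod: "\<not> compatible P leq d a" "\<not> compatible P leq a d" if "a \<in> A" for a
      using no that d trans[OF _ d(2)] unfolding compatible_def by blast+
    then have "d \<in> A" using A(3) d(1) by blast
    then show False using nod[of d] d D(1) refl[of d] by (auto simp: compatible_def)
  qed
  then show ?thesis using that[of A] A(1,2) D(1) unfolding max_antichain_def by blast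
qed

section \<open>From the forcing order to its regular open algebra and back\<close>

text \<open>The canonical dense map into the regular open algebra: the conditions that force
  \<open>a\<close> into the generic filter.\<close>

definition reg_open_hull :: "'p set \<Rightarrow> ('p \<Rightarrow> 'p \<Rightarrow> bool) \<Rightarrow> 'p \<Rightarrow> 'p set" where
  "reg_open_hull P leq a = {q \<in> P. \<forall>s \<in> P. leq s q \<longrightarrow> compatible P leq s a}"

text \<open>Every \<open>p\<close> has a least neighbourhood, the set of its extensions, so closure
  and interior turn into quantifiers over extensions. The last clause says that \<open>U\<close>
  contains each condition below which it is dense.\<close>

lemma carrier_ro:
  assumes leq: "reflp leq" "transp leq"
  shows "U \<in> carrier (ro P leq) \<longleftrightarrow> U \<subseteq> P \<and> (\<forall>p \<in> U. \<forall>q \<in> P. leq q p \<longrightarrow> q \<in> U) \<and>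
    (\<forall>p \<in> P. (\<forall>q \<in> P. leq q p \<longrightarrow> (\<exists>s \<in> U. leq s q)) \<longrightarrow> p \<in> U)"
proof -
  note refl = reflpD[OF leq(1)] and trans = transpD[OF leq(2)]
  let ?X = "forcing_topology P leq"
  have ops: "openin ?X V \<longleftrightarrow> V \<subseteq> P \<and> (\<forall>p \<in> V. \<forall>q \<in> P. leq q p \<longrightarrow> q \<in> V)" for V
    by (rule openin_forcing_topology)
  have cone: "openin ?X {q \<in> P. leq q p}" for p
    unfolding ops using trans by blast
  have top: "topspace ?X = P"
  proof
    show "topspace ?X \<subseteq> P"
      by (metis ops openin_topspace)
    have "openin ?X P" by (simp add: ops)
    then show "P \<subseteq> topspace ?X" by (rule openin_subset)
  qed
  have cl: "x \<in> ?X closure_of V \<longleftrightarrow> x \<in> P \<and> (\<exists>s \<in> V. leq s x)" if "V \<subseteq> P" for x V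
  proof
    assume "x \<in> ?X closure_of V"
    then have "x \<in> P" "\<And>T. x \<in> T \<Longrightarrow> openin ?X T \<Longrightarrow> \<exists>y \<in> V. y \<in> T"
      unfolding in_closure_of top by auto
    from this(1) this(2)[OF _ cone[of x]] refl[of x] show "x \<in> P \<and> (\<exists>s \<in> V. leq s x)"
      by blast
  next
    assume "x \<in> P \<and> (\<exists>s \<in> V. leq s x)"
    then show "x \<in> ?X closure_of V"
      unfolding in_closure_of top ops using that by blast
  qed
  have int: "x \<in> ?X interior_of V \<longleftrightarrow> x \<in> P \<and> (\<forall>q \<in> P. leq q x \<longrightarrow> q \<in> V)" for x V
  proof
    assume "x \<in> ?X interior_of V"
    then show "x \<in> P \<and> (\<forall>q \<in> P. leq q x \<longrightarrow> q \<in> V)"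
      unfolding interior_of_def ops by blast
  next
    assume "x \<in> P \<and> (\<forall>q \<in> P. leq q x \<longrightarrow> q \<in> V)"
    then show "x \<in> ?X interior_of V"
      unfolding interior_of_def using cone[of x] refl by blast
  qed
  show ?thesis
  proof (cases "openin ?X U")
    case True
    then have U: "U \<subseteq> P" "\<forall>p \<in> U. \<forall>q \<in> P. leq q p \<longrightarrow> q \<in> U" by (auto simp: ops)
    have "x \<in> ?X interior_of (?X closure_of U) \<longleftrightarrow> 
        x \<in> P \<and> (\<forall>q \<in> P. leq q x \<longrightarrow> (\<exists>s \<in> U. leq s q))" for x
      unfolding int cl[OF U(1)] by blast
    moreover have "x \<in> P \<and> (\<forall>q \<in> P. leq q x \<longrightarrow> (\<exists>s \<in> U. leq s q))" if "x \<in> U" for x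
      using U refl that by blast
    ultimately have "?X interior_of (?X closure_of U) = U \<longleftrightarrow>
        (\<forall>p \<in> P. (\<forall>q \<in> P. leq q p \<longrightarrow> (\<exists>s \<in> U. leq s q)) \<longrightarrow> p \<in> U)"
      unfolding set_eq_iff by blast
    then show ?thesis
      using True U by (simp add: ro_def)
  next
    case False
    then show ?thesis by (auto simp: ro_def ops)
  qed
qed

lemma reg_open_hull_in_carrier:
  assumes leq: "reflp leq" "transp leq"
  shows "reg_open_hull P leq a \<in> carrier (ro P leq)"
proof -
  note refl = reflpD[OF leq(1)] and trans = transpD[OF leq(2)]
  have "p \<in> reg_open_hull P leq a"
    if p: "p \<in> P" and h: "\<forall>q \<in> P. leq q p \<longrightarrow> (\<exists>s \<in> reg_open_hull P leq a. leq s q)" for p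
  proof -
    have "compatible P leq s a" if s: "s \<in> P" "leq s p" for s
    proof -
      obtain u where u: "u \<in> reg_open_hull P leq a" "leq u s" using h s by blast
      then have "compatible P leq u a" using refl by (auto simp: reg_open_hull_def)
      then show ?thesis using u(2) trans unfolding compatible_def by blast
    qed
    then show ?thesis using p by (auto simp: reg_open_hull_def)
  qed
  moreover have "q \<in> reg_open_hull P leq a" 
    if "p \<in> reg_open_hull P leq a" "q \<in> P" "leq q p" for p q
    using that(1,2) trans[OF _ that(3)] unfolding reg_open_hull_def by blast
  moreover have "reg_open_hull P leq a \<subseteq> P"
    by (auto simp: reg_open_hull_def)
  ultimately show ?thesis
    unfolding carrier_ro[OF leq] by (intro conjI ballI impI)
qed

text \<open>A point common to two hulls has an extension below both generators, so incompatibility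
  becomes disjointness. Maximality holds because a nonempty regular open set contains a condition
  compatible with some \<open>a\<close>, and a common extension lies in both sets. Injectivity
  allows members of \<open>A\<close> to be counted by their hulls.\<close>

lemma maximal_disjoint_hulls:
  assumes leq: "reflp leq" "transp leq"
    and A: "max_antichain P leq A"
  shows "maximal_disjoint (ro P leq) (reg_open_hull P leq ` A)"
    and "inj_on (reg_open_hull P leq) A"
proof -
  note refl = reflpD[OF leq(1)] and trans = transpD[OF leq(2)]
  let ?h = "reg_open_hull P leq"
  note car = carrier_ro[OF leq]
  have down: "q \<in> U" if "U \<in> carrier (ro P leq)" "p \<in> U" "q \<in> P" "leq q p" for U p q
    using that unfolding car by blast
  have hc: "?h a \<in> carrier (ro P leq)" for a
    by (rule reg_open_hull_in_carrier[OF leq])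
  have AP: "a \<in> P" if "a \<in> A" for a using A that by (auto simp: max_antichain_def)
  have self: "a \<in> ?h a" if "a \<in> A" for a
    using AP[OF that] refl by (auto simp: reg_open_hull_def compatible_def)
  have disj: "a = b" if ab: "a \<in> A" "b \<in> A" "q \<in> ?h a" "q \<in> ?h b" for a b q
  proof -
    obtain w where w: "w \<in> P" "leq w q" "leq w a"
      using ab refl unfolding reg_open_hull_def compatible_def by blast
    moreover obtain v where "v \<in> P" "leq v w" "leq v b"
      using ab w unfolding reg_open_hull_def compatible_def by blast
    ultimately have "compatible P leq a b" using trans unfolding compatible_def by blast
    then show ?thesis using A ab by (auto simp: max_antichain_def)
  qed
  show inj: "inj_on ?h A"
    using self disj by (metis inj_onI)
  have pd: "pairwise_disjoint (ro P leq) (?h ` A)"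
    unfolding pairwise_disjoint_def bottom_ro
  proof (intro conjI subsetI ballI impI)
    fix U assume "U \<in> ?h ` A"
    then show "U \<in> carrier (ro P leq) - {{}}" using hc self by auto
  next
    fix U V assume "U \<in> ?h ` A" "V \<in> ?h ` A" "U \<noteq> V"
    then have "U \<inter> V = {}" using disj by blast
    then show "U \<sqinter>\<^bsub>ro P leq\<^esub> V = {}"
      using meet_ro[of U P leq V] hc \<open>U \<in> ?h ` A\<close> \<open>V \<in> ?h ` A\<close> by auto
  qed
  moreover have "A' = ?h ` A" if A': "pairwise_disjoint (ro P leq) A'" "?h ` A \<subseteq> A'" for A'
  proof (rule ccontr)
    assume "A' \<noteq> ?h ` A"
    then obtain V where V: "V \<in> A'" "V \<notin> ?h ` A" using A'(2) by blast
    have Vc: "V \<in> carrier (ro P leq)" "V \<noteq> {}"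
      using A'(1) V by (auto simp: pairwise_disjoint_def bottom_ro)
    then obtain v where v: "v \<in> V" "v \<in> P" unfolding car by blast
    then obtain a where a: "a \<in> A" "compatible P leq v a"
      using A by (auto simp: max_antichain_def)
    then obtain w where w: "w \<in> P" "leq w v" "leq w a" by (auto simp: compatible_def)
    have "w \<in> V" using down[OF Vc(1) v(1) w(1,2)] .
    moreover have "w \<in> ?h a" using down[OF hc self[OF a(1)] w(1,3)] .
    moreover have "?h a \<sqinter>\<^bsub>ro P leq\<^esub> V = \<bottom>\<^bsub>ro P leq\<^esub>"
    proof -
      have "?h a \<in> A'" "?h a \<noteq> V" using A'(2) V a(1) by auto
      then show ?thesis using A'(1) V(1) unfolding pairwise_disjoint_def by auto
    qed
    ultimately show False
      using meet_ro[OF hc[of a] Vc(1)] by (auto simp: bottom_ro)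
  qed
  ultimately show "maximal_disjoint (ro P leq) (?h ` A)"
    unfolding maximal_disjoint_def by blast
qed

text \<open>Any \<open>q\<close> in any member \<open>V\<close> of the refining family works: if
  \<open>a\<close> is compatible with \<open>q\<close>, a common extension lies both in
  \<open>V\<close> and in the hull of \<open>a\<close>, so this hull is among the few that meet
  \<open>V\<close>.\<close>

lemma distributive_any_antichains:
  fixes P :: "'p set" and \<mu> :: "'u rel"
  assumes leq: "reflp leq" "transp leq"
    and dist: "distributive_any (ro P leq) \<theta> (cardSuc \<mu>)" and mu: "Card_order \<mu>"
    and ne: "P \<noteq> {}" and A: "\<And>i. i \<in> Field \<theta> \<Longrightarrow> max_antichain P leq (A i)"
  shows "\<exists>q \<in> P. \<forall>i \<in> Field \<theta>. |{a \<in> A i. compatible P leq q a}| \<le>o \<mu>"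
proof -
  note refl = reflpD[OF leq(1)] and trans = transpD[OF leq(2)]
  let ?h = "reg_open_hull P leq"
  note car = carrier_ro[OF leq]
  have down: "q \<in> U" if "U \<in> carrier (ro P leq)" "p \<in> U" "q \<in> P" "leq q p" for U p q
    using that unfolding car by blast
  have hc: "?h a \<in> carrier (ro P leq)" for a
    by (rule reg_open_hull_in_carrier[OF leq])
  \<comment> \<open>The largest cardinal on the type is taken for the width, so the antichains may
    have any size.\<close>
  have "distributive (ro P leq) \<theta> |UNIV :: 'p set set| (cardSuc \<mu>)"
    using dist unfolding distributive_any_def by (auto intro: card_of_Card_order)
  moreover have "\<forall>i \<in> Field \<theta>. maximal_disjoint (ro P leq) (?h ` A i) \<and> |?h ` A i| \<le>o |UNIV :: 'p set set|"
    using maximal_disjoint_hulls(1)[OF leq A] by (auto intro: card_of_mono1)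
  ultimately obtain Q where Q: "maximal_disjoint (ro P leq) Q"
    "\<forall>V \<in> Q. \<forall>i \<in> Field \<theta>. |{p \<in> ?h ` A i. p \<sqinter>\<^bsub>ro P leq\<^esub> V \<noteq> \<bottom>\<^bsub>ro P leq\<^esub>}| <o cardSuc \<mu>"
    unfolding distributive_def by (drule_tac x="\<lambda>i. ?h ` A i" in spec) blast
  \<comment> \<open>The empty family is not maximal, since the top element \<open>P\<close> could be
    added.\<close>
  have "Q \<noteq> {}"
  proof
    assume "Q = {}"
    have "P \<in> carrier (ro P leq)" unfolding car by blast
    then have "pairwise_disjoint (ro P leq) {P}"
      using ne by (auto simp: pairwise_disjoint_def bottom_ro)
    then show False using Q(1) \<open>Q = {}\<close> unfolding maximal_disjoint_def by blast
  qed
  then obtain V where V: "V \<in> Q" by blast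
  then have Vc: "V \<in> carrier (ro P leq)" "V \<noteq> {}"
    using Q(1) by (auto simp: maximal_disjoint_def pairwise_disjoint_def bottom_ro)
  then obtain q where q: "q \<in> V" "q \<in> P" unfolding car by blast
  have "|{a \<in> A i. compatible P leq q a}| \<le>o \<mu>" if i: "i \<in> Field \<theta>" for i
  proof -
    let ?C = "{a \<in> A i. compatible P leq q a}"
    let ?M = "{p \<in> ?h ` A i. p \<sqinter>\<^bsub>ro P leq\<^esub> V \<noteq> \<bottom>\<^bsub>ro P leq\<^esub>}"
    have "?h ` ?C \<subseteq> ?M"
    proof
      fix U assume "U \<in> ?h ` ?C"
      then obtain a where a: "a \<in> A i" "compatible P leq q a" "U = ?h a" by blast
      then obtain w where w: "w \<in> P" "leq w q" "leq w a" by (auto simp: compatible_def)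
      have "w \<in> V" using down[OF Vc(1) q(1) w(1,2)] .
      moreover have "w \<in> ?h a"
        using w(1) refl trans[OF _ w(3)] unfolding reg_open_hull_def compatible_def by blast
      ultimately show "U \<in> ?M"
        using meet_ro[OF hc[of a] Vc(1)] a by (auto simp: bottom_ro)
    qed
    moreover have "inj_on ?h ?C"
      using maximal_disjoint_hulls(2)[OF leq A[OF i]] by (auto intro: inj_on_subset)
    ultimately have "|?C| \<le>o |?M|"
      using card_of_ordLeq by blast
    moreover have "|?M| \<le>o \<mu>"
      using Q(2) V i mu by (simp add: cardSuc_ordLeq_ordLess card_of_Card_order)
    ultimately show ?thesis by (rule ordLeq_transitive)
  qed
  with q(2) show ?thesis by blast
qed

section \<open>Sequences of antichains and chains through them\<close>

text \<open>\<open>R n p' p\<close> stands for "\<open>p'\<close> is a thinning of \<open>p\<close>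
  at stage \<open>n\<close>". By \<open>R_mono\<close> a thinning of a common extension of
  \<open>p\<close> and \<open>a\<close> is also a thinning of \<open>a\<close>; hence the thinnings
  of members of \<open>A n\<close> are dense, and \<open>A (Suc n)\<close> is chosen among
  them.\<close>

lemma refining_antichains:
  fixes R :: "nat \<Rightarrow> 'p \<Rightarrow> 'p \<Rightarrow> bool"
  assumes leq: "reflp leq" "transp leq"
    and R: "\<And>n p. p \<in> P \<Longrightarrow> \<exists>p' \<in> P. R n p' p"
    and R_le: "\<And>n p' p. R n p' p \<Longrightarrow> leq p' p"
    and R_mono: "\<And>n p' p a. p \<in> P \<Longrightarrow> a \<in> P \<Longrightarrow> R n p' p \<Longrightarrow> leq p a \<Longrightarrow> R n p' a"
  shows "\<exists>A. \<forall>n. max_antichain P leq (A n) \<and> (\<forall>a' \<in> A (Suc n). \<exists>a \<in> A n. R n a' a)"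
proof -
  note refl = reflpD[OF leq(1)] and trans = transpD[OF leq(2)]
  show ?thesis
  proof (rule dependent_nat_choice)
    have "\<exists>d \<in> P. leq d p" if "p \<in> P" for p
      using that refl[of p] by blast
    then obtain A where "max_antichain P leq A"
      using max_antichain_in_dense[OF leq order_refl] by metis
    then show "\<exists>A. max_antichain P leq A" ..
  next
    fix A n assume A: "max_antichain P leq A"
    let ?D = "{p' \<in> P. \<exists>a \<in> A. R n p' a}"
    have "\<exists>d \<in> ?D. leq d p" if p: "p \<in> P" for p
    proof -
      obtain a where a: "a \<in> A" "compatible P leq p a"
        using A p by (auto simp: max_antichain_def)
      then obtain w where w: "w \<in> P" "leq w p" "leq w a" by (auto simp: compatible_def)
      obtain p' where p': "p' \<in> P" "R n p' w" using R w by blast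
      moreover have "R n p' a" using R_mono[OF w(1) _ p'(2) w(3)] A a by (auto simp: max_antichain_def)
      moreover have "leq p' p" using R_le p' w trans by blast
      ultimately show ?thesis using a by blast
    qed
    then obtain B where "max_antichain P leq B" "B \<subseteq> ?D"
      by (rule max_antichain_in_dense[OF leq, of ?D P, rotated]) auto
    then show "\<exists>B. max_antichain P leq B \<and> (\<forall>a' \<in> B. \<exists>a \<in> A. R n a' a)" by blast
  qed
qed

lemma chain_through_antichains:
  fixes R :: "nat \<Rightarrow> 'p \<Rightarrow> 'p \<Rightarrow> bool"
  assumes leq: "reflp leq" "transp leq"
    and A: "\<And>n. max_antichain P leq (A n)"
    and RA: "\<And>n a'. a' \<in> A (Suc n) \<Longrightarrow> \<exists>a \<in> A n. R n a' a"
    and R_le: "\<And>n p' p. R n p' p \<Longrightarrow> leq p' p"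
    and q: "q \<in> P"
  shows "\<exists>w a. \<forall>n. w n \<in> P \<and> leq (w n) q \<and> leq (w n) (a n) \<and> a n \<in> A n \<and> R n (a (Suc n)) (a n)"
proof -
  note refl = reflpD[OF leq(1)] and trans = transpD[OF leq(2)]
  have "\<exists>z. \<forall>n. (fst (z n) \<in> P \<and> leq (fst (z n)) q \<and> snd (z n) \<in> A n \<and> leq (fst (z n)) (snd (z n))) \<and>
     leq (fst (z (Suc n))) (fst (z n))"
  proof (rule dependent_nat_choice)
    obtain a where "a \<in> A 0" "compatible P leq q a" using A q by (meson max_antichain_def)
    then show "\<exists>z. fst z \<in> P \<and> leq (fst z) q \<and> snd z \<in> A 0 \<and> leq (fst z) (snd z)"
      by (auto simp: compatible_def)
  next
    fix z :: "'p \<times> 'p" and n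
    assume z: "fst z \<in> P \<and> leq (fst z) q \<and> snd z \<in> A n \<and> leq (fst z) (snd z)"
    obtain a where "a \<in> A (Suc n)" "compatible P leq (fst z) a" using A z by (meson max_antichain_def)
    then obtain w where "w \<in> P" "leq w (fst z)" "leq w a" "a \<in> A (Suc n)" by (auto simp: compatible_def)
    moreover from this have "leq w q" using z trans by blast
    ultimately show "\<exists>y. (fst y \<in> P \<and> leq (fst y) q \<and> snd y \<in> A (Suc n) \<and> leq (fst y) (snd y)) \<and> leq (fst y) (fst z)"
      by auto
  qed
  then obtain z where z: "\<And>n. fst (z n) \<in> P" "\<And>n. leq (fst (z n)) q" "\<And>n. snd (z n) \<in> A n"
     "\<And>n. leq (fst (z n)) (snd (z n))" "\<And>n. leq (fst (z (Suc n))) (fst (z n))" by blast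
  have "R n (snd (z (Suc n))) (snd (z n))" for n
  proof -
    \<comment> \<open>The member of \<open>A n\<close> thinned by the next term of the chain might
      differ from the chosen one, but the next witness lies below both, so they are compatible and
      therefore equal.\<close>
    obtain a where a: "a \<in> A n" "R n (snd (z (Suc n))) a" using RA z by blast
    have "leq (fst (z (Suc n))) a" using a(2) R_le z(4) trans by blast
    moreover have "leq (fst (z (Suc n))) (snd (z n))" using z trans by blast
    ultimately have "compatible P leq a (snd (z n))" using z(1) unfolding compatible_def by blast
    then have "a = snd (z n)" using A[of n] a z(3) unfolding max_antichain_def by blast
    with a show ?thesis by simp
  qed
  with z show ?thesis by (intro exI[of _ "fst \<circ> z"] exI[of _ "snd \<circ> z"]) simp
qed

section \<open>Ordinals below a cardinal\<close>

locale well_ord =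
  fixes r :: "'a rel"
  assumes wo: "Well_order r"
begin

abbreviation lt :: "'a \<Rightarrow> 'a \<Rightarrow> bool" (infix "\<prec>" 50) where
  "a \<prec> b \<equiv> a \<in> underS r b"

lemma lt_Field: "a \<prec> b \<Longrightarrow> a \<in> Field r" "a \<prec> b \<Longrightarrow> b \<in> Field r"
  by (auto simp: underS_def Field_def)

lemma lt_irrefl: "\<not> a \<prec> a"
  by (simp add: underS_def)

lemma lt_trans: "a \<prec> b \<Longrightarrow> b \<prec> c \<Longrightarrow> a \<prec> c"
proof -
  assume "a \<prec> b" "b \<prec> c"
  moreover have "trans r" "antisym r" using wo by (auto simp: order_on_defs)
  ultimately show ?thesis
    using transD[of r a b c] antisymD[of r a b] by (auto simp: underS_def)
qed

lemma lt_linear: "a \<in> Field r \<Longrightarrow> b \<in> Field r \<Longrightarrow> a \<prec> b \<or> a = b \<or> b \<prec> a"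
  using wo by (auto simp: underS_def order_on_defs total_on_def)

lemma wf_lt: "wf {(a, b). a \<prec> b}"
proof -
  have "{(a, b). a \<prec> b} = r - Id" by (auto simp: underS_def)
  then show ?thesis using wo by (simp add: well_order_on_def)
qed

lemma ex_least:
  assumes "S \<subseteq> Field r" "S \<noteq> {}"
  shows "\<exists>m \<in> S. \<forall>x \<in> S. m = x \<or> m \<prec> x"
proof -
  obtain m where m: "m \<in> S" "\<And>y. y \<prec> m \<Longrightarrow> y \<notin> S"
    using wfE_min[OF wf_lt] assms(2) by (metis (no_types, lifting) case_prodI ex_in_conv mem_Collect_eq)
  moreover have "m = x \<or> m \<prec> x" if "x \<in> S" for x
    using m that lt_linear[of m x] assms(1) by blast
  ultimately show ?thesis by blast
qed

lemma underS_inj: "a \<in> Field r \<Longrightarrow> b \<in> Field r \<Longrightarrow> underS r a = underS r b \<Longrightarrow> a = b"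
  using lt_linear[of a b] lt_irrefl by blast

lemma underS_subset_iff:
  assumes "a \<in> Field r" "b \<in> Field r"
  shows "underS r a \<subseteq> underS r b \<longleftrightarrow> a = b \<or> a \<prec> b"
  using lt_linear[OF assms] lt_irrefl lt_trans[of _ a b] by blast

lemma Well_order_seg: "Well_order (seg r a)"
  using Well_order_Restr[OF wo] by (simp add: seg_def)

lemma in_seg: "(x, y) \<in> seg r a \<longleftrightarrow> (x = y \<or> x \<prec> y) \<and> y \<prec> a"
proof -
  have "(x, x) \<in> r" if "x \<in> Field r" for x
    using wo that by (auto simp: order_on_defs refl_on_def)
  then show ?thesis
    using lt_trans[of x y a] lt_Field[of y a] by (auto simp: seg_def underS_def)
qed

lemma underS_seg: "b \<prec> a \<Longrightarrow> underS (seg r a) b = underS r b"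
  by (auto simp: underS_def[of "seg r a"] in_seg lt_irrefl)

lemma seg_seg: "b \<prec> a \<Longrightarrow> seg (seg r a) b = seg r b"
  using lt_trans[of _ b a] lt_trans[of _ _ b] unfolding set_eq_iff split_paired_All seg_def[of "seg r a"]
  by (auto simp: underS_seg in_seg)

lemma limit_ord_seg: "d \<prec> a \<Longrightarrow> limit_ord (seg r a) d \<longleftrightarrow> limit_ord r d"
proof -
  assume d: "d \<prec> a"
  have "underS (seg r a) c = underS r c" if "c \<prec> d" for c
    using underS_seg lt_trans[OF that d] .
  then show ?thesis
    using d lt_Field(1)[OF d] by (simp add: limit_ord_def Field_seg[OF wo] underS_seg)
qed

lemma cofinal_seg: "cofinal K (seg r a) \<longleftrightarrow> (\<forall>x. x \<prec> a \<longrightarrow> (\<exists>y \<in> K. x \<prec> y \<and> y \<prec> a))"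
proof -
  have "x \<noteq> y \<and> (x, y) \<in> seg r a \<longleftrightarrow> x \<prec> y \<and> y \<prec> a" for x y
    using in_seg lt_irrefl by auto
  then show ?thesis unfolding cofinal_def Field_seg[OF wo] Ball_def by simp
qed

definition sc :: "'a \<Rightarrow> 'a" where
  "sc a = (THE b. b \<in> Field r \<and> underS r b = insert a (underS r a))"

lemma sc:
  assumes "a \<prec> c"
  shows "underS r (sc a) = insert a (underS r a)" "sc a \<in> Field r" "sc a = c \<or> sc a \<prec> c"
proof -
  have "{b. a \<prec> b} \<subseteq> Field r" "{b. a \<prec> b} \<noteq> {}" using assms lt_Field by auto
  from ex_least[OF this] obtain m where m: "a \<prec> m" "\<And>x. a \<prec> x \<Longrightarrow> m = x \<or> m \<prec> x"
    by auto
  have "x = a \<or> x \<prec> a" if "x \<prec> m" for x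
    using that m lt_linear[of x a] lt_Field lt_irrefl lt_trans by metis
  then have u: "underS r m = insert a (underS r a)"
    using m(1) lt_trans by auto
  have "sc a = m" unfolding sc_def
    using u lt_Field m(1) underS_inj by (intro the_equality) metis+
  then show "underS r (sc a) = insert a (underS r a)" "sc a \<in> Field r" "sc a = c \<or> sc a \<prec> c"
    using u m assms lt_Field(2)[OF m(1)] by auto
qed

lemma lt_sc: "a \<prec> c \<Longrightarrow> a \<prec> sc a"
  using sc(1) by blast

lemma ordinal_cases:
  assumes "d \<in> Field r"
  obtains "underS r d = {}" | e where "e \<prec> d" "d = sc e" | "limit_ord r d"
proof (cases "underS r d = {} \<or> limit_ord r d")
  case False
  then obtain e where e: "e \<prec> d" "\<And>c. c \<prec> d \<Longrightarrow> \<not> e \<prec> c"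
    using assms unfolding limit_ord_def by blast
  then have "d = sc e" using sc[OF e(1)] lt_sc[OF e(1)] by blast
  then show ?thesis using that e by blast
qed (use that in blast)

text \<open>\<open>d\<close> is the supremum of \<open>K\<close>. As \<open>K\<close> has no
  maximum, everything below \<open>d\<close> is below a member of \<open>K\<close>, which makes
  \<open>d\<close> a limit.\<close>

lemma lt_sup:
  assumes "K \<subseteq> underS r a" "K \<noteq> {}" "\<And>x. x \<in> K \<Longrightarrow> \<exists>y \<in> K. x \<prec> y" "b \<prec> a" "\<And>x. x \<in> K \<Longrightarrow> x \<prec> b"
  shows "\<exists>d. limit_ord r d \<and> (d = b \<or> d \<prec> b) \<and> (\<forall>x \<in> K. x \<prec> d) \<and> (\<forall>x. x \<prec> d \<longrightarrow> (\<exists>y \<in> K. x \<prec> y))"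
proof -
  let ?S = "{d \<in> Field r. \<forall>x \<in> K. x \<prec> d}"
  have "b \<in> ?S" using assms lt_Field by blast
  then obtain d where d: "d \<in> ?S" "\<And>x. x \<in> ?S \<Longrightarrow> d = x \<or> d \<prec> x"
    using ex_least[of ?S] by blast
  have ub: "\<exists>y \<in> K. x \<prec> y" if "x \<prec> d" for x
  proof -
    have "x \<notin> ?S" using that d(2) lt_trans lt_irrefl by blast
    moreover have "x \<in> Field r" using that lt_Field by blast
    ultimately obtain y where "y \<in> K" "\<not> y \<prec> x" by blast
    then have "x = y \<or> x \<prec> y" using lt_linear[of x y] that assms(1) lt_Field by blast
    then show ?thesis using assms(3) \<open>y \<in> K\<close> lt_trans by blast
  qed
  moreover have "limit_ord r d"
    using ub d(1) assms(2) unfolding limit_ord_def by blast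
  ultimately show ?thesis using d \<open>b \<in> ?S\<close> by blast
qed

lemma card_of_underS:
  assumes "Card_order (seg r a)" "b \<prec> a"
  shows "|underS r b| <o seg r a"
  using BNF_Cardinal_Order_Relation.card_of_underS[of "seg r a" b] assms
  by (simp add: Field_seg[OF wo] underS_seg)

lemma seg_less:
  assumes "Card_order (seg r a)" "Card_order (seg r b)" "b \<prec> a"
  shows "seg r b <o seg r a"
  using card_of_underS[OF assms(1,3)] card_of_Field_ordIso[OF assms(2)]
  unfolding Field_seg[OF wo] by (rule ordIso_ordLess_trans[rotated, OF _ ordIso_symmetric])

lemma seg_le:
  assumes "Card_order (seg r a)" "Card_order (seg r b)" "b = a \<or> b \<prec> a"
  shows "seg r b \<le>o seg r a"
  using seg_less[of a b] assms ordLess_imp_ordLeq ordLeq_reflexive[OF Well_order_seg] by blast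

lemma card_of_underS_eq: "Card_order (seg r a) \<Longrightarrow> |underS r a| =o seg r a"
  using card_of_Field_ordIso[of "seg r a"] by (simp add: Field_seg[OF wo])

lemma inf_card_limit:
  assumes "Card_order (seg r a)" "infinite (underS r a)" "b \<prec> a"
  obtains c where "b \<prec> c" "c \<prec> a"
  using infinite_Card_order_limit[of "seg r a" b] assms that
  by (auto simp: Field_seg[OF wo] in_seg)

lemma regular_bounded:
  assumes "regular_inf_card (seg r a)" "K \<subseteq> underS r a" "|K| <o seg r a"
  shows "\<exists>b. b \<prec> a \<and> (\<forall>x \<in> K. x \<prec> b)"
proof -
  have c: "Card_order (seg r a)" "infinite (underS r a)" "regularCard (seg r a)"
    using assms(1) by (auto simp: regular_inf_card_def Field_seg[OF wo])
  have "\<not> cofinal K (seg r a)"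
    using c(3) assms(2,3) not_ordLess_ordIso by (auto simp: regularCard_def Field_seg[OF wo])
  then obtain x where x: "x \<prec> a" "\<And>y. y \<in> K \<Longrightarrow> \<not> x \<prec> y"
    using assms(2) unfolding cofinal_seg by blast
  \<comment> \<open>Failure of cofinality gives only the weak bound \<open>x\<close>; one more step
    up makes it strict.\<close>
  obtain b where b: "x \<prec> b" "b \<prec> a" using inf_card_limit[OF c(1,2) x(1)] .
  have "y \<prec> b" if "y \<in> K" for y
  proof -
    have "y \<in> Field r" "x \<in> Field r" using assms(2) that x lt_Field by blast+
    then have "y \<prec> x \<or> y = x" using lt_linear x(2) that by blast
    then show ?thesis using b lt_trans by blast
  qed
  with b(2) show ?thesis by blast
qed

lemma cofinal_card:
  assumes "regular_inf_card (seg r a)" "K \<subseteq> underS r a" "\<And>b. b \<prec> a \<Longrightarrow> \<exists>x \<in> K. \<not> x \<prec> b"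
  shows "|K| =o seg r a"
proof (rule ccontr)
  have c: "Card_order (seg r a)" using assms(1) by (auto simp: regular_inf_card_def)
  assume n: "\<not> ?thesis"
  have "|K| \<le>o seg r a"
    using card_of_mono1[OF assms(2)] card_of_underS_eq[OF c] ordLeq_ordIso_trans by blast
  then have "|K| <o seg r a" using n ordLeq_iff_ordLess_or_ordIso by blast
  then show False using regular_bounded[OF assms(1,2)] assms(3) by blast
qed

end

section \<open>Clubs and stationary sets\<close>

lemma card_of_Times_self_ordLess_infinite:
  assumes c: "Card_order c" "infinite (Field c)" and A: "|A| <o c"
  shows "|A \<times> A| <o c"
proof (cases "finite A")
  case True
  then have "finite (A \<times> A)" by simp
  then show ?thesis
    using finite_ordLess_infinite[OF card_of_Well_order card_order_on_well_order_on[OF c(1)], of "A \<times> A"] c(2)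
    by (simp add: Field_card_of)
next
  case False
  then have "|A \<times> A| =o |A|" by (rule card_of_Times_same_infinite)
  then show ?thesis using A ordIso_ordLess_trans by blast
qed

context well_ord
begin

lemma infinite_no_max:
  assumes "K \<noteq> {}" "\<And>x. x \<in> K \<Longrightarrow> \<exists>y \<in> K. x \<prec> y"
  shows "infinite K"
proof
  assume "finite K"
  then have "\<exists>m \<in> K. \<forall>x \<in> K. \<not> m \<prec> x"
    using assms(1)
  proof (induction K rule: finite_ne_induct)
    case (singleton x)
    then show ?case using lt_irrefl by blast
  next
    case (insert x F)
    then obtain m where m: "m \<in> F" "\<forall>y \<in> F. \<not> m \<prec> y" by blast
    show ?case
    proof (cases "m \<prec> x")
      case True
      then show ?thesis using m lt_trans[of m x] lt_irrefl by blast
    next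
      case False
      then show ?thesis using m by blast
    qed
  qed
  then show False using assms(2) by blast
qed

text \<open>A countable range is bounded below an uncountable regular cardinal. Its supremum has
  cofinality omega because every cofinal subset of a limit is infinite.\<close>

lemma regular_uncountable_sup:
  assumes reg: "regular_inf_card (seg r a)" and unc: "natLeq <o seg r a"
    and x: "\<And>n :: nat. x n \<prec> a" "\<And>n. x n \<prec> x (Suc n)"
  shows "\<exists>d. d \<prec> a \<and> limit_ord r d \<and> (\<forall>n. x n \<prec> d) \<and> (\<forall>y. y \<prec> d \<longrightarrow> (\<exists>n. y \<prec> x n)) \<and>
    has_cof (seg r d) natLeq"
proof -
  have "|range x| \<le>o |UNIV :: nat set|" by (rule card_of_image)
  then have le: "|range x| \<le>o natLeq" using card_of_nat ordLeq_ordIso_trans by blast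
  then have "|range x| <o seg r a" using unc ordLeq_ordLess_trans by blast
  then obtain b where b: "b \<prec> a" "\<And>n. x n \<prec> b"
    using regular_bounded[OF reg, of "range x"] x(1) by auto
  obtain d where d: "limit_ord r d" "d = b \<or> d \<prec> b" "\<And>n. x n \<prec> d" "\<And>y. y \<prec> d \<Longrightarrow> \<exists>n. y \<prec> x n"
    using lt_sup[of "range x" a b] x b by auto
  have inf: "infinite K" if K: "K \<subseteq> underS r d" "cofinal K (seg r d)" for K
  proof (rule infinite_no_max)
    show "K \<noteq> {}" using K(2) d(3) unfolding cofinal_seg by blast
    show "\<exists>y \<in> K. z \<prec> y" if "z \<in> K" for z using K that unfolding cofinal_seg by blast
  qed
  have cof: "range x \<subseteq> underS r d" "cofinal (range x) (seg r d)"
    using d(3,4) unfolding cofinal_seg by auto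
  have "has_cof (seg r d) natLeq"
    unfolding has_cof_def Field_seg[OF wo]
  proof (intro conjI allI impI)
    show "Card_order natLeq" by (rule natLeq_Card_order)
    have "natLeq \<le>o |range x|" using inf[OF cof] infinite_iff_natLeq_ordLeq by blast
    then show "\<exists>K \<subseteq> underS r d. cofinal K (seg r d) \<and> |K| =o natLeq"
      using cof le ordIso_iff_ordLeq by blast
    show "natLeq \<le>o |K|" if "K \<subseteq> underS r d" "cofinal K (seg r d)" for K
      using inf[OF that] infinite_iff_natLeq_ordLeq by blast
  qed
  moreover have "d \<prec> a" using b(1) d(2) lt_trans by blast
  ultimately show ?thesis using d by blast
qed

text \<open>Eliminates the segment of a segment from the closure clause, so that clubs are handled
  in the order of \<open>r\<close> alone.\<close>

lemma club_in_seg: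
  "club_in (seg r a) C \<longleftrightarrow> C \<subseteq> underS r a \<and> (\<forall>x. x \<prec> a \<longrightarrow> (\<exists>y \<in> C. x \<prec> y)) \<and>
     (\<forall>d. d \<prec> a \<longrightarrow> limit_ord r d \<longrightarrow> (\<forall>x. x \<prec> d \<longrightarrow> (\<exists>y \<in> C. x \<prec> y \<and> y \<prec> d)) \<longrightarrow> d \<in> C)"
proof -
  have "d \<in> underS r a \<Longrightarrow> (limit_ord (seg r a) d \<and> cofinal (C \<inter> underS (seg r a) d) (seg (seg r a) d)) \<longleftrightarrow>
     limit_ord r d \<and> (\<forall>x. x \<prec> d \<longrightarrow> (\<exists>y \<in> C. x \<prec> y \<and> y \<prec> d))" for d
    by (auto simp: limit_ord_seg underS_seg seg_seg cofinal_seg)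
  then have cl: "(\<forall>d \<in> underS r a. limit_ord (seg r a) d \<and> cofinal (C \<inter> underS (seg r a) d) (seg (seg r a) d) \<longrightarrow> d \<in> C)
    \<longleftrightarrow> (\<forall>d. d \<prec> a \<longrightarrow> limit_ord r d \<longrightarrow> (\<forall>x. x \<prec> d \<longrightarrow> (\<exists>y \<in> C. x \<prec> y \<and> y \<prec> d)) \<longrightarrow> d \<in> C)"
    by blast
  have "C \<subseteq> underS r a \<Longrightarrow> cofinal C (seg r a) \<longleftrightarrow> (\<forall>x. x \<prec> a \<longrightarrow> (\<exists>y \<in> C. x \<prec> y))"
    unfolding cofinal_seg by blast
  then show ?thesis
    unfolding club_in_def Field_seg[OF wo] cl by blast
qed

text \<open>Closing off: the values of \<open>g\<close> on pairs below \<open>w\<close> are fewer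
  than the regular cardinal, hence bounded, and omega many such steps lead to a closure point above
  any given \<open>z\<close>.\<close>

lemma club_closure_points:
  assumes reg: "regular_inf_card (seg r a)" and unc: "natLeq <o seg r a"
    and g: "\<And>c x. c \<prec> a \<Longrightarrow> x \<prec> a \<Longrightarrow> g c x \<prec> a"
  shows "club_in (seg r a) {d. d \<prec> a \<and> limit_ord r d \<and> (\<forall>c x. c \<prec> d \<longrightarrow> x \<prec> d \<longrightarrow> g c x \<prec> d)}"
    (is "club_in _ ?D")
  unfolding club_in_seg
proof (intro conjI allI impI)
  show "?D \<subseteq> underS r a" by blast
  have c: "Card_order (seg r a)" "infinite (underS r a)"
    using reg by (auto simp: regular_inf_card_def Field_seg[OF wo])
  fix z assume z: "z \<prec> a"
  have step: "\<exists>w'. w' \<prec> a \<and> w \<prec> w' \<and> (\<forall>c x. c \<prec> w \<longrightarrow> x \<prec> w \<longrightarrow> g c x \<prec> w')" if w: "w \<prec> a" for w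
  proof -
    let ?K = "insert w ((\<lambda>(c, x). g c x) ` (underS r w \<times> underS r w))"
    have "|underS r w| <o seg r a" using card_of_underS[OF c(1) w] .
    then have "|underS r w \<times> underS r w| <o seg r a"
      using card_of_Times_self_ordLess_infinite[of "seg r a"] c by (simp add: Field_seg[OF wo])
    then have "|(\<lambda>(c, x). g c x) ` (underS r w \<times> underS r w)| <o seg r a"
      using card_of_image ordLeq_ordLess_trans by blast
    moreover have "|{w}| <o seg r a"
      using finite_ordLess_infinite[OF card_of_Well_order Well_order_seg, of "{w}"] c(2)
      by (simp add: Field_card_of Field_seg[OF wo])
    ultimately have "|?K| <o seg r a"
      using card_of_Un_ordLess_infinite_Field[of "seg r a" "{w}"] c by (simp add: Field_seg[OF wo])
    moreover have "?K \<subseteq> underS r a" using w g lt_trans by auto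
    ultimately obtain b where "b \<prec> a" "\<forall>x \<in> ?K. x \<prec> b"
      using regular_bounded[OF reg] by blast
    then show ?thesis by (intro exI[of _ b]) auto
  qed
  have "\<exists>s. \<forall>n :: nat. (s n \<prec> a \<and> (n = 0 \<longrightarrow> s n = z)) \<and>
     (s n \<prec> s (Suc n) \<and> (\<forall>c x. c \<prec> s n \<longrightarrow> x \<prec> s n \<longrightarrow> g c x \<prec> s (Suc n)))"
    by (rule dependent_nat_choice) (use z step in auto)
  then obtain s where s: "\<And>n :: nat. s n \<prec> a" "s 0 = z" "\<And>n. s n \<prec> s (Suc n)"
     "\<And>n c x. c \<prec> s n \<Longrightarrow> x \<prec> s n \<Longrightarrow> g c x \<prec> s (Suc n)" by blast
  obtain d where d: "d \<prec> a" "limit_ord r d" "\<And>n. s n \<prec> d" "\<And>y. y \<prec> d \<Longrightarrow> \<exists>n. y \<prec> s n"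
    using regular_uncountable_sup[OF reg unc, of s] s by blast
  have mono: "y \<prec> s (n + m)" if "y \<prec> s n" for y n m
  proof (induction m)
    case (Suc m)
    then show ?case using s(3)[of "n + m"] lt_trans by auto
  qed (use that in simp)
  have "g c x \<prec> d" if "c \<prec> d" "x \<prec> d" for c x
  proof -
    obtain n m where "c \<prec> s n" "x \<prec> s m" using d(4) \<open>c \<prec> d\<close> \<open>x \<prec> d\<close> by blast
    then have "c \<prec> s (n + m)" "x \<prec> s (n + m)" using mono[of c n m] mono[of x m n] by (auto simp: add.commute)
    then show ?thesis using s(4) d(3) lt_trans by blast
  qed
  then show "\<exists>y \<in> ?D. z \<prec> y" using d s(2) by blast
next
  fix d assume d: "d \<prec> a" "limit_ord r d" and cof: "\<forall>x. x \<prec> d \<longrightarrow> (\<exists>y \<in> ?D. x \<prec> y \<and> y \<prec> d)"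
  have "g c x \<prec> d" if cx: "c \<prec> d" "x \<prec> d" for c x
  proof -
    obtain e where e: "e \<prec> d" "c = e \<or> c \<prec> e" "x = e \<or> x \<prec> e"
      using lt_linear[of c x] cx lt_Field by metis
    then obtain y where y: "y \<in> ?D" "e \<prec> y" "y \<prec> d" using cof by blast
    have "c \<prec> y" "x \<prec> y" using e y lt_trans by blast+
    then show ?thesis using y lt_trans by blast
  qed
  then show "d \<in> ?D" using d by blast
qed

lemma stationary_meets:
  "stationary_in (seg r a) S \<Longrightarrow> club_in (seg r a) C \<Longrightarrow> \<exists>x \<in> S. x \<in> C"
  unfolding stationary_in_def by blast

text \<open>The final segment above \<open>b\<close> is a club.\<close>

lemma stationary_unbounded:
  assumes reg: "regular_inf_card (seg r a)" and S: "stationary_in (seg r a) S" and b: "b \<prec> a"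
  shows "\<exists>x \<in> S. b \<prec> x"
proof -
  have c: "Card_order (seg r a)" "infinite (underS r a)"
    using reg by (auto simp: regular_inf_card_def Field_seg[OF wo])
  have "club_in (seg r a) {x. x \<prec> a \<and> b \<prec> x}"
    unfolding club_in_seg
  proof (intro conjI allI impI)
    fix x assume x: "x \<prec> a"
    obtain e where e: "e \<prec> a" "b = e \<or> b \<prec> e" "x = e \<or> x \<prec> e"
      using lt_linear[of b x] b x lt_Field by metis
    obtain y where y: "e \<prec> y" "y \<prec> a" using inf_card_limit[OF c e(1)] .
    then have "b \<prec> y" "x \<prec> y" using e lt_trans by blast+
    then show "\<exists>y \<in> {x. x \<prec> a \<and> b \<prec> x}. x \<prec> y" using y by blast
  next
    fix d assume d: "d \<prec> a" "limit_ord r d" "\<forall>x. x \<prec> d \<longrightarrow> (\<exists>y\<in>{x. x \<prec> a \<and> b \<prec> x}. x \<prec> y \<and> y \<prec> d)"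
    from d(2) obtain z where "z \<prec> d" unfolding limit_ord_def by blast
    then show "d \<in> {x. x \<prec> a \<and> b \<prec> x}" using d lt_trans by blast
  qed blast
  then show ?thesis using stationary_meets[OF S] by blast
qed

lemma stationary_subset: "stationary_in (seg r a) S \<Longrightarrow> S \<subseteq> underS r a"
  by (simp add: stationary_in_def Field_seg[OF wo])

lemma stationary_card:
  assumes reg: "regular_inf_card (seg r a)" and S: "stationary_in (seg r a) S"
  shows "|S| =o seg r a"
proof (rule cofinal_card[OF reg stationary_subset[OF S]])
  fix b assume "b \<prec> a"
  then obtain x where "x \<in> S" "b \<prec> x" using stationary_unbounded[OF reg S] by blast
  then show "\<exists>x \<in> S. \<not> x \<prec> b" using lt_trans lt_irrefl by blast
qed

text \<open>Fodor's lemma, with closure points in place of a diagonal intersection. Suppose that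
  each value \<open>c\<close> is avoided on a club \<open>C c\<close>, and let \<open>g c x\<close>
  be an element of \<open>C c\<close> above \<open>x\<close>. A point \<open>x\<close> of
  \<open>S\<close> closed under \<open>g\<close> is a limit of \<open>C (f x)\<close> since
  \<open>f x\<close> is below \<open>x\<close>; so it belongs to \<open>C (f x)\<close>, where the
  value \<open>f x\<close> is forbidden.\<close>

lemma pressing_down:
  assumes reg: "regular_inf_card (seg r a)" and unc: "natLeq <o seg r a"
    and S: "stationary_in (seg r a) S" and f: "\<And>x. x \<in> S \<Longrightarrow> f x \<prec> x"
  shows "\<exists>c. c \<prec> a \<and> stationary_in (seg r a) {x \<in> S. f x = c}"
proof (rule ccontr)
  assume no: "\<not> ?thesis"
  have "\<exists>C. club_in (seg r a) C \<and> (\<forall>x \<in> S \<inter> C. f x \<noteq> c)" if "c \<prec> a" for c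
    using no that stationary_subset[OF S] unfolding stationary_in_def Field_seg[OF wo] by blast
  then obtain C where C: "\<And>c. c \<prec> a \<Longrightarrow> club_in (seg r a) (C c)"
     "\<And>c x. c \<prec> a \<Longrightarrow> x \<in> S \<Longrightarrow> x \<in> C c \<Longrightarrow> f x \<noteq> c" by (metis IntI)
  have "\<exists>y. c \<prec> a \<longrightarrow> x \<prec> a \<longrightarrow> y \<in> C c \<and> x \<prec> y \<and> y \<prec> a" for c x
    using C(1)[of c] unfolding club_in_seg by blast
  then obtain g where g: "\<And>c x. c \<prec> a \<Longrightarrow> x \<prec> a \<Longrightarrow> g c x \<in> C c \<and> x \<prec> g c x \<and> g c x \<prec> a"
    by metis
  then have "club_in (seg r a) {d. d \<prec> a \<and> limit_ord r d \<and> (\<forall>c x. c \<prec> d \<longrightarrow> x \<prec> d \<longrightarrow> g c x \<prec> d)}"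
    using club_closure_points[OF reg unc, of g] by blast
  then obtain x where x: "x \<in> S" "x \<prec> a" "limit_ord r x" "\<And>c y. c \<prec> x \<Longrightarrow> y \<prec> x \<Longrightarrow> g c y \<prec> x"
    using stationary_meets[OF S] by blast
  have fx: "f x \<prec> x" using f x(1) by blast
  then have fa: "f x \<prec> a" using x(2) lt_trans by blast
  have "x \<in> C (f x)"
  proof -
    have "\<exists>z \<in> C (f x). y \<prec> z \<and> z \<prec> x" if "y \<prec> x" for y
      using g[OF fa, of y] x(4)[OF fx that] lt_trans[OF that x(2)] by blast
    then show ?thesis using C(1)[OF fa] x(2,3) unfolding club_in_seg by blast
  qed
  then show False using C(2)[OF fa x(1)] by blast
qed

text \<open>A club contains an increasing omega-sequence and hence its supremum, which has
  cofinality omega.\<close>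

lemma cof_omega_below_stationary:
  assumes reg: "regular_inf_card (seg r a)" and unc: "natLeq <o seg r a"
  shows "stationary_in (seg r a) (cof_omega_below r a)"
  unfolding stationary_in_def
proof (intro conjI allI impI)
  show "cof_omega_below r a \<subseteq> Field (seg r a)" by (auto simp: cof_omega_below_def Field_seg[OF wo])
  fix C assume "club_in (seg r a) C"
  then have C: "C \<subseteq> underS r a" "\<And>x. x \<prec> a \<Longrightarrow> \<exists>y \<in> C. x \<prec> y"
    "\<And>d. d \<prec> a \<Longrightarrow> limit_ord r d \<Longrightarrow> (\<And>x. x \<prec> d \<Longrightarrow> \<exists>y \<in> C. x \<prec> y \<and> y \<prec> d) \<Longrightarrow> d \<in> C"
    unfolding club_in_seg by blast+
  have "infinite (underS r a)" using reg by (auto simp: regular_inf_card_def Field_seg[OF wo])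
  then obtain z where "z \<prec> a" by (metis ex_in_conv finite.emptyI)
  then obtain y0 where y0: "y0 \<in> C" using C(2) by blast
  have "\<exists>s. \<forall>n :: nat. s n \<in> C \<and> s n \<prec> s (Suc n)"
    by (rule dependent_nat_choice) (use y0 C(1,2) in auto)
  then obtain s where s: "\<And>n :: nat. s n \<in> C" "\<And>n. s n \<prec> s (Suc n)" by blast
  obtain d where d: "d \<prec> a" "limit_ord r d" "\<And>n. s n \<prec> d" "\<And>y. y \<prec> d \<Longrightarrow> \<exists>n. y \<prec> s n" "has_cof (seg r d) natLeq"
    using regular_uncountable_sup[OF reg unc, of s] s C(1) by blast
  have "d \<in> C" using C(3)[OF d(1,2)] d(3,4) s(1) by blast
  then show "cof_omega_below r a \<inter> C \<noteq> {}" using d by (auto simp: cof_omega_below_def)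
qed

text \<open>An enumeration of a countable cofinal set; it need not be increasing.\<close>

lemma omega_sequence:
  assumes "has_cof (seg r b) natLeq"
  shows "\<exists>e :: nat \<Rightarrow> 'a. (\<forall>n. e n \<prec> b) \<and> (\<forall>x. x \<prec> b \<longrightarrow> (\<exists>n. x \<prec> e n))"
proof -
  obtain K where K: "K \<subseteq> underS r b" "cofinal K (seg r b)" "|K| =o natLeq"
    using assms by (auto simp: has_cof_def Field_seg[OF wo])
  have "|UNIV :: nat set| =o |K|"
    using K(3) card_of_nat ordIso_symmetric ordIso_transitive by blast
  then obtain e where "bij_betw e (UNIV :: nat set) K" using card_of_ordIso by blast
  then have "range e = K" by (simp add: bij_betw_def)
  then show ?thesis using K(1,2) unfolding cofinal_seg by (intro exI[of _ e]) blast
qed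

text \<open>A point of cofinality omega already has infinitely many predecessors. This makes Fodor's
  lemma applicable at every stationary branching node, without looking at its height.\<close>

lemma stationary_cof_omega_uncountable:
  assumes reg: "regular_inf_card (seg r a)" and S: "stationary_in (seg r a) S" "S \<subseteq> cof_omega_below r a"
  shows "natLeq <o seg r a"
proof -
  have c: "Card_order (seg r a)" "infinite (underS r a)"
    using reg by (auto simp: regular_inf_card_def Field_seg[OF wo])
  then obtain z where "z \<prec> a" by (metis ex_in_conv finite.emptyI)
  then obtain b where b: "b \<in> S" using stationary_unbounded[OF reg S(1)] by blast
  then have "b \<prec> a" "has_cof (seg r b) natLeq" using S(2) by (auto simp: cof_omega_below_def)
  moreover from this obtain K where "K \<subseteq> underS r b" "|K| =o natLeq"
    by (auto simp: has_cof_def Field_seg[OF wo])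
  then have "natLeq \<le>o |underS r b|"
    using card_of_mono1 ordIso_symmetric ordIso_ordLeq_trans by blast
  ultimately show ?thesis using card_of_underS[OF c(1)] ordLeq_ordLess_trans by blast
qed

end

section \<open>Ranks in sets of ordinals\<close>

context well_ord
begin

definition increasing_on :: "'a set \<Rightarrow> ('a \<Rightarrow> 'a) \<Rightarrow> bool" where
  "increasing_on Y f \<longleftrightarrow> (\<forall>x \<in> Y. f x \<in> Field r) \<and> (\<forall>x \<in> Y. \<forall>y \<in> Y. x \<prec> y \<longrightarrow> f x \<prec> f y)"

text \<open>The least value at \<open>y\<close> of an increasing map is the order type of the part of \<open>Y\<close> below \<open>y\<close>;
  this form makes the comparison of different sets \<open>Y\<close> immediate.\<close>

definition min_rank :: "'a set \<Rightarrow> 'a \<Rightarrow> 'a" where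
  "min_rank Y y = (SOME m. (\<exists>f. increasing_on Y f \<and> f y = m) \<and>
     (\<forall>f. increasing_on Y f \<longrightarrow> m = f y \<or> m \<prec> f y))"

lemma min_rank:
  assumes "Y \<subseteq> Field r" "y \<in> Y"
  shows "\<exists>f. increasing_on Y f \<and> f y = min_rank Y y"
    and "increasing_on Y f \<Longrightarrow> min_rank Y y = f y \<or> min_rank Y y \<prec> f y"
proof -
  let ?V = "{f y |f. increasing_on Y f}"
  have "increasing_on Y (\<lambda>x. x)" using assms(1) by (auto simp: increasing_on_def)
  then have "?V \<noteq> {}" by blast
  moreover have "?V \<subseteq> Field r" using assms(2) by (auto simp: increasing_on_def)
  ultimately obtain m where "m \<in> ?V" "\<forall>x \<in> ?V. m = x \<or> m \<prec> x" using ex_least[of ?V] by auto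
  then have "(\<exists>f. increasing_on Y f \<and> f y = m) \<and> (\<forall>f. increasing_on Y f \<longrightarrow> m = f y \<or> m \<prec> f y)"
    by auto
  then have *: "(\<exists>f. increasing_on Y f \<and> f y = min_rank Y y) \<and>
      (\<forall>f. increasing_on Y f \<longrightarrow> min_rank Y y = f y \<or> min_rank Y y \<prec> f y)"
    unfolding min_rank_def by (rule someI)
  show "\<exists>f. increasing_on Y f \<and> f y = min_rank Y y" using * by (rule conjunct1)
  show "increasing_on Y f \<Longrightarrow> min_rank Y y = f y \<or> min_rank Y y \<prec> f y" using * by simp
qed

text \<open>An increasing map that is optimal for \<open>Y\<close> restricts to a competitor on
  \<open>Y'\<close>.\<close>

lemma min_rank_mono:
  assumes "Y \<subseteq> Field r" "Y' \<subseteq> Y" "y \<in> Y'"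
  shows "min_rank Y' y = min_rank Y y \<or> min_rank Y' y \<prec> min_rank Y y"
proof -
  obtain f where f: "increasing_on Y f" "f y = min_rank Y y"
    using min_rank(1)[of Y y] assms by auto
  then have "increasing_on Y' f" using assms(2) by (auto simp: increasing_on_def)
  then show ?thesis using min_rank(2)[of Y' y f] assms f(2) by auto
qed

text \<open>The elements of successor rank in the induced well-order of \<open>Y\<close>.\<close>

definition succ_points :: "'a set \<Rightarrow> 'a set" where
  "succ_points Y = {s \<in> Y. \<exists>z \<in> Y. z \<prec> s \<and> (\<forall>w \<in> Y. w \<prec> s \<longrightarrow> w = z \<or> w \<prec> z)}"

lemma succ_points_subset: "succ_points Y \<subseteq> Y"
  by (auto simp: succ_points_def)

text \<open>Let \<open>f\<close> be optimal for \<open>Y\<close> at \<open>s\<close>, and let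
  \<open>p\<close> send a successor point to its immediate predecessor in \<open>Y\<close>. For
  successor points x below y, p x is below x and x is at most p y, so \<open>p\<close> is
  increasing. Thus \<open>f\<close> after \<open>p\<close> competes on the successor points, and its
  value at \<open>s\<close> is below \<open>f s\<close>.\<close>

lemma min_rank_succ_points:
  assumes Y: "Y \<subseteq> Field r" and s: "s \<in> succ_points Y"
  shows "min_rank (succ_points Y) s \<prec> min_rank Y s"
proof -
  have "\<forall>x \<in> succ_points Y. \<exists>z. z \<in> Y \<and> z \<prec> x \<and> (\<forall>w \<in> Y. w \<prec> x \<longrightarrow> w = z \<or> w \<prec> z)"
    by (auto simp: succ_points_def)
  then obtain p where p: "\<And>x. x \<in> succ_points Y \<Longrightarrow> p x \<in> Y" "\<And>x. x \<in> succ_points Y \<Longrightarrow> p x \<prec> x"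
    "\<And>x w. x \<in> succ_points Y \<Longrightarrow> w \<in> Y \<Longrightarrow> w \<prec> x \<Longrightarrow> w = p x \<or> w \<prec> p x"
    by metis
  have sY: "s \<in> Y" using s succ_points_subset by blast
  obtain f where f: "increasing_on Y f" "f s = min_rank Y s" using min_rank(1)[OF Y sY] by blast
  have pm: "p x \<prec> p y" if "x \<in> succ_points Y" "y \<in> succ_points Y" "x \<prec> y" for x y
  proof -
    have "x \<in> Y" using that succ_points_subset by blast
    then have "x = p y \<or> x \<prec> p y" using p(3)[OF that(2) _ that(3)] by blast
    then show ?thesis using p(2)[OF that(1)] lt_trans[of "p x" x "p y"] by auto
  qed
  have "increasing_on (succ_points Y) (\<lambda>x. f (p x))"
    using f(1) p(1) pm by (simp add: increasing_on_def)
  then have "min_rank (succ_points Y) s = f (p s) \<or> min_rank (succ_points Y) s \<prec> f (p s)"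
    using min_rank(2)[of "succ_points Y" s "\<lambda>x. f (p x)"] s Y succ_points_subset[of Y] by auto
  moreover have "f (p s) \<prec> f s" using f(1) p(1,2)[OF s] sY by (simp add: increasing_on_def)
  ultimately show ?thesis using f(2) lt_trans[of _ "f (p s)" "f s"] by auto
qed

text \<open>Sending a point to the next element of \<open>Y\<close> is injective into the successor
  points; it is defined except at a possible maximum, and removing one point from an infinite set
  does not change its size.\<close>

lemma succ_points_card:
  assumes Y: "Y \<subseteq> Field r" and inf: "infinite Y"
  shows "|succ_points Y| =o |Y|"
proof -
  define M where "M = {y \<in> Y. \<forall>w \<in> Y. \<not> y \<prec> w}"
  have "finite M"
  proof (cases "M = {}")
    case False
    then obtain m where m: "m \<in> M" by blast
    have "x = m" if "x \<in> M" for x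
      using lt_linear[of x m] that m Y unfolding M_def by auto
    then have "M \<subseteq> {m}" by blast
    then show ?thesis using finite_subset by blast
  qed (simp only: finite.emptyI)
  then have inf': "infinite (Y - M)" using inf Diff_infinite_finite by blast
  then have "|M| <o |Y - M|"
    using \<open>finite M\<close> finite_ordLess_infinite[OF card_of_Well_order card_of_Well_order]
    by (simp only: Field_card_of)
  then have "|M| \<le>o |Y - M|" by (rule ordLess_imp_ordLeq)
  then have "|(Y - M) \<union> M| \<le>o |Y - M|"
    by (intro card_of_Un_ordLeq_infinite_Field)
      (simp_all only: inf' Field_card_of card_of_card_order_on ordLeq_reflexive[OF card_of_Well_order] not_False_eq_True)
  moreover have "(Y - M) \<union> M = Y" by (auto simp: M_def)
  ultimately have "|Y| \<le>o |Y - M|" by (simp only:)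
  moreover have "|Y - M| \<le>o |succ_points Y|"
  proof -
    have "\<exists>w. w \<in> Y \<and> y \<prec> w \<and> (\<forall>x \<in> Y. y \<prec> x \<longrightarrow> w = x \<or> w \<prec> x)" if "y \<in> Y - M" for y
      using ex_least[of "{w \<in> Y. y \<prec> w}"] that Y unfolding M_def by auto
    then have "\<forall>y \<in> Y - M. \<exists>w. w \<in> Y \<and> y \<prec> w \<and> (\<forall>x \<in> Y. y \<prec> x \<longrightarrow> w = x \<or> w \<prec> x)"
      by blast
    from bchoice[OF this] obtain n
      where "\<forall>y \<in> Y - M. n y \<in> Y \<and> y \<prec> n y \<and> (\<forall>x \<in> Y. y \<prec> x \<longrightarrow> n y = x \<or> n y \<prec> x)" ..
    then have n: "\<And>y. y \<in> Y - M \<Longrightarrow> n y \<in> Y" "\<And>y. y \<in> Y - M \<Longrightarrow> y \<prec> n y"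
      "\<And>y x. y \<in> Y - M \<Longrightarrow> x \<in> Y \<Longrightarrow> y \<prec> x \<Longrightarrow> n y = x \<or> n y \<prec> x"
      by blast+
    have "n y \<in> succ_points Y" if y: "y \<in> Y - M" for y
    proof -
      have "w = y \<or> w \<prec> y" if w: "w \<in> Y" "w \<prec> n y" for w
      proof -
        have "w \<in> Field r" "y \<in> Field r" using w y Y by auto
        moreover have "\<not> y \<prec> w" using n(3)[OF y w(1)] w(2) lt_trans[of w "n y" w] lt_irrefl[of w] by auto
        ultimately show ?thesis using lt_linear[of w y] by blast
      qed
      then show ?thesis using n(1,2)[OF y] y unfolding succ_points_def by blast
    qed
    moreover have "inj_on n (Y - M)"
    proof (rule inj_onI)
      have A: False if "x \<in> Y - M" "y \<in> Y - M" "n x = n y" "x \<prec> y" for x y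
        using n(3)[OF that(1) _ that(4)] n(2)[OF that(2)] that lt_trans[of "n x" y "n x"] lt_irrefl by auto
      fix x y assume xy: "x \<in> Y - M" "y \<in> Y - M" "n x = n y"
      then show "x = y" using A[of x y] A[of y x] lt_linear[of x y] Y by auto
    qed
    ultimately show ?thesis using card_of_ordLeq by blast
  qed
  ultimately have "|Y| \<le>o |succ_points Y|" using ordLeq_transitive by blast
  then show ?thesis using card_of_mono1[OF succ_points_subset[of Y]] ordIso_iff_ordLeq by blast
qed

end

section \<open>Nodes and trees\<close>

text \<open>\<open>k_large\<close> expresses the cofinality of the sequence in kappa. As the
  sequence increases, the cardinals exceed lambda from that height on, which provides nodes with
  more than lambda successors.\<close>

locale kappa_seq = well_ord r for r :: "'a rel" +
  fixes l :: 'a and k :: "'a \<Rightarrow> 'a"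
  assumes l_card: "Card_order (seg r l)" and l_inf: "infinite (underS r l)"
    and k_reg: "\<And>a. a \<prec> l \<Longrightarrow> regular_inf_card (seg r (k a))"
    and k_mono: "\<And>a b. b \<prec> l \<Longrightarrow> a \<prec> b \<Longrightarrow> k a \<prec> k b"
    and k_large: "\<exists>a. a \<prec> l \<and> l \<prec> k a"
begin

abbreviation N :: "'a node set" where "N \<equiv> nodes r l k"
abbreviation h :: "'a node \<Rightarrow> 'a" where "h \<equiv> ht r"
abbreviation ext :: "'a node \<Rightarrow> 'a \<Rightarrow> 'a node" where "ext t b \<equiv> t(h t \<mapsto> b)"

lemma ht_eqI: "a \<in> Field r \<Longrightarrow> dom t = underS r a \<Longrightarrow> h t = a"
  unfolding ht_def by (rule the_equality) (simp_all add: underS_inj)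

lemma nodeD:
  assumes "t \<in> N"
  shows "h t \<prec> l" "dom t = underS r (h t)" "\<And>b. b \<prec> h t \<Longrightarrow> the (t b) \<prec> k b"
proof -
  obtain a where a: "a \<prec> l" "dom t = underS r a" "\<forall>b \<in> underS r a. the (t b) \<prec> k b"
    using assms by (auto simp: nodes_def)
  then have "h t = a" using ht_eqI lt_Field by blast
  with a show "h t \<prec> l" "dom t = underS r (h t)" "\<And>b. b \<prec> h t \<Longrightarrow> the (t b) \<prec> k b" by auto
qed

lemma nodeI:
  assumes "a \<prec> l" "dom t = underS r a" "\<And>b. b \<prec> a \<Longrightarrow> the (t b) \<prec> k b"
  shows "t \<in> N" "h t = a"
  using assms ht_eqI[OF lt_Field(1)[OF assms(1)] assms(2)] by (auto simp: nodes_def)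

lemma h_Field: "t \<in> N \<Longrightarrow> h t \<in> Field r"
  by (rule lt_Field(1)[OF nodeD(1)])

lemma map_le_val: "s \<subseteq>\<^sub>m t \<Longrightarrow> s \<in> N \<Longrightarrow> c \<prec> h s \<Longrightarrow> t c = s c"
  using nodeD(2)[of s] unfolding map_le_def by simp

lemma map_le_h:
  assumes "s \<in> N" "t \<in> N" "s \<subseteq>\<^sub>m t"
  shows "h s = h t \<or> h s \<prec> h t"
  using map_le_implies_dom_le[OF assms(3)] nodeD(2)[OF assms(1)] nodeD(2)[OF assms(2)]
    underS_subset_iff[OF h_Field[OF assms(1)] h_Field[OF assms(2)]] by simp

lemma map_le_h_lt:
  assumes "s \<in> N" "t \<in> N" "s \<subseteq>\<^sub>m t" "s \<noteq> t"
  shows "h s \<prec> h t"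
proof -
  have "h s \<noteq> h t"
  proof
    assume "h s = h t"
    then have "dom s = dom t" using nodeD(2) assms by simp
    then have "t \<subseteq>\<^sub>m s" using assms(3) by (auto simp: map_le_def)
    then show False using assms(3,4) map_le_antisym by blast
  qed
  then show ?thesis using map_le_h[OF assms(1-3)] by blast
qed

lemma restrict_node:
  assumes "t \<in> N" "b = h t \<or> b \<prec> h t"
  shows "t |` underS r b \<in> N" "h (t |` underS r b) = b" "t |` underS r b \<subseteq>\<^sub>m t"
proof -
  have b: "b \<prec> l" using assms nodeD(1) lt_trans by blast
  have sub: "c \<prec> h t" if "c \<prec> b" for c using assms that lt_trans by blast
  then have "dom (t |` underS r b) = underS r b" using nodeD(2)[OF assms(1)] by auto
  moreover have "the ((t |` underS r b) c) \<prec> k c" if "c \<prec> b" for c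
    using that sub nodeD(3)[OF assms(1)] by simp
  ultimately show "t |` underS r b \<in> N" "h (t |` underS r b) = b"
    using nodeI[OF b] by auto
  show "t |` underS r b \<subseteq>\<^sub>m t" by (auto simp: map_le_def)
qed

lemma map_le_restrict:
  assumes "s \<in> N" "s \<subseteq>\<^sub>m t"
  shows "s = t |` underS r (h s)"
proof
  fix c
  show "s c = (t |` underS r (h s)) c"
  proof (cases "c \<prec> h s")
    case True
    then show ?thesis using map_le_val[OF assms(2,1)] by simp
  next
    case False
    then have "c \<notin> dom s" using nodeD(2)[OF assms(1)] by simp
    then show ?thesis using False by (simp add: domIff)
  qed
qed

lemma restrict_mono: "A \<subseteq> B \<Longrightarrow> t |` A \<subseteq>\<^sub>m t |` B"
  by (auto simp: map_le_def)

lemma map_le_by_h: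
  assumes "s \<in> N" "s' \<in> N" "s \<subseteq>\<^sub>m t" "s' \<subseteq>\<^sub>m t" "h s = h s' \<or> h s \<prec> h s'"
  shows "s \<subseteq>\<^sub>m s'"
proof -
  have "underS r (h s) \<subseteq> underS r (h s')" using assms(5) lt_trans by auto
  then have "t |` underS r (h s) \<subseteq>\<^sub>m t |` underS r (h s')" by (rule restrict_mono)
  then show ?thesis
    using map_le_restrict[OF assms(1,3)] map_le_restrict[OF assms(2,4)] by simp
qed

lemma map_le_linear:
  assumes "s \<in> N" "s' \<in> N" "s \<subseteq>\<^sub>m t" "s' \<subseteq>\<^sub>m t"
  shows "s \<subseteq>\<^sub>m s' \<or> s' \<subseteq>\<^sub>m s"
  using lt_linear[OF h_Field[OF assms(1)] h_Field[OF assms(2)]]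
    map_le_by_h[OF assms] map_le_by_h[OF assms(2,1,4,3)] by blast

lemma sc_l:
  assumes "a \<prec> l"
  shows "sc a \<prec> l"
proof -
  obtain c where "a \<prec> c" "c \<prec> l" using inf_card_limit[OF l_card l_inf assms] .
  then show ?thesis using sc(3)[of a c] lt_trans by blast
qed

lemma ext_node:
  assumes "t \<in> N" "b \<prec> k (h t)"
  shows "ext t b \<in> N" "h (ext t b) = sc (h t)"
proof -
  have ht: "h t \<prec> l" using nodeD(1)[OF assms(1)] .
  have d: "dom (ext t b) = underS r (sc (h t))" using nodeD(2)[OF assms(1)] sc(1)[OF ht] by auto
  have v: "the (ext t b c) \<prec> k c" if "c \<prec> sc (h t)" for c
    using that sc(1)[OF ht] nodeD(3)[OF assms(1)] assms(2) by auto
  show "ext t b \<in> N" by (rule nodeI(1)[OF sc_l[OF ht] d v])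
  show "h (ext t b) = sc (h t)" by (rule nodeI(2)[OF sc_l[OF ht] d v])
qed

lemma not_dom_h: "t \<in> N \<Longrightarrow> t (h t) = None"
  using nodeD(2)[of t] lt_irrefl[of "h t"] by (metis domIff)

lemma map_le_ext:
  assumes "t \<in> N"
  shows "t \<subseteq>\<^sub>m ext t b" "t \<noteq> ext t b"
proof -
  show "t \<subseteq>\<^sub>m ext t b" using not_dom_h[OF assms] by (auto simp: map_le_def)
  show "t \<noteq> ext t b" using not_dom_h[OF assms] by (metis fun_upd_same option.distinct(1))
qed

lemma ext_node_iff: 
  assumes "t \<in> N"
  shows "ext t b \<in> N \<longleftrightarrow> b \<prec> k (h t)"
proof
  assume e: "ext t b \<in> N"
  have "h t \<prec> h (ext t b)" using map_le_h_lt[OF assms e map_le_ext[OF assms]] .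
  then show "b \<prec> k (h t)" using nodeD(3)[OF e] by fastforce
qed (use ext_node assms in blast)

lemma ext_inj: "ext t b = ext t b' \<longleftrightarrow> b = b'"
  by (metis fun_upd_same option.inject)

lemma ext_le:
  assumes "s \<in> N" "t \<in> N" "s \<subseteq>\<^sub>m t" "s \<noteq> t"
  shows "ext s (the (t (h s))) \<subseteq>\<^sub>m t"
proof -
  have "h s \<in> dom t" using map_le_h_lt[OF assms] nodeD(2)[OF assms(2)] by blast
  then show ?thesis using assms(3) by (auto simp: map_le_def)
qed

lemma below_ext:
  assumes "t \<in> N" "ext t b \<in> N" "u \<in> N" "u \<subseteq>\<^sub>m ext t b" "u \<noteq> ext t b"
  shows "u \<subseteq>\<^sub>m t"
proof -
  have "h u \<prec> sc (h t)"
    using map_le_h_lt[OF assms(3,2,4,5)] ext_node[OF assms(1)] ext_node_iff assms(1,2) by simp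
  then have "h u = h t \<or> h u \<prec> h t" using sc(1)[OF nodeD(1)[OF assms(1)]] by blast
  then show ?thesis using map_le_by_h[OF assms(3,1,4)] map_le_ext(1)[OF assms(1)] by blast
qed

lemma empty_node: "Map.empty \<in> N" "underS r (h Map.empty) = {}"
proof -
  have "underS r l \<noteq> {}" using l_inf by auto
  moreover have "underS r l \<subseteq> Field r" using lt_Field by blast
  ultimately obtain z where z: "z \<prec> l" "\<forall>x \<in> underS r l. z = x \<or> z \<prec> x" using ex_least by blast
  have "underS r z = {}"
  proof (rule ccontr)
    assume "underS r z \<noteq> {}"
    then obtain x where "x \<prec> z" by blast
    then show False using z(2) lt_trans[OF _ z(1), of x] lt_trans[of x z x] lt_irrefl by metis
  qed
  then show "Map.empty \<in> N" "underS r (h Map.empty) = {}"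
    using nodeI[OF z(1), of Map.empty] by auto
qed

lemma treeD:
  assumes "is_tree r l k T"
  shows "t \<in> T \<Longrightarrow> t \<in> N" "t \<in> T \<Longrightarrow> s \<in> N \<Longrightarrow> s \<subseteq>\<^sub>m t \<Longrightarrow> s \<in> T" "Map.empty \<in> T"
proof -
  show 1: "t \<in> T \<Longrightarrow> t \<in> N" "t \<in> T \<Longrightarrow> s \<in> N \<Longrightarrow> s \<subseteq>\<^sub>m t \<Longrightarrow> s \<in> T" for s t
    using assms by (auto simp: is_tree_def)
  obtain t where "t \<in> T" using assms by (auto simp: is_tree_def)
  then show "Map.empty \<in> T" using 1(2)[of t Map.empty] empty_node by simp
qed

lemma OSucc_iff: "b \<in> OSucc r T t \<longleftrightarrow> ext t b \<in> T"
  by (simp add: OSucc_def)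

lemma OSucc_subset:
  assumes "is_tree r l k T" "t \<in> T"
  shows "OSucc r T t \<subseteq> underS r (k (h t))"
proof
  fix b assume "b \<in> OSucc r T t"
  then show "b \<prec> k (h t)"
    using treeD(1)[OF assms(1)] ext_node_iff[OF treeD(1)[OF assms]] unfolding OSucc_iff by blast
qed

lemma next_in_OSucc:
  assumes T: "is_tree r l k T" and "t \<in> T" "s \<in> N" "s \<subseteq>\<^sub>m t" "s \<noteq> t"
  shows "the (t (h s)) \<in> OSucc r T s"
proof -
  have t: "t \<in> N" using treeD(1)[OF T] assms by blast
  have "h s \<prec> h t" using map_le_h_lt assms t by blast
  then have "ext s (the (t (h s))) \<in> N" using ext_node_iff assms(3) nodeD(3)[OF t] by blast
  then show ?thesis
    using treeD(2)[OF T \<open>t \<in> T\<close>] ext_le[OF assms(3) t assms(4,5)] by (simp add: OSucc_def)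
qed

text \<open>\<open>Succs\<close> is defined by minimality in the tree, \<open>OSucc\<close> by
  one-point extensions. Closure under initial segments puts a one-point extension between any node
  and a proper extension of it, so the two agree and sizes can be computed from sets of
  ordinals.\<close>

lemma Succs_eq:
  assumes T: "is_tree r l k T" and t: "t \<in> T"
  shows "Succs T t = ext t ` OSucc r T t"
proof
  have tN: "t \<in> N" using treeD(1)[OF T] t by blast
  show "Succs T t \<subseteq> ext t ` OSucc r T t"
  proof
    fix s assume "s \<in> Succs T t"
    then have s: "s \<in> T" "t \<subseteq>\<^sub>m s" "s \<noteq> t" "\<And>u. u \<in> T \<Longrightarrow> t \<subseteq>\<^sub>m u \<Longrightarrow> u \<subseteq>\<^sub>m s \<Longrightarrow> u = t \<or> u = s"
      by (auto simp: Succs_def)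
    have b: "the (s (h t)) \<in> OSucc r T t" using next_in_OSucc[OF T s(1) tN s(2)] s(3) by blast
    then have "ext t (the (s (h t))) = s"
      using s(4)[of "ext t (the (s (h t)))"] map_le_ext[OF tN] ext_le[OF tN _ s(2)] s(1,3) treeD(1)[OF T]
      unfolding OSucc_def by (metis mem_Collect_eq)
    then show "s \<in> ext t ` OSucc r T t" using b by (metis image_eqI)
  qed
  show "ext t ` OSucc r T t \<subseteq> Succs T t"
  proof
    fix s assume "s \<in> ext t ` OSucc r T t"
    then obtain b where b: "s = ext t b" "ext t b \<in> T" by (auto simp: OSucc_def)
    have "u = t \<or> u = ext t b" if "u \<in> T" "t \<subseteq>\<^sub>m u" "u \<subseteq>\<^sub>m ext t b" for u
      using below_ext[OF tN, of b u] treeD(1)[OF T] b(2) that map_le_antisym by blast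
    then show "s \<in> Succs T t" using b map_le_ext(1)[OF tN] map_le_ext(2)[OF tN, THEN not_sym] by (auto simp: Succs_def)
  qed
qed

lemma Succs_card:
  assumes "is_tree r l k T" "t \<in> T"
  shows "|Succs T t| =o |OSucc r T t|"
proof -
  have "bij_betw (ext t) (OSucc r T t) (Succs T t)"
    unfolding Succs_eq[OF assms] bij_betw_def inj_on_def using ext_inj by blast
  then show ?thesis using card_of_ordIsoI ordIso_symmetric by blast
qed

text \<open>If all nodes above \<open>s\<close> had height below \<open>a\<close>, unions of chains
  would have height at most \<open>a\<close> and stay in the tree by closure at limits. Zorn's lemma
  would give a maximal node, contrary to the existence of proper extensions.\<close>

lemma heights_unbounded:
  assumes T: "is_tree r l k T" and cl: "lt_closed r l T" and s: "s \<in> T" and a: "a \<prec> l"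
  shows "\<exists>u \<in> T. s \<subseteq>\<^sub>m u \<and> (a = h u \<or> a \<prec> h u)"
proof (rule ccontr)
  assume no: "\<not> ?thesis"
  let ?X = "{u \<in> T. s \<subseteq>\<^sub>m u}"
  have XN: "u \<in> N" if "u \<in> ?X" for u using that treeD(1)[OF T] by blast
  have small: "h u \<prec> a" if "u \<in> ?X" for u
    using no that lt_linear[of "h u" a] h_Field[OF XN[OF that]] lt_Field(1)[OF a] by blast
  have po: "partial_order_on ?X (relation_of (\<subseteq>\<^sub>m) ?X)"
    by (rule partial_order_on_relation_ofI) (auto intro: map_le_trans map_le_antisym)
  have "\<exists>m \<in> ?X. \<forall>u \<in> ?X. m \<subseteq>\<^sub>m u \<longrightarrow> u = m"
  proof (rule predicate_Zorn[OF po])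
    fix C assume "C \<in> Chains (relation_of (\<subseteq>\<^sub>m) ?X)"
    then have C: "C \<subseteq> ?X" "\<And>u w. u \<in> C \<Longrightarrow> w \<in> C \<Longrightarrow> u \<subseteq>\<^sub>m w \<or> w \<subseteq>\<^sub>m u"
      by (auto simp: Chains_def relation_of_def)
    show "\<exists>u \<in> ?X. \<forall>w \<in> C. w \<subseteq>\<^sub>m u"
    proof (cases "C = {} \<or> (\<exists>u \<in> C. \<forall>w \<in> C. w \<subseteq>\<^sub>m u)")
      case True
      then show ?thesis using C(1) s by (auto intro: map_le_refl)
    next
      case False
      \<comment> \<open>The union of the chain, as a partial map.\<close>
      define f where "f x = (if \<exists>u \<in> C. x \<in> dom u then (SOME u. u \<in> C \<and> x \<in> dom u) x else None)" for x
      have f: "f x = u x" if u: "u \<in> C" "x \<in> dom u" for u x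
      proof -
        define w where "w = (SOME u. u \<in> C \<and> x \<in> dom u)"
        have w: "w \<in> C \<and> x \<in> dom w" unfolding w_def by (rule someI[of _ u]) (use u in blast)
        have "f x = w x" using u by (auto simp: f_def w_def)
        also have "\<dots> = u x" using C(2)[of w u] w u unfolding map_le_def by metis
        finally show ?thesis .
      qed
      then have le: "u \<subseteq>\<^sub>m f" if "u \<in> C" for u using that by (auto simp: map_le_def)
      have grow: "\<exists>w \<in> C. h u \<prec> h w" if u: "u \<in> C" for u
      proof -
        obtain w where w: "w \<in> C" "\<not> w \<subseteq>\<^sub>m u" using False u by blast
        then have "u \<subseteq>\<^sub>m w" "u \<noteq> w" using C(2) u map_le_refl by blast+
        then show ?thesis using map_le_h_lt[of u w] XN C(1) u w(1) by blast
      qed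
      \<comment> \<open>The height of the union is the supremum of the heights, a limit because the
        chain has no largest member.\<close>
      have "\<exists>d. limit_ord r d \<and> (d = a \<or> d \<prec> a) \<and> (\<forall>x \<in> h ` C. x \<prec> d) \<and>
        (\<forall>x. x \<prec> d \<longrightarrow> (\<exists>y \<in> h ` C. x \<prec> y))"
      proof (rule lt_sup[OF _ _ _ a])
        show "h ` C \<subseteq> underS r l" using small lt_trans[OF _ a] C(1) by blast
        show "h ` C \<noteq> {}" using False by blast
        show "\<exists>y \<in> h ` C. x \<prec> y" if "x \<in> h ` C" for x using that grow by blast
        show "x \<prec> a" if "x \<in> h ` C" for x using that small C(1) by blast
      qed
      then obtain d where d12: "limit_ord r d" "d = a \<or> d \<prec> a"
        and d34: "\<forall>x \<in> h ` C. x \<prec> d" "\<forall>x. x \<prec> d \<longrightarrow> (\<exists>y \<in> h ` C. x \<prec> y)"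
        by (elim exE conjE)
      have d: "limit_ord r d" "d = a \<or> d \<prec> a" "u \<in> C \<Longrightarrow> h u \<prec> d"
        "x \<prec> d \<Longrightarrow> \<exists>u \<in> C. x \<prec> h u" for u x
        using d12 d34(1) d34(2)[rule_format, of x] by auto
      have dl: "d \<prec> l" using d(2) a lt_trans by blast
      have domu: "dom u = underS r (h u)" if "u \<in> C" for u using nodeD(2) XN C(1) that by blast
      have dom: "dom f = underS r d"
      proof
        show "dom f \<subseteq> underS r d"
        proof
          fix x assume "x \<in> dom f"
          then obtain u where "u \<in> C" "x \<in> dom u" using f_def by (metis domIff)
          then show "x \<prec> d" using domu d(3) lt_trans by blast
        qed
        show "underS r d \<subseteq> dom f"
        proof
          fix x assume "x \<prec> d"
          then obtain u where "u \<in> C" "x \<prec> h u" using d(4) by blast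
          then show "x \<in> dom f" using domu f[of u x] by (metis domIff)
        qed
      qed
      have "f |` underS r b \<in> T" if b: "b \<prec> d" for b
      proof -
        obtain u where u: "u \<in> C" "b \<prec> h u" using d(4) b by blast
        have uN: "u \<in> N" "u \<in> T" using u C(1) XN by blast+
        have "f |` underS r b = u |` underS r b"
        proof
          fix x show "(f |` underS r b) x = (u |` underS r b) x"
            using f[OF u(1), of x] domu[OF u(1)] lt_trans[OF _ u(2), of x] by (auto simp: restrict_map_def)
        qed
        then show ?thesis using treeD(2)[OF T uN(2)] restrict_node[OF uN(1)] u(2) by auto
      qed
      then have "f \<in> T" using cl dl d(1) dom unfolding lt_closed_def by blast
      moreover have "s \<subseteq>\<^sub>m f"
      proof -
        obtain u where "u \<in> C" using False by blast
        then show ?thesis using le C(1) map_le_trans by blast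
      qed
      ultimately show ?thesis using le by blast
    qed
  qed
  then obtain m where m: "m \<in> T" "s \<subseteq>\<^sub>m m" "\<And>u. u \<in> T \<Longrightarrow> s \<subseteq>\<^sub>m u \<Longrightarrow> m \<subseteq>\<^sub>m u \<Longrightarrow> u = m" by blast
  obtain u where "u \<in> T" "m \<subseteq>\<^sub>m u" "u \<noteq> m" using cl m(1) unfolding lt_closed_def by blast
  then show False using m map_le_trans by blast
qed

end

section \<open>Thinning out trees\<close>

context kappa_seq
begin

text \<open>
  Nodes fixed by \<open>g\<close> branch into \<open>Z\<close>; from any other node \<open>v\<close> the tree follows the unique path towards
  \<open>g v\<close>. The coherence condition in \<open>guide\<close> says that the target does not change on the way.
\<close>

definition guided :: "'a node set \<Rightarrow> ('a node \<Rightarrow> 'a node) \<Rightarrow> ('a node \<Rightarrow> 'a set) \<Rightarrow> 'a node set" where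
  "guided p g Z = {u \<in> p. \<forall>v \<in> p. v \<subseteq>\<^sub>m u \<and> v \<noteq> u \<longrightarrow>
     the (u (h v)) \<in> (if g v = v then Z v else {the (g v (h v))})}"

definition guide :: "'a node set \<Rightarrow> ('a node \<Rightarrow> 'a node) \<Rightarrow> ('a node \<Rightarrow> 'a set) \<Rightarrow> bool" where
  "guide p g Z \<longleftrightarrow> is_tree r l k p \<and> lt_closed r l p \<and>
     (\<forall>v \<in> p. g v \<in> p \<and> v \<subseteq>\<^sub>m g v) \<and>
     (\<forall>v \<in> p. \<forall>w \<in> p. v \<subseteq>\<^sub>m w \<and> w \<subseteq>\<^sub>m g v \<longrightarrow> g w = g v) \<and>
     (\<forall>v \<in> p. g v = v \<longrightarrow> Z v \<subseteq> OSucc r p v \<and> Z v \<noteq> {})"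

text \<open>Membership is a condition on each coordinate separately, and a coordinate is inherited
  by initial segments (\<open>val\<close>); closure downwards and at limits follows. The last claim
  holds because a node moved by \<open>g\<close> has at most one successor, so that all large
  branching occurs at nodes fixed by \<open>g\<close>.\<close>

lemma guided_tree:
  assumes "guide p g Z"
  shows "guided p g Z \<subseteq> p" (is "?G \<subseteq> p")
    and "is_tree r l k (guided p g Z)" and "lt_closed r l (guided p g Z)"
    and "\<And>v. v \<in> guided p g Z \<Longrightarrow> g v \<in> guided p g Z"
    and "\<And>v. v \<in> guided p g Z \<Longrightarrow> g v = v \<Longrightarrow> OSucc r (guided p g Z) v = Z v"
    and "\<And>v. v \<in> guided p g Z \<Longrightarrow> seg r l <o |OSucc r (guided p g Z) v| \<Longrightarrow> g v = v"
proof -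
  have p: "is_tree r l k p" "lt_closed r l p"
    and g: "\<And>v. v \<in> p \<Longrightarrow> g v \<in> p" "\<And>v. v \<in> p \<Longrightarrow> v \<subseteq>\<^sub>m g v"
    and coh: "\<And>v w. v \<in> p \<Longrightarrow> w \<in> p \<Longrightarrow> v \<subseteq>\<^sub>m w \<Longrightarrow> w \<subseteq>\<^sub>m g v \<Longrightarrow> g w = g v"
    and Z: "\<And>v. v \<in> p \<Longrightarrow> g v = v \<Longrightarrow> Z v \<subseteq> OSucc r p v" "\<And>v. v \<in> p \<Longrightarrow> g v = v \<Longrightarrow> Z v \<noteq> {}"
    using assms unfolding guide_def by blast+
  show sub: "?G \<subseteq> p" by (auto simp: guided_def)
  have pN: "v \<in> N" if "v \<in> p" for v using treeD(1)[OF p(1) that] .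
  have GD: "the (u (h v)) \<in> (if g v = v then Z v else {the (g v (h v))})"
    if "u \<in> ?G" "v \<in> p" "v \<subseteq>\<^sub>m u" "v \<noteq> u" for u v
    using that unfolding guided_def by blast
  have GI: "u \<in> ?G" if "u \<in> p" "\<And>v. v \<in> p \<Longrightarrow> v \<subseteq>\<^sub>m u \<Longrightarrow> v \<noteq> u \<Longrightarrow>
      the (u (h v)) \<in> (if g v = v then Z v else {the (g v (h v))})" for u
    using that unfolding guided_def by blast
  have val: "the (u (h v)) = the (w (h v))" if "v \<in> p" "w \<in> p" "v \<subseteq>\<^sub>m w" "v \<noteq> w" "w \<subseteq>\<^sub>m u" for u v w
    using map_le_val[OF that(5) pN[OF that(2)] map_le_h_lt[OF pN[OF that(1)] pN[OF that(2)] that(3,4)]] by simp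
  have down: "w \<in> ?G" if u: "u \<in> ?G" and w: "w \<in> N" "w \<subseteq>\<^sub>m u" for u w
  proof (rule GI)
    show wp: "w \<in> p" using treeD(2)[OF p(1) _ w] u sub by blast
    fix v assume v: "v \<in> p" "v \<subseteq>\<^sub>m w" "v \<noteq> w"
    have "v \<subseteq>\<^sub>m u" using v(2) w(2) map_le_trans by blast
    moreover have "v \<noteq> u" using v(2,3) w(2) map_le_antisym by blast
    ultimately have "the (u (h v)) \<in> (if g v = v then Z v else {the (g v (h v))})" using GD u v(1) by blast
    then show "the (w (h v)) \<in> (if g v = v then Z v else {the (g v (h v))})"
      using val[OF v(1) wp v(2,3) w(2)] by simp
  qed
  have "Map.empty \<in> ?G"
  proof (rule GI)
    show "Map.empty \<in> p" using treeD(3)[OF p(1)] .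
    fix v :: "'a node" assume "v \<subseteq>\<^sub>m Map.empty" "v \<noteq> Map.empty"
    then show "the (Map.empty (h v)) \<in> (if g v = v then Z v else {the (g v (h v))})"
      using map_le_antisym[of v Map.empty] by simp
  qed
  then show tree: "is_tree r l k ?G"
    using down sub pN unfolding is_tree_def by blast
  show gG: "g v \<in> ?G" if v: "v \<in> ?G" for v
  proof (rule GI)
    have vp: "v \<in> p" using v sub by blast
    show "g v \<in> p" using g(1)[OF vp] .
    fix w assume w: "w \<in> p" "w \<subseteq>\<^sub>m g v" "w \<noteq> g v"
    \<comment> \<open>Properly below \<open>v\<close> the requirement is inherited from
      \<open>v\<close>. From \<open>v\<close> on, coherence gives \<open>w\<close> the same target
      \<open>g v\<close>, so following that target is what is required.\<close>
    consider "w \<subseteq>\<^sub>m v" "w \<noteq> v" | "v \<subseteq>\<^sub>m w"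
      using map_le_linear[OF pN[OF w(1)] pN[OF vp] w(2) g(2)[OF vp]] map_le_refl by blast
    then show "the (g v (h w)) \<in> (if g w = w then Z w else {the (g w (h w))})"
    proof cases
      case 1
      then show ?thesis using GD[OF v w(1)] val[OF w(1) vp 1 g(2)[OF vp]] by simp
    next
      case 2
      then have "g w = g v" using coh[OF vp w(1) 2 w(2)] by simp
      then show ?thesis using w(3) by auto
    qed
  qed
  have ext_iff: "ext v b \<in> ?G \<longleftrightarrow> b \<in> (if g v = v then Z v else {the (g v (h v))}) \<and> ext v b \<in> p" if v: "v \<in> ?G" for v b
  proof
    have vp: "v \<in> p" using v sub by blast
    note vN = pN[OF vp]
    show "b \<in> (if g v = v then Z v else {the (g v (h v))}) \<and> ext v b \<in> p" if "ext v b \<in> ?G"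
      using GD[OF that vp] map_le_ext[OF vN] sub that by auto
    assume b: "b \<in> (if g v = v then Z v else {the (g v (h v))}) \<and> ext v b \<in> p"
    show "ext v b \<in> ?G"
    proof (rule GI)
      show ep: "ext v b \<in> p" using b by blast
      fix w assume w: "w \<in> p" "w \<subseteq>\<^sub>m ext v b" "w \<noteq> ext v b"
      have wv: "w \<subseteq>\<^sub>m v" using below_ext[OF vN pN[OF ep] pN[OF w(1)] w(2,3)] .
      show "the (ext v b (h w)) \<in> (if g w = w then Z w else {the (g w (h w))})"
      proof (cases "w = v")
        case True
        then show ?thesis using b by (auto split: if_splits)
      next
        case False
        then show ?thesis
          using GD[OF v w(1) wv] val[OF w(1) vp wv False map_le_ext(1)[OF vN]] by simp
      qed
    qed
  qed
  show O: "OSucc r ?G v = Z v" if "v \<in> ?G" "g v = v" for v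
  proof -
    have "v \<in> p" using that sub by blast
    then have "ext v b \<in> p" if "b \<in> Z v" for b using Z(1) that \<open>g v = v\<close> unfolding OSucc_def by blast
    then show ?thesis using ext_iff[OF that(1)] that(2) unfolding OSucc_def by auto
  qed
  show "g v = v" if "v \<in> ?G" "seg r l <o |OSucc r ?G v|" for v
  proof (rule ccontr)
    assume "g v \<noteq> v"
    then have "OSucc r ?G v \<subseteq> {the (g v (h v))}" using ext_iff[OF that(1)] by (auto simp: OSucc_def)
    then have "finite (OSucc r ?G v)" using finite_subset by blast
    then have "|OSucc r ?G v| <o seg r l"
      using finite_ordLess_infinite[OF card_of_Well_order Well_order_seg] l_inf
      by (simp add: Field_card_of Field_seg[OF wo])
    then show False using that(2) ordLess_transitive ordLess_irreflexive by blast
  qed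
  show "lt_closed r l ?G"
    unfolding lt_closed_def
  proof (intro conjI ballI allI impI)
    fix v assume v: "v \<in> ?G"
    then have vp: "v \<in> p" using sub by blast
    show "\<exists>t \<in> ?G. v \<subseteq>\<^sub>m t \<and> t \<noteq> v"
    proof (cases "g v = v")
      case True
      then obtain b where "b \<in> OSucc r ?G v" using O[OF v] Z(2)[OF vp] by blast
      then show ?thesis using map_le_ext[OF pN[OF vp], of b] unfolding OSucc_def by (metis mem_Collect_eq)
    next
      case False
      then show ?thesis using gG[OF v] g(2)[OF vp] by blast
    qed
  next
    fix d f assume d: "d \<prec> l" and "limit_ord r d \<and> dom f = underS r d \<and> (\<forall>b \<in> underS r d. f |` underS r b \<in> ?G)"
    then have f: "limit_ord r d" "dom f = underS r d" "\<And>b. b \<prec> d \<Longrightarrow> f |` underS r b \<in> ?G" by auto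
    then have fp: "f \<in> p" using p(2) d sub unfolding lt_closed_def by blast
    show "f \<in> ?G"
    proof (rule GI[OF fp])
      fix v assume v: "v \<in> p" "v \<subseteq>\<^sub>m f" "v \<noteq> f"
      have "h v \<prec> h f" using map_le_h_lt[OF pN[OF v(1)] pN[OF fp] v(2,3)] .
      moreover have "h f = d" using ht_eqI[OF lt_Field(1)[OF d] f(2)] .
      ultimately obtain b where b: "h v \<prec> b" "b \<prec> d" using f(1) unfolding limit_ord_def by blast
      let ?u = "f |` underS r b"
      have u: "?u \<in> N" "h ?u = b" "?u \<subseteq>\<^sub>m f" using restrict_node[OF pN[OF fp], of b] b \<open>h f = d\<close> by auto
      have "v \<subseteq>\<^sub>m ?u" using map_le_by_h[OF pN[OF v(1)] u(1) v(2) u(3)] u(2) b(1) by auto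
      moreover have "v \<noteq> ?u" using u(2) b(1) lt_irrefl by auto
      ultimately have "the (?u (h v)) \<in> (if g v = v then Z v else {the (g v (h v))})"
        using GD[OF f(3)[OF b(2)] v(1)] by blast
      then show "the (f (h v)) \<in> (if g v = v then Z v else {the (g v (h v))})" using b(1) by simp
    qed
  qed
qed

section \<open>Trees restricted to the nodes comparable with a given node\<close>

definition cone :: "'a node set \<Rightarrow> 'a node \<Rightarrow> 'a node set" where
  "cone p x = {u \<in> p. u \<subseteq>\<^sub>m x \<or> x \<subseteq>\<^sub>m u}"

lemma cone_tree:
  assumes p: "is_tree r l k p" "lt_closed r l p" and x: "x \<in> p"
  shows "is_tree r l k (cone p x)" and "lt_closed r l (cone p x)"
    and "\<And>t. t \<in> N \<Longrightarrow> x \<subseteq>\<^sub>m t \<Longrightarrow> OSucc r (cone p x) t = OSucc r p t"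
proof -
  have pN: "v \<in> N" if "v \<in> p" for v using treeD(1)[OF p(1) that] .
  have "w \<in> cone p x" if u: "u \<in> cone p x" and w: "w \<in> N" "w \<subseteq>\<^sub>m u" for u w
  proof -
    have up: "u \<in> p" using u by (simp add: cone_def)
    have "w \<in> p" using treeD(2)[OF p(1) up w] .
    moreover have "w \<subseteq>\<^sub>m x \<or> x \<subseteq>\<^sub>m w"
    proof (cases "u \<subseteq>\<^sub>m x")
      case True
      then show ?thesis using w(2) map_le_trans by blast
    next
      case False
      then have "x \<subseteq>\<^sub>m u" using u by (simp add: cone_def)
      then show ?thesis using map_le_linear[OF w(1) pN[OF x] w(2)] by blast
    qed
    ultimately show ?thesis by (simp add: cone_def)
  qed
  moreover have "x \<in> cone p x" using x by (simp add: cone_def)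
  ultimately show "is_tree r l k (cone p x)"
    using pN unfolding is_tree_def cone_def by blast
  show "OSucc r (cone p x) t = OSucc r p t" if "t \<in> N" "x \<subseteq>\<^sub>m t" for t
    using map_le_trans[OF that(2) map_le_ext(1)[OF that(1)]] by (auto simp: OSucc_def cone_def)
  show "lt_closed r l (cone p x)"
    unfolding lt_closed_def
  proof (intro conjI ballI allI impI)
    fix s assume s: "s \<in> cone p x"
    show "\<exists>t \<in> cone p x. s \<subseteq>\<^sub>m t \<and> t \<noteq> s"
    proof (cases "x \<subseteq>\<^sub>m s")
      case True
      obtain t where "t \<in> p" "s \<subseteq>\<^sub>m t" "t \<noteq> s" using p(2) s unfolding lt_closed_def cone_def by blast
      then show ?thesis using map_le_trans[OF True] by (auto simp: cone_def)
    next
      case False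
      then have "s \<subseteq>\<^sub>m x" "s \<noteq> x" using s map_le_refl by (auto simp: cone_def)
      then show ?thesis using \<open>x \<in> cone p x\<close> by blast
    qed
  next
    fix d f assume d: "d \<prec> l" and f: "limit_ord r d \<and> dom f = underS r d \<and> (\<forall>b \<in> underS r d. f |` underS r b \<in> cone p x)"
    then have fp: "f \<in> p" using p(2) unfolding lt_closed_def cone_def by blast
    \<comment> \<open>Either some proper restriction of \<open>f\<close> has already passed
      \<open>x\<close>, or all of them are below \<open>x\<close> and then so is their union
      \<open>f\<close>.\<close>
    have "f \<subseteq>\<^sub>m x \<or> x \<subseteq>\<^sub>m f"
    proof (cases "\<exists>b. b \<prec> d \<and> x \<subseteq>\<^sub>m f |` underS r b")
      case True
      then obtain b where "x \<subseteq>\<^sub>m f |` underS r b" by blast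
      moreover have "f |` underS r b \<subseteq>\<^sub>m f" by (auto simp: map_le_def)
      ultimately show ?thesis using map_le_trans by blast
    next
      case False
      have "f c = x c" if "c \<in> dom f" for c
      proof -
        have "c \<prec> d" using that f by blast
        then obtain b where b: "c \<prec> b" "b \<prec> d" using f unfolding limit_ord_def by blast
        then have "f |` underS r b \<subseteq>\<^sub>m x" using False f unfolding cone_def by blast
        moreover have "c \<in> dom (f |` underS r b)" using b(1) that by simp
        ultimately have "(f |` underS r b) c = x c" unfolding map_le_def by blast
        then show ?thesis using b(1) by simp
      qed
      then show ?thesis by (simp add: map_le_def)
    qed
    with fp show "f \<in> cone p x" by (simp add: cone_def)
  qed
qed

text \<open>Every strengthening of a cone still contains its base node. Take the least height
  \<open>d\<close> at which the path to \<open>x\<close> leaves \<open>T\<close>: it is not zero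
  because of the root, not a limit because of closure, and not a successor because the last node
  inside \<open>T\<close> would have no proper extension.\<close>

lemma below_cone:
  assumes T: "is_tree r l k T" "lt_closed r l T" and sub: "T \<subseteq> cone p x" and x: "x \<in> N"
  shows "x \<in> T"
proof (rule ccontr)
  assume "x \<notin> T"
  let ?D = "{d \<in> Field r. (d = h x \<or> d \<prec> h x) \<and> x |` underS r d \<notin> T}"
  have "x |` underS r (h x) = x" using map_le_restrict[OF x map_le_refl] by simp
  then have "h x \<in> ?D" using \<open>x \<notin> T\<close> h_Field[OF x] by simp
  then obtain d where d: "d \<in> ?D" "\<forall>e \<in> ?D. d = e \<or> d \<prec> e" using ex_least[of ?D] by blast
  have dx: "d = h x \<or> d \<prec> h x" and dF: "d \<in> Field r" and dT: "x |` underS r d \<notin> T" using d(1) by auto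
  have less: "x |` underS r e \<in> T" if e: "e \<prec> d" for e
  proof (rule ccontr)
    assume "x |` underS r e \<notin> T"
    then have "e \<in> ?D" using e dx lt_trans[of e d "h x"] lt_Field(1)[OF e] by auto
    then have "d = e \<or> d \<prec> e" by (rule d(2)[rule_format])
    then show False using e lt_trans[of e d e] lt_irrefl[of e] by auto
  qed
  note xd = restrict_node[OF x dx]
  show False
  proof (cases rule: ordinal_cases[OF dF])
    case 1
    then have "x |` underS r d = Map.empty" by simp
    then show False using dT treeD(3)[OF T(1)] by metis
  next
    case (2 e)
    let ?v = "x |` underS r e"
    have ex: "e \<prec> h x" using 2(1) dx lt_trans by blast
    note v = restrict_node[OF x disjI2[OF ex]]
    have "?v \<in> T" using less 2(1) .
    then obtain u where u: "u \<in> T" "?v \<subseteq>\<^sub>m u" "u \<noteq> ?v" using T(2) unfolding lt_closed_def by blast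
    have uN: "u \<in> N" using treeD(1)[OF T(1) u(1)] .
    \<comment> \<open>The extension \<open>u\<close> is comparable with \<open>x\<close>. It cannot
      be above, since \<open>x\<close> is missing from \<open>T\<close>; so it is below
      \<open>x\<close> and passes through the path at height \<open>d\<close>.\<close>
    have "u \<subseteq>\<^sub>m x"
    proof (rule ccontr)
      assume "\<not> u \<subseteq>\<^sub>m x"
      then have "x \<subseteq>\<^sub>m u" using u(1) sub by (auto simp: cone_def)
      then show False using treeD(2)[OF T(1) u(1) x] \<open>x \<notin> T\<close> by blast
    qed
    moreover have "d = h u \<or> d \<prec> h u"
      using sc(3)[of e "h u"] map_le_h_lt[OF v(1) uN u(2)] u(3) v(2) 2(2) by auto
    ultimately have "x |` underS r d \<subseteq>\<^sub>m u"
      using map_le_by_h[OF xd(1) uN xd(3)] xd(2) by auto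
    then show False using treeD(2)[OF T(1) u(1) xd(1)] dT by blast
  next
    case 3
    have "dom (x |` underS r d) = underS r d" using nodeD(2)[OF xd(1)] xd(2) by simp
    moreover have "(x |` underS r d) |` underS r b \<in> T" if "b \<prec> d" for b
    proof -
      have "underS r d \<inter> underS r b = underS r b" using lt_trans[OF _ that] by blast
      then show ?thesis using less[OF that] by simp
    qed
    moreover have "d \<prec> l" using nodeD(1)[OF x] dx lt_trans by blast
    ultimately have "x |` underS r d \<in> T" using T(2) 3 unfolding lt_closed_def by blast
    then show False using dT by blast
  qed
qed

end

text \<open>Take the least element in a well-order of the type. The second property, that the choice
  survives passing to a smaller set still containing it, is the coherence demanded by
  \<open>guide\<close>.\<close>

lemma coherent_choice:
  obtains sel :: "'b set \<Rightarrow> 'b" where "\<And>S. S \<noteq> {} \<Longrightarrow> sel S \<in> S"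
    "\<And>S S'. S' \<subseteq> S \<Longrightarrow> sel S \<in> S' \<Longrightarrow> sel S' = sel S"
proof -
  obtain W :: "'b rel" where W: "well_order_on UNIV W" using well_order_on by blast
  then have F: "Field W = UNIV" using well_order_on_Field by fastforce
  interpret W: well_ord W using W F by unfold_locales simp
  define least where "least S m \<longleftrightarrow> m \<in> S \<and> (\<forall>x \<in> S. m = x \<or> m \<in> underS W x)" for S m
  have ex: "\<exists>m. least S m" if "S \<noteq> {}" for S
    using W.ex_least[of S] F that unfolding least_def by auto
  have uniq: "m = m'" if "least S m" "least S m'" for S m m'
    using that W.lt_trans[of m m' m] W.lt_irrefl[of m] unfolding least_def by metis
  have sel: "least S (SOME m. least S m)" if "S \<noteq> {}" for S
    using someI_ex[OF ex[OF that]] .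
  show ?thesis
  proof (rule that[of "\<lambda>S. SOME m. least S m"])
    show "(SOME m. least S m) \<in> S" if "S \<noteq> {}" for S using sel[OF that] by (simp add: least_def)
    fix S S' assume S: "S' \<subseteq> S" "(SOME m. least S m) \<in> S'"
    then have "least S (SOME m. least S m)" using sel[of S] by blast
    then have "least S' (SOME m. least S m)" using S unfolding least_def by blast
    moreover have "least S' (SOME m. least S' m)" using sel[of S'] S(2) by blast
    ultimately show "(SOME m. least S' m) = (SOME m. least S m)" using uniq by blast
  qed
qed

context kappa_seq
begin

lemma k_card:
  assumes "a \<prec> l"
  shows "Card_order (seg r (k a))" "infinite (underS r (k a))"
  using k_reg[OF assms] by (auto simp: regular_inf_card_def Field_seg[OF wo])

lemma seg_k_mono:
  assumes "b \<prec> l" "a = b \<or> a \<prec> b"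
  shows "seg r (k a) \<le>o seg r (k b)"
proof -
  have a: "a \<prec> l" using assms lt_trans by blast
  have "k a = k b \<or> k a \<prec> k b" using assms k_mono by blast
  then show ?thesis by (rule seg_le[OF k_card(1)[OF assms(1)] k_card(1)[OF a]])
qed

lemma seg_l_less: "l \<prec> k a \<Longrightarrow> a \<prec> l \<Longrightarrow> seg r l <o seg r (k a)"
  by (rule seg_less[OF k_card(1) l_card])

lemma ordLeq_k_infinite:
  assumes "a \<prec> l" "seg r (k a) \<le>o |A|"
  shows "infinite A"
proof
  assume "finite A"
  then have "|A| <o seg r (k a)"
    using finite_ordLess_infinite[OF card_of_Well_order Well_order_seg] k_card(2)[OF assms(1)]
    by (simp add: Field_card_of Field_seg[OF wo])
  then show False using assms(2) not_ordLess_ordLeq by blast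
qed

lemma ever_branching_iff:
  assumes "is_tree r l k T"
  shows "ever_branching r l k T \<longleftrightarrow>
    (\<forall>s \<in> T. \<forall>a \<in> underS r l. \<exists>t \<in> T. s \<subseteq>\<^sub>m t \<and> seg r (k a) \<le>o |OSucc r T t| )"
proof -
  have "c \<le>o |Succs T t| \<longleftrightarrow> c \<le>o |OSucc r T t|" if "t \<in> T" for t and c :: "'a rel"
    using ordLeq_ordIso_trans[OF _ Succs_card[OF assms that]]
      ordLeq_ordIso_trans[OF _ ordIso_symmetric[OF Succs_card[OF assms that]]] by blast
  then show ?thesis unfolding ever_branching_def by blast
qed

lemma Laver_stem_iff:
  assumes "is_tree r l k T"
  shows "Laver_stem r k T s \<longleftrightarrow> s \<in> T \<and> (\<forall>t \<in> T. s \<subseteq>\<^sub>m t \<or> t \<subseteq>\<^sub>m s) \<and>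
    (\<forall>t \<in> T. s \<subseteq>\<^sub>m t \<longrightarrow> |OSucc r T t| =o seg r (k (h t)))"
proof -
  have "|Succs T t| =o c \<longleftrightarrow> |OSucc r T t| =o c" if "t \<in> T" for t and c :: "'a rel"
    using ordIso_transitive[OF Succs_card[OF assms that]]
      ordIso_transitive[OF ordIso_symmetric[OF Succs_card[OF assms that]]] by blast
  then show ?thesis unfolding Laver_stem_def by blast
qed

text \<open>The scheme for Laver trees: nodes not above \<open>s\<close> are guided to
  \<open>s\<close>, all others branch into \<open>Z\<close>.\<close>

lemma stem_shrink:
  assumes p: "is_tree r l k p" "lt_closed r l p" and s: "s \<in> p" "\<forall>t \<in> p. s \<subseteq>\<^sub>m t \<or> t \<subseteq>\<^sub>m s"
    and Z: "\<And>t. t \<in> p \<Longrightarrow> s \<subseteq>\<^sub>m t \<Longrightarrow> Z t \<subseteq> OSucc r p t" "\<And>t. t \<in> p \<Longrightarrow> s \<subseteq>\<^sub>m t \<Longrightarrow> Z t \<noteq> {}"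
  obtains p' where "p' \<subseteq> p" "is_tree r l k p'" "lt_closed r l p'" "s \<in> p'"
    "\<forall>t \<in> p'. s \<subseteq>\<^sub>m t \<longrightarrow> OSucc r p' t = Z t" "\<forall>t \<in> p'. seg r l <o |OSucc r p' t| \<longrightarrow> s \<subseteq>\<^sub>m t"
proof -
  define g where "g v = (if s \<subseteq>\<^sub>m v then v else s)" for v
  have g: "g v \<in> p" "v \<subseteq>\<^sub>m g v" if "v \<in> p" for v using that s map_le_refl by (auto simp: g_def)
  have gv: "s \<subseteq>\<^sub>m v" if "g v = v" for v using that map_le_refl by (metis g_def)
  have gw: "g w = g v" if "v \<subseteq>\<^sub>m w" "w \<subseteq>\<^sub>m g v" for v w
  proof (cases "s \<subseteq>\<^sub>m v")
    case True
    then show ?thesis using that map_le_antisym by (auto simp: g_def)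
  next
    case False
    then have "w \<subseteq>\<^sub>m s" "g v = s" using that(2) by (auto simp: g_def)
    then show ?thesis using map_le_antisym by (auto simp: g_def)
  qed
  have "guide p g Z"
    unfolding guide_def using p g gw Z gv by blast
  note G = guided_tree[OF this]
  \<comment> \<open>The root belongs to the guided tree, hence so does its target.\<close>
  have "g Map.empty = s" using map_le_antisym[of s Map.empty] by (auto simp: g_def)
  then have "s \<in> guided p g Z" using G(4)[OF treeD(3)[OF G(2)]] by simp
  moreover have "g t = t" if "s \<subseteq>\<^sub>m t" for t using that by (simp add: g_def)
  ultimately show ?thesis
    using that[OF G(1,2,3)] G(5,6) gv by blast
qed

end

section \<open>Density of the thinned conditions\<close>

context kappa_seq
begin

text \<open>The scheme for Miller trees: each node is guided to a coherently chosen member of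
  \<open>F\<close> above it. \<open>F'\<close> consists of the members that are their own target;
  another member of \<open>F\<close> met on the way keeps a single successor.\<close>

lemma cofinal_shrink:
  assumes p: "is_tree r l k p" "lt_closed r l p" and F: "F \<subseteq> p" "\<forall>s \<in> p. \<exists>t \<in> F. s \<subseteq>\<^sub>m t"
    and Z: "\<And>t. t \<in> F \<Longrightarrow> Z t \<subseteq> OSucc r p t" "\<And>t. t \<in> F \<Longrightarrow> Z t \<noteq> {}"
  obtains p' F' where "p' \<subseteq> p" "is_tree r l k p'" "lt_closed r l p'" "F' \<subseteq> F" "F' \<subseteq> p'"
    "\<forall>s \<in> p'. \<exists>t \<in> F'. s \<subseteq>\<^sub>m t" "\<forall>t \<in> F'. OSucc r p' t = Z t"
    "\<forall>t \<in> p'. seg r l <o |OSucc r p' t| \<longrightarrow> t \<in> F'"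
proof -
  obtain sel :: "'a node set \<Rightarrow> 'a node" where sel: "\<And>S. S \<noteq> {} \<Longrightarrow> sel S \<in> S"
    "\<And>S S'. S' \<subseteq> S \<Longrightarrow> sel S \<in> S' \<Longrightarrow> sel S' = sel S"
    using coherent_choice by blast
  define g where "g v = sel {t \<in> F. v \<subseteq>\<^sub>m t}" for v
  have g: "g v \<in> F" "v \<subseteq>\<^sub>m g v" if "v \<in> p" for v
    using sel(1)[of "{t \<in> F. v \<subseteq>\<^sub>m t}"] F(2) that unfolding g_def by blast+
  have gw: "g w = g v" if "v \<in> p" "v \<subseteq>\<^sub>m w" "w \<subseteq>\<^sub>m g v" for v w
    unfolding g_def
  proof (rule sel(2))
    show "{t \<in> F. w \<subseteq>\<^sub>m t} \<subseteq> {t \<in> F. v \<subseteq>\<^sub>m t}" using map_le_trans[OF that(2)] by blast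
    show "sel {t \<in> F. v \<subseteq>\<^sub>m t} \<in> {t \<in> F. w \<subseteq>\<^sub>m t}" using g(1)[OF that(1)] that(3) unfolding g_def by blast
  qed
  have gF: "v \<in> F" if "v \<in> p" "g v = v" for v using g(1)[OF that(1)] that(2) by simp
  have "g v \<in> p" if "v \<in> p" for v using g(1)[OF that] F(1) by blast
  then have "guide p g Z"
    unfolding guide_def using p g(2) gw Z gF by blast
  note G = guided_tree[OF this]
  let ?p = "guided p g Z"
  let ?F = "{v \<in> ?p. g v = v}"
  have gg: "g (g v) = g v" if "v \<in> ?p" for v using gw[of v "g v"] g(2) G(1) that map_le_refl by blast
  show ?thesis
  proof (rule that[OF G(1,2,3), of ?F])
    show "?F \<subseteq> F" using gF G(1) by blast
    show "?F \<subseteq> ?p" by blast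
    show "\<forall>s \<in> ?p. \<exists>t \<in> ?F. s \<subseteq>\<^sub>m t" using G(1,4) gg g(2) by blast
    show "\<forall>t \<in> ?F. OSucc r ?p t = Z t" using G(5) by blast
    show "\<forall>t \<in> ?p. seg r l <o |OSucc r ?p t| \<longrightarrow> t \<in> ?F" using G(6) by blast
  qed
qed

text \<open>The restriction to more than lambda successors leaves out the nodes on the way to a
  target: their single successor may already have the least rank.\<close>

definition rank_drop :: "'a node set \<Rightarrow> 'a node set \<Rightarrow> bool" where
  "rank_drop p' p \<longleftrightarrow> p' \<subseteq> p \<and> (\<forall>t \<in> p'. seg r l <o |OSucc r p' t| \<longrightarrow>
     (\<forall>y \<in> OSucc r p' t. min_rank (OSucc r p' t) y \<prec> min_rank (OSucc r p t) y))"

definition constant_on :: "('a \<Rightarrow> 'a) \<Rightarrow> 'a node set \<Rightarrow> 'a node set \<Rightarrow> bool" where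
  "constant_on e p' p \<longleftrightarrow> p' \<subseteq> p \<and> (\<forall>t \<in> p'. seg r l <o |OSucc r p' t| \<longrightarrow>
     (\<exists>c. c \<prec> k (h t) \<and> (\<forall>y \<in> OSucc r p' t. e y = c)))"

lemma OSucc_Field:
  assumes "is_tree r l k T" "t \<in> T"
  shows "OSucc r T t \<subseteq> Field r"
  using OSucc_subset[OF assms] lt_Field(1) by blast

lemma succ_points_OSucc:
  assumes p: "is_tree r l k p" "t \<in> p" and inf: "infinite (OSucc r p t)"
  shows "succ_points (OSucc r p t) \<noteq> {}"
  using succ_points_card[OF OSucc_Field[OF p] inf] inf card_of_ordIso_finite by fastforce

lemma Laver_rank_drop:
  assumes "p \<in> Laver r l k"
  shows "\<exists>p' \<in> Laver r l k. rank_drop p' p"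
proof -
  obtain s where p: "is_tree r l k p" "lt_closed r l p" and "Laver_stem r k p s"
    using assms by (auto simp: Laver_def)
  then have s: "s \<in> p" "\<forall>t \<in> p. s \<subseteq>\<^sub>m t \<or> t \<subseteq>\<^sub>m s" "\<And>t. t \<in> p \<Longrightarrow> s \<subseteq>\<^sub>m t \<Longrightarrow> |OSucc r p t| =o seg r (k (h t))"
    using Laver_stem_iff[OF p(1)] by blast+
  have hl: "h t \<prec> l" if "t \<in> p" for t using nodeD(1)[OF treeD(1)[OF p(1) that]] .
  have inf: "infinite (OSucc r p t)" if "t \<in> p" "s \<subseteq>\<^sub>m t" for t
    using ordLeq_k_infinite[OF hl[OF that(1)]] s(3)[OF that] ordIso_symmetric ordIso_imp_ordLeq by blast
  define Z where "Z t = succ_points (OSucc r p t)" for t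
  have Z1: "Z t \<subseteq> OSucc r p t" for t unfolding Z_def by (rule succ_points_subset)
  have Z2: "Z t \<noteq> {}" if "t \<in> p" "s \<subseteq>\<^sub>m t" for t
    unfolding Z_def using succ_points_OSucc[OF p(1) that(1) inf[OF that]] .
  obtain p' where p': "p' \<subseteq> p" "is_tree r l k p'" "lt_closed r l p'" "s \<in> p'"
    "\<forall>t \<in> p'. s \<subseteq>\<^sub>m t \<longrightarrow> OSucc r p' t = Z t" "\<forall>t \<in> p'. seg r l <o |OSucc r p' t| \<longrightarrow> s \<subseteq>\<^sub>m t"
    by (rule stem_shrink[of p s Z, OF p s(1,2) Z1 Z2])
  have "|OSucc r p' t| =o seg r (k (h t))" if t: "t \<in> p'" "s \<subseteq>\<^sub>m t" for t
  proof -
    have tp: "t \<in> p" using t(1) p'(1) by blast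
    have "|Z t| =o |OSucc r p t|"
      unfolding Z_def by (rule succ_points_card[OF OSucc_Field[OF p(1) tp] inf[OF tp t(2)]])
    then show ?thesis using p'(5) t s(3)[OF tp t(2)] ordIso_transitive by auto
  qed
  then have "Laver_stem r k p' s" using Laver_stem_iff[OF p'(2)] p'(1,4) s(2) by blast
  then have "p' \<in> Laver r l k" using p'(2,3) by (auto simp: Laver_def)
  moreover have "rank_drop p' p"
    unfolding rank_drop_def
  proof (intro conjI ballI impI)
    fix t y assume t: "t \<in> p'" "seg r l <o |OSucc r p' t|" and y: "y \<in> OSucc r p' t"
    have tp: "t \<in> p" using t(1) p'(1) by blast
    have "OSucc r p' t = succ_points (OSucc r p t)" using p'(5,6) t unfolding Z_def by blast
    then show "min_rank (OSucc r p' t) y \<prec> min_rank (OSucc r p t) y"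
      using min_rank_succ_points[OF OSucc_Field[OF p(1) tp]] y by simp
  qed (rule p'(1))
  ultimately show ?thesis by blast
qed

lemma Miller_iff:
  "p \<in> Miller r l k \<longleftrightarrow> is_tree r l k p \<and> lt_closed r l p \<and>
     (\<forall>s \<in> p. \<forall>a \<in> underS r l. \<exists>t \<in> p. s \<subseteq>\<^sub>m t \<and> seg r (k a) \<le>o |OSucc r p t| )"
  using ever_branching_iff[of p] by (auto simp: Miller_def perfect_tree_def)

lemma max_lt:
  assumes "a \<prec> c" "b \<prec> c"
  obtains m where "m \<prec> c" "a = m \<or> a \<prec> m" "b = m \<or> b \<prec> m"
  using lt_linear[of a b] lt_Field(1)[OF assms(1)] lt_Field(1)[OF assms(2)] assms by blast

text \<open>The choice of \<open>F\<close> transfers largeness from heights to successor sets: above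
  any member \<open>v\<close> of \<open>F\<close>, the next member has at least as many successors
  as the cardinal at the height of \<open>v\<close>. As heights are unbounded, two consecutive
  members above a high node suffice for ever-branching.\<close>

lemma Miller_rank_drop:
  assumes "p \<in> Miller r l k"
  shows "\<exists>p' \<in> Miller r l k. rank_drop p' p"
proof -
  have p: "is_tree r l k p" "lt_closed r l p"
    and br: "\<And>s a. s \<in> p \<Longrightarrow> a \<prec> l \<Longrightarrow> \<exists>t \<in> p. s \<subseteq>\<^sub>m t \<and> seg r (k a) \<le>o |OSucc r p t|"
    using assms by (auto simp: Miller_iff)
  have pN: "t \<in> N" if "t \<in> p" for t using treeD(1)[OF p(1) that] .
  have hl: "h t \<prec> l" if "t \<in> p" for t using nodeD(1)[OF pN[OF that]] .
  obtain a0 where a0: "a0 \<prec> l" "l \<prec> k a0" using k_large by blast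
  let ?X = "{t \<in> p. seg r (k a0) \<le>o |OSucc r p t|}"
  let ?Q = "\<lambda>v t. v \<subseteq>\<^sub>m t \<and> v \<noteq> t \<longrightarrow> seg r (k (h v)) \<le>o |OSucc r p t|"
  \<comment> \<open>The splitting nodes to be kept: along every branch their sizes catch up with the heights of
    earlier ones, which makes the thinned tree ever-branching without a transfinite construction.\<close>
  obtain F where F: "F \<subseteq> ?X" "\<forall>v \<in> F. \<forall>t \<in> F. ?Q v t"
    "\<forall>x \<in> ?X. ?Q x x \<and> (\<forall>v \<in> F. ?Q v x \<and> ?Q x v) \<longrightarrow> x \<in> F"
    using max_clique[of ?X ?Q] by (elim exE conjE)
  have dense: "\<exists>t \<in> F. s \<subseteq>\<^sub>m t" if s: "s \<in> p" for s
  proof (rule ccontr)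
    assume no: "\<not> ?thesis"
    \<comment> \<open>\<open>a\<close> dominates \<open>a0\<close>, so that \<open>t\<close>
      qualifies for \<open>?X\<close>, and the height of \<open>s\<close>, so that \<open>t\<close>
      satisfies \<open>?Q\<close> over all members of \<open>F\<close> below it: these are below
      \<open>s\<close>, as none is above \<open>s\<close>. Thus \<open>t\<close> could be added to
      \<open>F\<close>.\<close>
    obtain a where a: "a \<prec> l" "a0 = a \<or> a0 \<prec> a" "h s = a \<or> h s \<prec> a"
      using max_lt[OF a0(1) hl[OF s]] .
    obtain t where t: "t \<in> p" "s \<subseteq>\<^sub>m t" "seg r (k a) \<le>o |OSucc r p t|" using br[OF s a(1)] by blast
    have k: "seg r (k b) \<le>o |OSucc r p t|" if "b = a \<or> b \<prec> a" for b
      using seg_k_mono[OF a(1) that] t(3) ordLeq_transitive by blast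
    have "?Q v t \<and> ?Q t v" if v: "v \<in> F" for v
    proof -
      have vp: "v \<in> p" using v F(1) by blast
      have nsv: "\<not> s \<subseteq>\<^sub>m v" using no v by blast
      have "?Q v t"
      proof
        assume vt: "v \<subseteq>\<^sub>m t \<and> v \<noteq> t"
        then have "v \<subseteq>\<^sub>m s" using map_le_linear[OF pN[OF vp] pN[OF s] _ t(2)] nsv by blast
        then have "h v = h s \<or> h v \<prec> h s" by (rule map_le_h[OF pN[OF vp] pN[OF s]])
        then have "h v = a \<or> h v \<prec> a" using a(3) lt_trans[of "h v" "h s" a] by auto
        then show "seg r (k (h v)) \<le>o |OSucc r p t|" by (rule k)
      qed
      moreover have "\<not> t \<subseteq>\<^sub>m v" using nsv map_le_trans[OF t(2)] by blast
      ultimately show ?thesis by blast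
    qed
    moreover have "t \<in> ?X" using t(1) k[OF a(2)] by blast
    ultimately have "t \<in> F" using F(3) by blast
    then show False using no t(2) by blast
  qed
  have Fp: "F \<subseteq> p" using F(1) by blast
  have inf: "infinite (OSucc r p t)" if "t \<in> F" for t
    using ordLeq_k_infinite[OF a0(1)] F(1) that by blast
  define Z where "Z t = succ_points (OSucc r p t)" for t
  have Z1: "Z t \<subseteq> OSucc r p t" for t unfolding Z_def by (rule succ_points_subset)
  have Z2: "Z t \<noteq> {}" if "t \<in> F" for t
    unfolding Z_def using succ_points_OSucc[OF p(1) _ inf[OF that]] Fp that by blast
  obtain p' F' where p': "p' \<subseteq> p" "is_tree r l k p'" "lt_closed r l p'" "F' \<subseteq> F" "F' \<subseteq> p'"
    "\<forall>s \<in> p'. \<exists>t \<in> F'. s \<subseteq>\<^sub>m t" "\<forall>t \<in> F'. OSucc r p' t = Z t"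
    "\<forall>t \<in> p'. seg r l <o |OSucc r p' t| \<longrightarrow> t \<in> F'"
    by (rule cofinal_shrink[of p F Z, OF p Fp _ Z1 Z2]) (use dense in blast)+
  have p'N: "t \<in> N" if "t \<in> p'" for t using pN p'(1) that by blast
  have "\<exists>t \<in> p'. s \<subseteq>\<^sub>m t \<and> seg r (k a) \<le>o |OSucc r p' t|" if s: "s \<in> p'" and a: "a \<prec> l" for s a
  proof -
    obtain u where u: "u \<in> p'" "s \<subseteq>\<^sub>m u" "a = h u \<or> a \<prec> h u"
      using heights_unbounded[OF p'(2,3) s a] by blast
    obtain t1 where t1: "t1 \<in> F'" "u \<subseteq>\<^sub>m t1" using p'(6) u(1) by blast
    have t1p: "t1 \<in> p'" using t1 p'(5) by blast
    \<comment> \<open>Going through a successor of \<open>t1\<close> makes the second splitting node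
      \<open>t2\<close> different from \<open>t1\<close>, as \<open>F(2)\<close> requires.\<close>
    obtain y where y: "y \<in> OSucc r p' t1" using p'(7) Z2 t1(1) p'(4) by blast
    then have x: "ext t1 y \<in> p'" by (simp add: OSucc_def)
    obtain t2 where t2: "t2 \<in> F'" "ext t1 y \<subseteq>\<^sub>m t2" using p'(6) x by blast
    have le: "t1 \<subseteq>\<^sub>m t2" using map_le_trans[OF map_le_ext(1)[OF p'N[OF t1p]] t2(2)] .
    have "t1 \<noteq> t2"
    proof
      assume "t1 = t2"
      then have "ext t1 y = t1"
        using t2(2) map_le_ext(1)[OF p'N[OF t1p]] map_le_antisym by blast
      then show False using map_le_ext(2)[OF p'N[OF t1p], of y] by simp
    qed
    then have "seg r (k (h t1)) \<le>o |OSucc r p t2|" using F(2) p'(4) t1(1) t2(1) le by blast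
    moreover have "|OSucc r p t2| =o |OSucc r p' t2|"
    proof -
      have "t2 \<in> F" using t2(1) p'(4) by blast
      then have "|Z t2| =o |OSucc r p t2|"
        unfolding Z_def using succ_points_card[OF OSucc_Field[OF p(1)] inf] Fp by blast
      then show ?thesis using p'(7) t2(1) ordIso_symmetric by simp
    qed
    moreover have "seg r (k a) \<le>o seg r (k (h t1))"
    proof (rule seg_k_mono[OF nodeD(1)[OF p'N[OF t1p]]])
      show "a = h t1 \<or> a \<prec> h t1"
        using u(3) map_le_h[OF p'N[OF u(1)] p'N[OF t1p] t1(2)] lt_trans[of a "h u" "h t1"] by auto
    qed
    ultimately have "seg r (k a) \<le>o |OSucc r p' t2|"
      using ordLeq_transitive ordLeq_ordIso_trans by blast
    moreover have "s \<subseteq>\<^sub>m t2" using u(2) t1(2) le map_le_trans by blast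
    ultimately show ?thesis using t2(1) p'(5) by blast
  qed
  then have "p' \<in> Miller r l k" using p'(2,3) by (simp add: Miller_iff)
  moreover have "rank_drop p' p"
    unfolding rank_drop_def
  proof (intro conjI ballI impI)
    fix t y assume t: "t \<in> p'" "seg r l <o |OSucc r p' t|" and y: "y \<in> OSucc r p' t"
    have tp: "t \<in> p" using t(1) p'(1) by blast
    have "OSucc r p' t = succ_points (OSucc r p t)" using p'(7,8) t unfolding Z_def by blast
    then show "min_rank (OSucc r p' t) y \<prec> min_rank (OSucc r p t) y"
      using min_rank_succ_points[OF OSucc_Field[OF p(1) tp]] y by simp
  qed (rule p'(1))
  ultimately show ?thesis by blast
qed

section \<open>Thinning to stationary sets on which a regressive function is constant\<close>

lemma stationary_shrink:
  assumes e: "\<And>y. has_cof (seg r y) natLeq \<Longrightarrow> e y \<prec> y"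
    and t: "t \<in> N" "stat_branching r k p t"
  shows "\<exists>Z. Z \<subseteq> OSucc r p t \<and> stationary_in (seg r (k (h t))) Z \<and> (\<exists>c. c \<prec> k (h t) \<and> (\<forall>y \<in> Z. e y = c))"
proof -
  have S: "OSucc r p t \<subseteq> cof_omega_below r (k (h t))" "stationary_in (seg r (k (h t))) (OSucc r p t)"
    using t(2) by (auto simp: stat_branching_def)
  note reg = k_reg[OF nodeD(1)[OF t(1)]]
  have "e y \<prec> y" if "y \<in> OSucc r p t" for y
    using e that S(1) by (auto simp: cof_omega_below_def)
  then obtain c where "c \<prec> k (h t)" "stationary_in (seg r (k (h t))) {y \<in> OSucc r p t. e y = c}"
    using pressing_down[OF reg stationary_cof_omega_uncountable[OF reg S(2,1)] S(2), of e] by blast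
  then show ?thesis by (intro exI[of _ "{y \<in> OSucc r p t. e y = c}"]) blast
qed

lemma stationary_nonempty:
  assumes "t \<in> N" "stationary_in (seg r (k (h t))) Z"
  shows "Z \<noteq> {}" "|Z| =o seg r (k (h t))"
proof -
  note hl = nodeD(1)[OF assms(1)]
  show c: "|Z| =o seg r (k (h t))" by (rule stationary_card[OF k_reg[OF hl] assms(2)])
  then have "infinite Z"
    using ordLeq_k_infinite[OF hl] ordIso_symmetric ordIso_imp_ordLeq by blast
  then show "Z \<noteq> {}" by auto
qed

text \<open>A stationary subset of a regular cardinal has full size, which recovers the size clause
  of \<open>Laver_stem\<close>.\<close>

lemma Laver_stat_iff:
  "p \<in> Laver_stat r l k \<longleftrightarrow> is_tree r l k p \<and> lt_closed r l p \<and>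
     (\<exists>s \<in> p. (\<forall>t \<in> p. s \<subseteq>\<^sub>m t \<or> t \<subseteq>\<^sub>m s) \<and> (\<forall>t \<in> p. s \<subseteq>\<^sub>m t \<longrightarrow> stat_branching r k p t))"
proof (cases "is_tree r l k p")
  case True
  have "|OSucc r p t| =o seg r (k (h t))" if "t \<in> p" "stat_branching r k p t" for t
    using stationary_nonempty(2)[OF treeD(1)[OF True that(1)]] that(2) by (simp add: stat_branching_def)
  then show ?thesis
    unfolding Laver_stat_def using Laver_stem_iff[OF True] by blast
qed (simp add: Laver_stat_def)

text \<open>Ever-branching is recovered from height: above a node of height at least
  \<open>a\<close>, a stationary branching node has at least \<open>k a\<close> successors.\<close>

lemma Miller_stat_iff:
  "p \<in> Miller_stat r l k \<longleftrightarrow> is_tree r l k p \<and> lt_closed r l p \<and>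
     (\<forall>s \<in> p. \<exists>t \<in> p. s \<subseteq>\<^sub>m t \<and> stat_branching r k p t)"
proof (intro iffI conjI)
  assume p: "is_tree r l k p \<and> lt_closed r l p \<and> (\<forall>s \<in> p. \<exists>t \<in> p. s \<subseteq>\<^sub>m t \<and> stat_branching r k p t)"
  have pN: "t \<in> N" if "t \<in> p" for t using treeD(1) p that by blast
  have "\<exists>t \<in> p. s \<subseteq>\<^sub>m t \<and> seg r (k a) \<le>o |OSucc r p t|" if s: "s \<in> p" and a: "a \<prec> l" for s a
  proof -
    obtain u where u: "u \<in> p" "s \<subseteq>\<^sub>m u" "a = h u \<or> a \<prec> h u"
      using heights_unbounded[of p] p s a by blast
    obtain t where t: "t \<in> p" "u \<subseteq>\<^sub>m t" "stat_branching r k p t" using p u(1) by blast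
    have "a = h t \<or> a \<prec> h t"
      using u(3) map_le_h[OF pN[OF u(1)] pN[OF t(1)] t(2)] lt_trans[of a "h u" "h t"] by auto
    then have "seg r (k a) \<le>o seg r (k (h t))" by (rule seg_k_mono[OF nodeD(1)[OF pN[OF t(1)]]])
    moreover have "seg r (k (h t)) =o |OSucc r p t|"
      using ordIso_symmetric[OF stationary_nonempty(2)[OF pN[OF t(1)]]] t(3) by (simp add: stat_branching_def)
    ultimately have "seg r (k a) \<le>o |OSucc r p t|" by (rule ordLeq_ordIso_trans)
    moreover have "s \<subseteq>\<^sub>m t" using u(2) t(2) by (rule map_le_trans)
    ultimately show ?thesis using t(1) by blast
  qed
  then have "p \<in> Miller r l k" using p by (simp add: Miller_iff)
  then show "p \<in> Miller_stat r l k" using p by (simp add: Miller_def Miller_stat_def)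
qed (auto simp: Miller_stat_def perfect_tree_def)

lemma stat_branching_cong: "OSucc r p t = OSucc r q t \<Longrightarrow> stat_branching r k p t \<longleftrightarrow> stat_branching r k q t"
  by (simp add: stat_branching_def)

lemma Laver_stat_constant_on:
  assumes e: "\<And>y. has_cof (seg r y) natLeq \<Longrightarrow> e y \<prec> y" and "p \<in> Laver_stat r l k"
  shows "\<exists>p' \<in> Laver_stat r l k. constant_on e p' p"
proof -
  obtain s where p: "is_tree r l k p" "lt_closed r l p"
    and s: "s \<in> p" "\<forall>t \<in> p. s \<subseteq>\<^sub>m t \<or> t \<subseteq>\<^sub>m s" "\<forall>t \<in> p. s \<subseteq>\<^sub>m t \<longrightarrow> stat_branching r k p t"
    using assms(2) by (auto simp: Laver_stat_iff)
  have pN: "t \<in> N" if "t \<in> p" for t using treeD(1)[OF p(1) that] .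
  have "\<forall>t \<in> {t \<in> p. s \<subseteq>\<^sub>m t}. \<exists>Z. Z \<subseteq> OSucc r p t \<and> stationary_in (seg r (k (h t))) Z \<and>
      (\<exists>c. c \<prec> k (h t) \<and> (\<forall>y \<in> Z. e y = c))"
    using stationary_shrink[OF e pN] s(3) by blast
  from bchoice[OF this] obtain Z where Z: "\<forall>t \<in> {t \<in> p. s \<subseteq>\<^sub>m t}. Z t \<subseteq> OSucc r p t \<and>
      stationary_in (seg r (k (h t))) (Z t) \<and> (\<exists>c. c \<prec> k (h t) \<and> (\<forall>y \<in> Z t. e y = c))" ..
  have Z1: "Z t \<subseteq> OSucc r p t" if "t \<in> p" "s \<subseteq>\<^sub>m t" for t using Z that by blast
  have Z2: "Z t \<noteq> {}" if "t \<in> p" "s \<subseteq>\<^sub>m t" for t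
    using stationary_nonempty(1)[OF pN[OF that(1)]] Z that by blast
  obtain p' where p': "p' \<subseteq> p" "is_tree r l k p'" "lt_closed r l p'" "s \<in> p'"
    "\<forall>t \<in> p'. s \<subseteq>\<^sub>m t \<longrightarrow> OSucc r p' t = Z t" "\<forall>t \<in> p'. seg r l <o |OSucc r p' t| \<longrightarrow> s \<subseteq>\<^sub>m t"
    by (rule stem_shrink[of p s Z, OF p s(1,2) Z1 Z2])
  have "stat_branching r k p' t" if t: "t \<in> p'" "s \<subseteq>\<^sub>m t" for t
  proof -
    have tp: "t \<in> p" using t(1) p'(1) by blast
    have "OSucc r p' t = Z t" using p'(5) t by blast
    moreover have "Z t \<subseteq> OSucc r p t" "stationary_in (seg r (k (h t))) (Z t)" using Z tp t(2) by blast+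
    moreover have "OSucc r p t \<subseteq> cof_omega_below r (k (h t))" using s(3) tp t(2) by (auto simp: stat_branching_def)
    ultimately show ?thesis unfolding stat_branching_def by auto
  qed
  then have "p' \<in> Laver_stat r l k" using p'(1,2,3,4) s(2) unfolding Laver_stat_iff by blast
  moreover have "constant_on e p' p"
    unfolding constant_on_def
  proof (intro conjI ballI impI)
    fix t assume t: "t \<in> p'" "seg r l <o |OSucc r p' t|"
    then have "s \<subseteq>\<^sub>m t" "t \<in> p" using p'(1,6) by blast+
    moreover from this have "OSucc r p' t = Z t" using p'(5) t(1) by blast
    ultimately show "\<exists>c. c \<prec> k (h t) \<and> (\<forall>y \<in> OSucc r p' t. e y = c)" using Z by simp
  qed (rule p'(1))
  ultimately show ?thesis by blast
qed

text \<open>All stationary branching nodes may serve as targets. Unlike in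
  \<open>Miller_rank_drop\<close>, their successor sets have the full size prescribed by the height,
  so sizes need no control along branches.\<close>

lemma Miller_stat_constant_on:
  assumes e: "\<And>y. has_cof (seg r y) natLeq \<Longrightarrow> e y \<prec> y" and "p \<in> Miller_stat r l k"
  shows "\<exists>p' \<in> Miller_stat r l k. constant_on e p' p"
proof -
  have p: "is_tree r l k p" "lt_closed r l p" "\<forall>s \<in> p. \<exists>t \<in> p. s \<subseteq>\<^sub>m t \<and> stat_branching r k p t"
    using assms(2) by (auto simp: Miller_stat_iff)
  have pN: "t \<in> N" if "t \<in> p" for t using treeD(1)[OF p(1) that] .
  let ?F = "{t \<in> p. stat_branching r k p t}"
  have "\<forall>t \<in> ?F. \<exists>Z. Z \<subseteq> OSucc r p t \<and> stationary_in (seg r (k (h t))) Z \<and>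
      (\<exists>c. c \<prec> k (h t) \<and> (\<forall>y \<in> Z. e y = c))"
    using stationary_shrink[OF e pN] by blast
  from bchoice[OF this] obtain Z where Z: "\<forall>t \<in> ?F. Z t \<subseteq> OSucc r p t \<and>
      stationary_in (seg r (k (h t))) (Z t) \<and> (\<exists>c. c \<prec> k (h t) \<and> (\<forall>y \<in> Z t. e y = c))" ..
  have Z1: "Z t \<subseteq> OSucc r p t" if "t \<in> ?F" for t using Z that by blast
  have Z2: "Z t \<noteq> {}" if "t \<in> ?F" for t
    using stationary_nonempty(1)[OF pN] Z that by blast
  obtain p' F' where p': "p' \<subseteq> p" "is_tree r l k p'" "lt_closed r l p'" "F' \<subseteq> ?F" "F' \<subseteq> p'"
    "\<forall>s \<in> p'. \<exists>t \<in> F'. s \<subseteq>\<^sub>m t" "\<forall>t \<in> F'. OSucc r p' t = Z t"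
    "\<forall>t \<in> p'. seg r l <o |OSucc r p' t| \<longrightarrow> t \<in> F'"
    by (rule cofinal_shrink[of p ?F Z, OF p(1,2) _ _ Z1 Z2]) (use p(3) in blast)+
  have "stat_branching r k p' t" if t: "t \<in> F'" for t
  proof -
    have "OSucc r p' t = Z t" using p'(7) t by blast
    moreover have "Z t \<subseteq> OSucc r p t" "stationary_in (seg r (k (h t))) (Z t)" using Z t p'(4) by blast+
    moreover have "OSucc r p t \<subseteq> cof_omega_below r (k (h t))" using t p'(4) by (auto simp: stat_branching_def)
    ultimately show ?thesis unfolding stat_branching_def by auto
  qed
  then have "p' \<in> Miller_stat r l k" using p'(2,3,5,6) unfolding Miller_stat_iff by blast
  moreover have "constant_on e p' p"
    unfolding constant_on_def
  proof (intro conjI ballI impI)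
    fix t assume t: "t \<in> p'" "seg r l <o |OSucc r p' t|"
    then have "t \<in> F'" using p'(8) by blast
    moreover from this have "OSucc r p' t = Z t" "t \<in> ?F" using p'(4,7) by blast+
    ultimately show "\<exists>c. c \<prec> k (h t) \<and> (\<forall>y \<in> OSucc r p' t. e y = c)" using Z by simp
  qed (rule p'(1))
  ultimately show ?thesis by blast
qed

end

section \<open>Cones and nonemptiness\<close>

context kappa_seq
begin

lemma cone_extend:
  assumes "s \<in> cone p x" "x \<in> p"
  shows "\<exists>s' \<in> p. s \<subseteq>\<^sub>m s' \<and> x \<subseteq>\<^sub>m s'"
  using assms map_le_refl unfolding cone_def by blast

lemma Miller_cone:
  assumes "p \<in> Miller r l k" "x \<in> p"
  shows "cone p x \<in> Miller r l k"
proof -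
  have p: "is_tree r l k p" "lt_closed r l p"
    and br: "\<And>s a. s \<in> p \<Longrightarrow> a \<prec> l \<Longrightarrow> \<exists>t \<in> p. s \<subseteq>\<^sub>m t \<and> seg r (k a) \<le>o |OSucc r p t|"
    using assms(1) by (auto simp: Miller_iff)
  note C = cone_tree[OF p assms(2)]
  have "\<exists>t \<in> cone p x. s \<subseteq>\<^sub>m t \<and> seg r (k a) \<le>o |OSucc r (cone p x) t|" if s: "s \<in> cone p x" and a: "a \<prec> l" for s a
  proof -
    obtain s' where s': "s' \<in> p" "s \<subseteq>\<^sub>m s'" "x \<subseteq>\<^sub>m s'" using cone_extend[OF s assms(2)] by blast
    obtain t where t: "t \<in> p" "s' \<subseteq>\<^sub>m t" "seg r (k a) \<le>o |OSucc r p t|" using br[OF s'(1) a] by blast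
    have "x \<subseteq>\<^sub>m t" "s \<subseteq>\<^sub>m t" using map_le_trans s' t(2) by blast+
    then show ?thesis using t C(3)[OF treeD(1)[OF p(1) t(1)]] by (auto simp: cone_def)
  qed
  then show ?thesis using C(1,2) by (simp add: Miller_iff)
qed

lemma Miller_stat_cone:
  assumes "p \<in> Miller_stat r l k" "x \<in> p"
  shows "cone p x \<in> Miller_stat r l k"
proof -
  have p: "is_tree r l k p" "lt_closed r l p"
    and br: "\<And>s. s \<in> p \<Longrightarrow> \<exists>t \<in> p. s \<subseteq>\<^sub>m t \<and> stat_branching r k p t"
    using assms(1) by (auto simp: Miller_stat_iff)
  note C = cone_tree[OF p assms(2)]
  have "\<exists>t \<in> cone p x. s \<subseteq>\<^sub>m t \<and> stat_branching r k (cone p x) t" if s: "s \<in> cone p x" for s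
  proof -
    obtain s' where s': "s' \<in> p" "s \<subseteq>\<^sub>m s'" "x \<subseteq>\<^sub>m s'" using cone_extend[OF s assms(2)] by blast
    obtain t where t: "t \<in> p" "s' \<subseteq>\<^sub>m t" "stat_branching r k p t" using br[OF s'(1)] by blast
    have "x \<subseteq>\<^sub>m t" "s \<subseteq>\<^sub>m t" using map_le_trans s' t(2) by blast+
    then show ?thesis
      using t stat_branching_cong[OF C(3)[OF treeD(1)[OF p(1) t(1)]]] by (auto simp: cone_def)
  qed
  then show ?thesis using C(1,2) by (simp add: Miller_stat_iff)
qed

text \<open>The longer of \<open>s\<close> and \<open>x\<close> serves as the new stem.\<close>

lemma cone_stem:
  assumes x: "x \<in> p" and s: "s \<in> p" "\<forall>t \<in> p. s \<subseteq>\<^sub>m t \<or> t \<subseteq>\<^sub>m s"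
  shows "\<exists>s' \<in> cone p x. (\<forall>t \<in> cone p x. s' \<subseteq>\<^sub>m t \<or> t \<subseteq>\<^sub>m s') \<and> s \<subseteq>\<^sub>m s' \<and> x \<subseteq>\<^sub>m s'"
proof (cases "x \<subseteq>\<^sub>m s")
  case True
  then show ?thesis using s map_le_refl unfolding cone_def by blast
next
  case False
  then have "s \<subseteq>\<^sub>m x" using s x by blast
  then show ?thesis using x map_le_refl unfolding cone_def by blast
qed

lemma Laver_cone:
  assumes "p \<in> Laver r l k" "x \<in> p"
  shows "cone p x \<in> Laver r l k"
proof -
  obtain s where p: "is_tree r l k p" "lt_closed r l p" and "Laver_stem r k p s"
    using assms by (auto simp: Laver_def)
  then have s: "s \<in> p" "\<forall>t \<in> p. s \<subseteq>\<^sub>m t \<or> t \<subseteq>\<^sub>m s" "\<And>t. t \<in> p \<Longrightarrow> s \<subseteq>\<^sub>m t \<Longrightarrow> |OSucc r p t| =o seg r (k (h t))"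
    using Laver_stem_iff[OF p(1)] by blast+
  note C = cone_tree[OF p assms(2)]
  obtain s' where s': "s' \<in> cone p x" "\<forall>t \<in> cone p x. s' \<subseteq>\<^sub>m t \<or> t \<subseteq>\<^sub>m s'" "s \<subseteq>\<^sub>m s'" "x \<subseteq>\<^sub>m s'"
    using cone_stem[OF assms(2) s(1,2)] by blast
  have "|OSucc r (cone p x) t| =o seg r (k (h t))" if t: "t \<in> cone p x" "s' \<subseteq>\<^sub>m t" for t
  proof -
    have tp: "t \<in> p" using t(1) by (simp add: cone_def)
    have "s \<subseteq>\<^sub>m t" "x \<subseteq>\<^sub>m t" using map_le_trans[OF _ t(2)] s' by blast+
    then show ?thesis using C(3)[OF treeD(1)[OF p(1) tp]] s(3)[OF tp] by simp
  qed
  then have "Laver_stem r k (cone p x) s'" using Laver_stem_iff[OF C(1)] s' by blast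
  then show ?thesis using C(1,2) by (auto simp: Laver_def)
qed

lemma Laver_stat_cone:
  assumes "p \<in> Laver_stat r l k" "x \<in> p"
  shows "cone p x \<in> Laver_stat r l k"
proof -
  obtain s where p: "is_tree r l k p" "lt_closed r l p"
    and s: "s \<in> p" "\<forall>t \<in> p. s \<subseteq>\<^sub>m t \<or> t \<subseteq>\<^sub>m s" "\<And>t. t \<in> p \<Longrightarrow> s \<subseteq>\<^sub>m t \<Longrightarrow> stat_branching r k p t"
    using assms(1) by (auto simp: Laver_stat_iff)
  note C = cone_tree[OF p assms(2)]
  obtain s' where s': "s' \<in> cone p x" "\<forall>t \<in> cone p x. s' \<subseteq>\<^sub>m t \<or> t \<subseteq>\<^sub>m s'" "s \<subseteq>\<^sub>m s'" "x \<subseteq>\<^sub>m s'"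
    using cone_stem[OF assms(2) s(1,2)] by blast
  have "stat_branching r k (cone p x) t" if t: "t \<in> cone p x" "s' \<subseteq>\<^sub>m t" for t
  proof -
    have tp: "t \<in> p" using t(1) by (simp add: cone_def)
    have "s \<subseteq>\<^sub>m t" "x \<subseteq>\<^sub>m t" using map_le_trans[OF _ t(2)] s' by blast+
    then show ?thesis using stat_branching_cong[OF C(3)[OF treeD(1)[OF p(1) tp]]] s(3)[OF tp] by simp
  qed
  then show ?thesis using C(1,2) s' unfolding Laver_stat_iff by blast
qed

lemma Laver_subset_Miller: "Laver r l k \<subseteq> Miller r l k"
proof
  fix p assume "p \<in> Laver r l k"
  then obtain s where p: "is_tree r l k p" "lt_closed r l p" and "Laver_stem r k p s"
    by (auto simp: Laver_def)
  then have s: "s \<in> p" "\<forall>t \<in> p. s \<subseteq>\<^sub>m t \<or> t \<subseteq>\<^sub>m s" "\<And>t. t \<in> p \<Longrightarrow> s \<subseteq>\<^sub>m t \<Longrightarrow> |OSucc r p t| =o seg r (k (h t))"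
    using Laver_stem_iff[OF p(1)] by blast+
  have "\<exists>t \<in> p. u \<subseteq>\<^sub>m t \<and> seg r (k a) \<le>o |OSucc r p t|" if u: "u \<in> p" and a: "a \<prec> l" for u a
  proof -
    obtain u' where u': "u' \<in> p" "u \<subseteq>\<^sub>m u'" "s \<subseteq>\<^sub>m u'" using s(1,2) u map_le_refl by blast
    obtain t where t: "t \<in> p" "u' \<subseteq>\<^sub>m t" "a = h t \<or> a \<prec> h t"
      using heights_unbounded[OF p u'(1) a] by blast
    have ut: "u \<subseteq>\<^sub>m t" "s \<subseteq>\<^sub>m t" using map_le_trans[OF _ t(2)] u' by blast+
    have "seg r (k a) \<le>o seg r (k (h t))"
      using seg_k_mono[OF nodeD(1)[OF treeD(1)[OF p(1) t(1)]] t(3)] .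
    then have "seg r (k a) \<le>o |OSucc r p t|"
      by (rule ordLeq_ordIso_trans[OF _ ordIso_symmetric[OF s(3)[OF t(1) ut(2)]]])
    then show ?thesis using t(1) ut(1) by blast
  qed
  then show "p \<in> Miller r l k" using p by (simp add: Miller_iff)
qed

lemma Laver_stat_subset_Miller_stat: "Laver_stat r l k \<subseteq> Miller_stat r l k"
proof
  fix p assume "p \<in> Laver_stat r l k"
  then show "p \<in> Miller_stat r l k"
    unfolding Laver_stat_iff Miller_stat_iff using map_le_refl by blast
qed

lemma Laver_stat_subset_Laver: "Laver_stat r l k \<subseteq> Laver r l k"
  by (auto simp: Laver_stat_def Laver_def)

lemma Miller_stat_subset_Miller: "Miller_stat r l k \<subseteq> Miller r l k"
  by (auto simp: Miller_stat_def Miller_def)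

section \<open>A stationary Laver tree exists\<close>

lemma nodes_tree: "is_tree r l k N" "lt_closed r l N"
proof -
  show "is_tree r l k N" using empty_node(1) by (auto simp: is_tree_def)
  show "lt_closed r l N"
    unfolding lt_closed_def
  proof (intro conjI ballI allI impI)
    fix s assume s: "s \<in> N"
    have "underS r (k (h s)) \<noteq> {}" using k_card(2)[OF nodeD(1)[OF s]] by auto
    then obtain b where "b \<prec> k (h s)" by blast
    then show "\<exists>t \<in> N. s \<subseteq>\<^sub>m t \<and> t \<noteq> s"
      using ext_node(1)[OF s] map_le_ext[OF s, of b] by metis
  next
    fix d f assume d: "d \<prec> l" and "limit_ord r d \<and> dom f = underS r d \<and> (\<forall>b \<in> underS r d. f |` underS r b \<in> N)"
    then have f: "limit_ord r d" "dom f = underS r d" "\<And>b. b \<prec> d \<Longrightarrow> f |` underS r b \<in> N" by auto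
    show "f \<in> N"
    proof (rule nodeI(1)[OF d f(2)])
      fix b assume "b \<prec> d"
      then obtain c where c: "b \<prec> c" "c \<prec> d" using f(1) unfolding limit_ord_def by blast
      have "dom (f |` underS r c) = underS r c" using f(2) lt_trans[OF _ c(2)] by auto
      then have "h (f |` underS r c) = c" using ht_eqI lt_Field(1)[OF c(2)] by blast
      then show "the (f b) \<prec> k b" using nodeD(3)[OF f(3)[OF c(2)], of b] c(1) by simp
    qed
  qed
qed

text \<open>The stem has height one because \<open>k\<close> may start with the countable cardinal, below which no
  ordinal has cofinality \<open>\<omega>\<close>.\<close>

lemma Laver_stat_nonempty: "Laver_stat r l k \<noteq> {}"
proof -
  let ?e = "Map.empty :: 'a node"
  note e = empty_node(1)
  have "underS r (k (h ?e)) \<noteq> {}" using k_card(2)[OF nodeD(1)[OF e]] by auto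
  then obtain z where z: "z \<prec> k (h ?e)" by blast
  define s where "s = ext ?e z"
  have s: "s \<in> N" "?e \<noteq> s" using ext_node(1)[OF e z] map_le_ext(2)[OF e, of z] by (auto simp: s_def)
  define g where "g v = (if v = ?e then s else v)" for v
  define Z where "Z v = cof_omega_below r (k (h v))" for v
  have e_le: "v = ?e" if "v \<subseteq>\<^sub>m ?e" for v using map_le_antisym[OF that] by simp
  have stat: "stationary_in (seg r (k (h v))) (Z v)" if v: "v \<in> N" "v \<noteq> ?e" for v
  proof -
    have lt: "h ?e \<prec> h v" using map_le_h_lt[OF e v(1)] v(2) by simp
    have hl: "h v \<prec> l" using nodeD(1)[OF v(1)] .
    \<comment> \<open>The cardinal at the root is infinite, so those at larger heights are
      uncountable, as stationarity of the points of cofinality omega requires.\<close>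
    have "natLeq \<le>o |underS r (k (h ?e))|"
      using k_card(2)[OF nodeD(1)[OF e]] infinite_iff_natLeq_ordLeq by blast
    then have "natLeq <o seg r (k (h v))"
      using card_of_underS[OF k_card(1)[OF hl] k_mono[OF hl lt]] by (rule ordLeq_ordLess_trans)
    then show ?thesis unfolding Z_def by (rule cof_omega_below_stationary[OF k_reg[OF hl]])
  qed
  have "guide N g Z"
    unfolding guide_def
  proof (intro conjI ballI impI nodes_tree)
    fix v assume v: "v \<in> N"
    show "g v \<in> N" "v \<subseteq>\<^sub>m g v" using v s(1) map_le_refl by (auto simp: g_def)
    show "g w = g v" if "w \<in> N" "v \<subseteq>\<^sub>m w \<and> w \<subseteq>\<^sub>m g v" for w
    proof (cases "v = ?e")
      case True
      then have "w = s \<or> w \<subseteq>\<^sub>m ?e"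
        using below_ext[OF e _ that(1), of z] s(1) that(2) by (auto simp: g_def s_def)
      then show ?thesis using True e_le by (auto simp: g_def)
    next
      case False
      then show ?thesis using that(2) map_le_antisym by (auto simp: g_def)
    qed
    assume "g v = v"
    then have "v \<noteq> ?e" using s(2) by (auto simp: g_def)
    then show "Z v \<noteq> {}" using stationary_nonempty(1)[OF v stat[OF v]] by blast
    show "Z v \<subseteq> OSucc r N v"
      using ext_node_iff[OF v] unfolding Z_def cof_omega_below_def OSucc_def by blast
  qed
  note G = guided_tree[OF this]
  let ?p = "guided N g Z"
  have "g ?e = s" by (simp add: g_def)
  then have sp: "s \<in> ?p" using G(4)[OF treeD(3)[OF G(2)]] by simp
  have comp: "s \<subseteq>\<^sub>m t \<or> t \<subseteq>\<^sub>m s" if t: "t \<in> ?p" for t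
  proof (cases "t = ?e")
    case False
    have tN: "t \<in> N" using t G(1) by blast
    have "the (t (h ?e)) \<in> (if g ?e = ?e then Z ?e else {the (g ?e (h ?e))})"
      using t e False unfolding guided_def by force
    then have "the (t (h ?e)) = z" using s(2) \<open>g ?e = s\<close> by (simp add: s_def)
    then have "s \<subseteq>\<^sub>m t" using ext_le[OF e tN] False by (simp add: s_def)
    then show ?thesis by blast
  qed simp
  have "stat_branching r k ?p t" if t: "t \<in> ?p" "s \<subseteq>\<^sub>m t" for t
  proof -
    have "t \<noteq> ?e" using t(2) e_le s(2) by blast
    moreover from this have "OSucc r ?p t = Z t" using G(5)[OF t(1)] by (simp add: g_def)
    ultimately show ?thesis
      using stat[of t] t(1) G(1) unfolding stat_branching_def by (auto simp: Z_def)
  qed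
  then have "?p \<in> Laver_stat r l k" using G(2,3) sp comp unfolding Laver_stat_iff by blast
  then show ?thesis by blast
qed

end

section \<open>Non-distributivity\<close>

context kappa_seq
begin

lemma UN_le_l:
  assumes "|I| \<le>o seg r l" "\<And>i. i \<in> I \<Longrightarrow> |A i| \<le>o seg r l"
  shows "|\<Union>i \<in> I. A i| \<le>o seg r l"
proof -
  note iso = card_of_underS_eq[OF l_card]
  have to: "|X| \<le>o |underS r l|" if "|X| \<le>o seg r l" for X :: "'c set"
    using ordLeq_ordIso_trans[OF that ordIso_symmetric[OF iso]] .
  have "|I| \<le>o |underS r l|" using ordLeq_ordIso_trans[OF assms(1) ordIso_symmetric[OF iso]] .
  moreover have "\<forall>i \<in> I. |A i| \<le>o |underS r l|" using assms(2) to by blast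
  ultimately have "|\<Union>i \<in> I. A i| \<le>o |underS r l|" by (rule card_of_UNION_ordLeq_infinite[OF l_inf])
  then show ?thesis using iso by (rule ordLeq_ordIso_trans)
qed

lemma UN_nat_le_l:
  fixes A :: "nat \<Rightarrow> 'c set"
  assumes "\<And>n. |A n| \<le>o seg r l"
  shows "|\<Union>n. A n| \<le>o seg r l"
proof (rule UN_le_l)
  show "|UNIV :: nat set| \<le>o seg r l"
    using l_inf infinite_iff_card_of_nat ordLeq_ordIso_trans[OF _ card_of_underS_eq[OF l_card]] by blast
qed (rule assms)

text \<open>The common part of both cases. \<open>R\<close> is indexed by the stage because the
  stationary case treats a different function \<open>e_n\<close> at each stage; the sets
  \<open>C n\<close> are returned because that case has to count the possible constants.\<close>

lemma distributive_chains:
  fixes R :: "nat \<Rightarrow> 'a node set \<Rightarrow> 'a node set \<Rightarrow> bool"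
  assumes dist: "distributive_any (ro P (\<subseteq>)) natLeq (cardSuc (seg r l))" and ne: "P \<noteq> {}"
    and trees: "\<And>p. p \<in> P \<Longrightarrow> is_tree r l k p \<and> lt_closed r l p"
    and cones: "\<And>p x. p \<in> P \<Longrightarrow> x \<in> p \<Longrightarrow> cone p x \<in> P"
    and R: "\<And>n p. p \<in> P \<Longrightarrow> \<exists>p' \<in> P. R n p' p"
    and R_le: "\<And>n p' p. R n p' p \<Longrightarrow> p' \<subseteq> p"
    and R_mono: "\<And>n p' p a. p \<in> P \<Longrightarrow> a \<in> P \<Longrightarrow> R n p' p \<Longrightarrow> p \<subseteq> a \<Longrightarrow> R n p' a"
  shows "\<exists>q C. q \<in> P \<and> (\<forall>n :: nat. |C n| \<le>o seg r l) \<and> (\<forall>t \<in> q. \<exists>B. |B| \<le>o seg r l \<and>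
    (\<forall>y \<in> OSucc r q t - B. \<exists>a. \<forall>n. a n \<in> C n \<and> R n (a (Suc n)) (a n) \<and> t \<in> a n \<and>
       y \<in> OSucc r (a n) t \<and> seg r l <o |OSucc r (a n) t| ))"
proof -
  have leq: "reflp ((\<subseteq>) :: 'a node set \<Rightarrow> _)" "transp ((\<subseteq>) :: 'a node set \<Rightarrow> _)"
    by (auto intro: reflpI transpI)
  have "\<exists>A. \<forall>n. max_antichain P (\<subseteq>) (A n) \<and> (\<forall>a' \<in> A (Suc n). \<exists>a \<in> A n. R n a' a)"
    by (rule refining_antichains[OF leq]) (fact R R_le R_mono)+
  then obtain A where A: "\<And>n. max_antichain P (\<subseteq>) (A n)"
    "\<And>n a'. a' \<in> A (Suc n) \<Longrightarrow> \<exists>a \<in> A n. R n a' a" by blast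
  have "\<exists>q \<in> P. \<forall>n \<in> Field natLeq. |{a \<in> A n. compatible P (\<subseteq>) q a}| \<le>o seg r l"
    by (rule distributive_any_antichains[OF leq dist l_card ne]) (rule A(1))
  then obtain q where q: "q \<in> P" "\<And>n. n \<in> Field natLeq \<Longrightarrow> |{a \<in> A n. compatible P (\<subseteq>) q a}| \<le>o seg r l"
    by blast
  define C where "C n = {a \<in> A n. compatible P (\<subseteq>) q a}" for n
  have C: "|C n| \<le>o seg r l" for n using q(2)[of n] by (simp add: C_def Field_natLeq)
  have AP: "a \<in> P" if "a \<in> A n" for a n using A(1)[of n] that by (auto simp: max_antichain_def)
  have "\<exists>B. |B| \<le>o seg r l \<and>
    (\<forall>y \<in> OSucc r q t - B. \<exists>a. \<forall>n. a n \<in> C n \<and> R n (a (Suc n)) (a n) \<and> t \<in> a n \<and>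
       y \<in> OSucc r (a n) t \<and> seg r l <o |OSucc r (a n) t| )" if t: "t \<in> q" for t
  proof -
    \<comment> \<open>The successors lost to small successor sets: at most omega times lambda sets
      of size at most lambda.\<close>
    define B where "B = (\<Union>n. \<Union>a \<in> {a \<in> C n. |OSucc r a t| \<le>o seg r l}. OSucc r a t)"
    have "|B| \<le>o seg r l"
      unfolding B_def
    proof (intro UN_nat_le_l UN_le_l)
      fix n
      have "|{a \<in> C n. |OSucc r a t| \<le>o seg r l}| \<le>o |C n|" by (rule card_of_mono1) blast
      then show "|{a \<in> C n. |OSucc r a t| \<le>o seg r l}| \<le>o seg r l" using C[of n] by (rule ordLeq_transitive)
    qed blast
    moreover have "\<exists>a. \<forall>n. a n \<in> C n \<and> R n (a (Suc n)) (a n) \<and> t \<in> a n \<and>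
       y \<in> OSucc r (a n) t \<and> seg r l <o |OSucc r (a n) t|" if y: "y \<in> OSucc r q t - B" for y
    proof -
      let ?x = "ext t y"
      have x: "?x \<in> q" using y by (simp add: OSucc_def)
      have tq: "is_tree r l k q" using trees q(1) by blast
      have tN: "t \<in> N" "?x \<in> N" using treeD(1)[OF tq] t x by blast+
      have "\<exists>w a. \<forall>n. w n \<in> P \<and> w n \<subseteq> cone q ?x \<and> w n \<subseteq> a n \<and> a n \<in> A n \<and> R n (a (Suc n)) (a n)"
        by (rule chain_through_antichains[OF leq]) (fact A R_le cones[OF q(1) x])+
      then obtain w a where w: "\<And>n. w n \<in> P" "\<And>n. w n \<subseteq> cone q ?x" "\<And>n. w n \<subseteq> a n" "\<And>n. a n \<in> A n"
        "\<And>n. R n (a (Suc n)) (a n)" by blast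
      have "a n \<in> C n \<and> R n (a (Suc n)) (a n) \<and> t \<in> a n \<and>
         y \<in> OSucc r (a n) t \<and> seg r l <o |OSucc r (a n) t|" for n
      proof -
        \<comment> \<open>The witness below both the cone and \<open>a n\<close> contains the base
          node of the cone, so \<open>a n\<close> contains it and keeps \<open>y\<close> as a
          successor of \<open>t\<close>.\<close>
        have "?x \<in> w n" using below_cone[OF _ _ w(2)[of n] tN(2)] trees[OF w(1)[of n]] by blast
        then have xa: "?x \<in> a n" using w(3) by blast
        have ya: "y \<in> OSucc r (a n) t" using xa by (simp add: OSucc_def)
        have ta: "t \<in> a n"
          using treeD(2)[of "a n", OF _ xa tN(1) map_le_ext(1)[OF tN(1)]] trees[OF AP[OF w(4)[of n]]] by blast
        have aC: "a n \<in> C n"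
          using w(1,3,4)[of n] w(2)[of n] unfolding C_def compatible_def cone_def by blast
        have "\<not> |OSucc r (a n) t| \<le>o seg r l" using y ya aC unfolding B_def by blast
        then have "seg r l <o |OSucc r (a n) t|"
          using not_ordLeq_iff_ordLess[OF Well_order_seg card_of_Well_order] by blast
        then show ?thesis using aC w(5) ta ya by blast
      qed
      then show ?thesis by blast
    qed
    ultimately show ?thesis by blast
  qed
  then show ?thesis using q(1) C by blast
qed

lemma not_distributive_rank_drop:
  assumes ne: "P \<noteq> {}" and PM: "P \<subseteq> Miller r l k"
    and cones: "\<And>p x. p \<in> P \<Longrightarrow> x \<in> p \<Longrightarrow> cone p x \<in> P"
    and R: "\<And>p. p \<in> P \<Longrightarrow> \<exists>p' \<in> P. rank_drop p' p"
  shows "\<not> distributive_any (ro P (\<subseteq>)) natLeq (cardSuc (seg r l))"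
proof
  assume dist: "distributive_any (ro P (\<subseteq>)) natLeq (cardSuc (seg r l))"
  have trees: "is_tree r l k p \<and> lt_closed r l p" if "p \<in> P" for p using PM that Miller_iff by blast
  \<comment> \<open>Enlarging a successor set can only raise ranks, so a drop relative to
    \<open>p\<close> persists relative to the larger \<open>a\<close>.\<close>
  have mono: "rank_drop p' a" if p: "p \<in> P" and a: "a \<in> P" and d: "rank_drop p' p" and le: "p \<subseteq> a" for p' p a
    unfolding rank_drop_def
  proof (intro conjI ballI impI)
    show "p' \<subseteq> a" using d le unfolding rank_drop_def by blast
    fix t y assume t: "t \<in> p'" "seg r l <o |OSucc r p' t|" and y: "y \<in> OSucc r p' t"
    have *: "min_rank (OSucc r p' t) y \<prec> min_rank (OSucc r p t) y" and sub: "p' \<subseteq> p"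
      using d t y unfolding rank_drop_def by blast+
    have "t \<in> a" using t(1) sub le by blast
    then have "OSucc r a t \<subseteq> Field r" using OSucc_Field trees[OF a] by blast
    moreover have "OSucc r p t \<subseteq> OSucc r a t" "y \<in> OSucc r p t" using le sub y unfolding OSucc_def by blast+
    ultimately have "min_rank (OSucc r p t) y = min_rank (OSucc r a t) y \<or>
        min_rank (OSucc r p t) y \<prec> min_rank (OSucc r a t) y" by (rule min_rank_mono)
    then show "min_rank (OSucc r p' t) y \<prec> min_rank (OSucc r a t) y" using * lt_trans by metis
  qed
  have "\<exists>q C. q \<in> P \<and> (\<forall>n :: nat. |C n| \<le>o seg r l) \<and> (\<forall>t \<in> q. \<exists>B. |B| \<le>o seg r l \<and>
    (\<forall>y \<in> OSucc r q t - B. \<exists>a. \<forall>n. a n \<in> C n \<and> rank_drop (a (Suc n)) (a n) \<and> t \<in> a n \<and>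
       y \<in> OSucc r (a n) t \<and> seg r l <o |OSucc r (a n) t| ))"
    by (rule distributive_chains[OF dist ne trees cones R _ mono]) (auto simp: rank_drop_def)
  then obtain q C where q: "q \<in> P" and qB: "\<forall>t \<in> q. \<exists>B. |B| \<le>o seg r l \<and>
    (\<forall>y \<in> OSucc r q t - B. \<exists>a. \<forall>n :: nat. a n \<in> C n \<and> rank_drop (a (Suc n)) (a n) \<and> t \<in> a n \<and>
       y \<in> OSucc r (a n) t \<and> seg r l <o |OSucc r (a n) t| )" by (elim exE conjE)
  obtain a0 where a0: "a0 \<prec> l" "l \<prec> k a0" using k_large by blast
  have tq: "is_tree r l k q" using trees q by blast
  obtain t where t: "t \<in> q" "seg r (k a0) \<le>o |OSucc r q t|"
    using q PM treeD(3)[OF tq] a0(1) Miller_iff by blast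
  have big: "seg r l <o |OSucc r q t|" using seg_l_less[OF a0(2,1)] t(2) by (rule ordLess_ordLeq_trans)
  obtain B where B: "|B| \<le>o seg r l" "\<forall>y \<in> OSucc r q t - B. \<exists>a. \<forall>n :: nat. a n \<in> C n \<and> rank_drop (a (Suc n)) (a n) \<and> t \<in> a n \<and>
       y \<in> OSucc r (a n) t \<and> seg r l <o |OSucc r (a n) t|" using qB t(1) by blast
  have "\<not> OSucc r q t \<subseteq> B"
  proof
    assume "OSucc r q t \<subseteq> B"
    then have "|OSucc r q t| \<le>o seg r l" using card_of_mono1 B(1) ordLeq_transitive by blast
    then show False using big not_ordLess_ordLeq by blast
  qed
  then obtain y where "y \<in> OSucc r q t - B" by blast
  then obtain a where a: "\<And>n :: nat. rank_drop (a (Suc n)) (a n)" "\<And>n. t \<in> a n"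
       "\<And>n. y \<in> OSucc r (a n) t" "\<And>n. seg r l <o |OSucc r (a n) t|" using B(2) by metis
  have "min_rank (OSucc r (a (Suc n)) t) y \<prec> min_rank (OSucc r (a n) t) y" for n
    using a(1)[of n] a(2,3,4)[of "Suc n"] unfolding rank_drop_def by blast
  then have "\<exists>f. \<forall>n :: nat. (f (Suc n), f n) \<in> {(x, y). x \<prec> y}"
    by (intro exI[of _ "\<lambda>n. min_rank (OSucc r (a n) t) y"]) simp
  then show False using wf_lt unfolding wf_iff_no_infinite_down_chain by blast
qed

lemma not_distributive_constant_on:
  assumes ne: "P \<noteq> {}" and PM: "P \<subseteq> Miller_stat r l k"
    and cones: "\<And>p x. p \<in> P \<Longrightarrow> x \<in> p \<Longrightarrow> cone p x \<in> P"
    and R: "\<And>e p. (\<And>y. has_cof (seg r y) natLeq \<Longrightarrow> e y \<prec> y) \<Longrightarrow> p \<in> P \<Longrightarrow> \<exists>p' \<in> P. constant_on e p' p"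
  shows "\<not> distributive_any (ro P (\<subseteq>)) natLeq (cardSuc (seg r l))"
proof
  assume dist: "distributive_any (ro P (\<subseteq>)) natLeq (cardSuc (seg r l))"
  have trees: "is_tree r l k p \<and> lt_closed r l p" if "p \<in> P" for p using PM that Miller_stat_iff by blast
  have "\<forall>y. \<exists>e :: nat \<Rightarrow> 'a. has_cof (seg r y) natLeq \<longrightarrow> (\<forall>n. e n \<prec> y) \<and> (\<forall>x. x \<prec> y \<longrightarrow> (\<exists>n. x \<prec> e n))"
    using omega_sequence by blast
  then obtain e where e: "\<forall>y. has_cof (seg r y) natLeq \<longrightarrow> (\<forall>n :: nat. e y n \<prec> y) \<and> (\<forall>x. x \<prec> y \<longrightarrow> (\<exists>n. x \<prec> e y n))"
    using choice[of "\<lambda>y e. has_cof (seg r y) natLeq \<longrightarrow> (\<forall>n. e n \<prec> y) \<and> (\<forall>x. x \<prec> y \<longrightarrow> (\<exists>n. x \<prec> e n))"] by blast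
  have R': "\<exists>p' \<in> P. constant_on (\<lambda>y. e y n) p' p" if "p \<in> P" for n p
    using R[of "\<lambda>y. e y n", OF _ that] e by blast
  have mono: "constant_on (\<lambda>y. e y n) p' a" if "constant_on (\<lambda>y. e y n) p' p" "p \<subseteq> a" for n p' p a
    using that unfolding constant_on_def by blast
  have "\<exists>q C. q \<in> P \<and> (\<forall>n :: nat. |C n| \<le>o seg r l) \<and> (\<forall>t \<in> q. \<exists>B. |B| \<le>o seg r l \<and>
    (\<forall>y \<in> OSucc r q t - B. \<exists>a. \<forall>n. a n \<in> C n \<and> constant_on (\<lambda>y. e y n) (a (Suc n)) (a n) \<and> t \<in> a n \<and>
       y \<in> OSucc r (a n) t \<and> seg r l <o |OSucc r (a n) t| ))"
    by (rule distributive_chains[OF dist ne trees cones R' _ mono]) (auto simp: constant_on_def)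
  then obtain q C where q: "q \<in> P" and C: "\<forall>n :: nat. |C n| \<le>o seg r l"
    and qB: "\<forall>t \<in> q. \<exists>B. |B| \<le>o seg r l \<and>
    (\<forall>y \<in> OSucc r q t - B. \<exists>a. \<forall>n. a n \<in> C n \<and> constant_on (\<lambda>y. e y n) (a (Suc n)) (a n) \<and> t \<in> a n \<and>
       y \<in> OSucc r (a n) t \<and> seg r l <o |OSucc r (a n) t| )" by (elim exE conjE)
  obtain a0 where a0: "a0 \<prec> l" "l \<prec> k a0" using k_large by blast
  have tq: "is_tree r l k q" "lt_closed r l q" using trees q by blast+
  \<comment> \<open>Climbing to height \<open>a0\<close> first guarantees that the cardinal at the
    stationary branching node \<open>t\<close> exceeds lambda.\<close>
  obtain u where u: "u \<in> q" "a0 = h u \<or> a0 \<prec> h u"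
    using heights_unbounded[OF tq treeD(3)[OF tq(1)] a0(1)] by blast
  obtain t where t: "t \<in> q" "u \<subseteq>\<^sub>m t" "stat_branching r k q t"
    using u(1) q PM Miller_stat_iff by blast
  have tN: "t \<in> N" "u \<in> N" using treeD(1)[OF tq(1)] t(1) u(1) by blast+
  note hl = nodeD(1)[OF tN(1)]
  note reg = k_reg[OF hl] and kc = k_card[OF hl]
  have "a0 = h t \<or> a0 \<prec> h t" using u(2) map_le_h[OF tN(2,1) t(2)] lt_trans[of a0 "h u" "h t"] by auto
  then have big: "seg r l <o seg r (k (h t))"
    by (rule ordLess_ordLeq_trans[OF seg_l_less[OF a0(2,1)] seg_k_mono[OF hl]])
  have S: "OSucc r q t \<subseteq> cof_omega_below r (k (h t))" "|OSucc r q t| =o seg r (k (h t))"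
    using t(3) stationary_nonempty(2)[OF tN(1)] by (auto simp: stat_branching_def)
  obtain B where B: "|B| \<le>o seg r l"
    "\<forall>y \<in> OSucc r q t - B. \<exists>a. \<forall>n. a n \<in> C n \<and> constant_on (\<lambda>y. e y n) (a (Suc n)) (a n) \<and> t \<in> a n \<and>
       y \<in> OSucc r (a n) t \<and> seg r l <o |OSucc r (a n) t|" using qB t(1) by blast
  \<comment> \<open>The constant value of the \<open>n\<close>-th function on the successor set, as
    a set with at most one element; the nonemptiness clause excludes vacuous constants.\<close>
  define V where "V n a = {c. c \<prec> k (h t) \<and> OSucc r a t \<noteq> {} \<and> (\<forall>y \<in> OSucc r a t. e y n = c)}" for n a
  have V1: "|V n a| \<le>o seg r l" for n a
  proof -
    have "finite (V n a)"
    proof (cases "V n a = {}")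
      case False
      then obtain c where "c \<in> V n a" by blast
      then have "V n a \<subseteq> {c}" unfolding V_def by auto
      then show ?thesis using finite_subset by blast
    qed simp
    then have "|V n a| <o seg r l"
      using finite_ordLess_infinite[OF card_of_Well_order Well_order_seg] l_inf
      by (simp add: Field_card_of Field_seg[OF wo])
    then show ?thesis by (rule ordLess_imp_ordLeq)
  qed
  \<comment> \<open>The index is shifted: the stage \<open>n\<close> thinning that makes
    \<open>e_n\<close> constant turns \<open>a n\<close> into \<open>a (Suc n)\<close>, a member of
    \<open>C (Suc n)\<close>.\<close>
  let ?V = "\<Union>n. \<Union>a \<in> C (Suc n). V n a"
  have "|?V| \<le>o seg r l"
    by (intro UN_nat_le_l UN_le_l V1) (use C in blast)
  then have V2: "|?V| <o seg r (k (h t))" using big by (rule ordLeq_ordLess_trans)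
  have "?V \<subseteq> underS r (k (h t))" unfolding V_def by blast
  from regular_bounded[OF reg this V2] obtain c where c: "c \<prec> k (h t)" "\<forall>x \<in> ?V. x \<prec> c"
    by (elim exE conjE)
  \<comment> \<open>The bound \<open>d\<close> leaves room above \<open>c\<close>: if
    \<open>y\<close> is not below \<open>d\<close>, then \<open>c\<close> is strictly below
    \<open>y\<close>, so some term of the cofinal sequence of \<open>y\<close> exceeds
    \<open>c\<close>, although this term is one of the constants.\<close>
  obtain d where d: "c \<prec> d" "d \<prec> k (h t)" using inf_card_limit[OF kc c(1)] .
  have "y \<prec> d" if y: "y \<in> OSucc r q t - B" for y
  proof (rule ccontr)
    assume n: "\<not> y \<prec> d"
    have yc: "y \<prec> k (h t)" "has_cof (seg r y) natLeq" using y S(1) by (auto simp: cof_omega_below_def)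
    have "y = d \<or> d \<prec> y" using lt_linear[of y d] lt_Field(1)[OF yc(1)] lt_Field(1)[OF d(2)] n by blast
    then have "c \<prec> y" using d(1) lt_trans by blast
    then obtain n where n: "c \<prec> e y n" using e yc(2) by blast
    obtain a where a: "\<forall>n. a n \<in> C n \<and> constant_on (\<lambda>y. e y n) (a (Suc n)) (a n) \<and> t \<in> a n \<and>
       y \<in> OSucc r (a n) t \<and> seg r l <o |OSucc r (a n) t|" using bspec[OF B(2) y] by (elim exE)
    have "constant_on (\<lambda>y. e y n) (a (Suc n)) (a n)" "t \<in> a (Suc n)" "seg r l <o |OSucc r (a (Suc n)) t|"
      "y \<in> OSucc r (a (Suc n)) t" "a (Suc n) \<in> C (Suc n)"
      using a by blast+
    then obtain c' where c': "c' \<prec> k (h t)" "\<forall>y \<in> OSucc r (a (Suc n)) t. e y n = c'"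
      unfolding constant_on_def by blast
    then have "e y n \<in> V n (a (Suc n))" using \<open>y \<in> OSucc r (a (Suc n)) t\<close> unfolding V_def by auto
    then have "e y n \<prec> c" using c(2) \<open>a (Suc n) \<in> C (Suc n)\<close> by blast
    then show False using n lt_trans[of c "e y n" c] lt_irrefl by blast
  qed
  then have "OSucc r q t \<subseteq> B \<union> underS r d" by blast
  moreover have "|B \<union> underS r d| <o seg r (k (h t))"
    using card_of_Un_ordLess_infinite_Field[OF _ kc(1) ordLeq_ordLess_trans[OF B(1) big] card_of_underS[OF kc(1) d(2)]] kc(2)
    by (simp add: Field_seg[OF wo])
  ultimately have "|OSucc r q t| <o seg r (k (h t))" using card_of_mono1 ordLeq_ordLess_trans by blast
  then show False using S(2) not_ordLess_ordIso by blast
qed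

end

theorem theorem5p11:
  fixes r :: "'a rel" and l :: 'a and k :: "'a \<Rightarrow> 'a" and P :: "'a node set set"
  assumes "singular_card r"
    and "l \<in> Field r" and "Card_order (seg r l)" and "has_cof r (seg r l)"
    and "natLeq <o seg r l"
    and "\<And>a. a \<in> underS r l \<Longrightarrow> k a \<in> Field r \<and> regular_inf_card (seg r (k a))"
    and "\<And>a b. a \<in> underS r l \<Longrightarrow> b \<in> underS r l \<Longrightarrow> a \<in> underS r b \<Longrightarrow> k a \<in> underS r (k b)"
    and "cofinal (k ` underS r l) r"
    and "P \<in> {Miller r l k, Laver r l k, Miller_stat r l k, Laver_stat r l k}"
  shows "\<not> distributive_any (ro P (\<subseteq>)) natLeq (cardSuc (seg r l))"
proof -
  have wo: "Well_order r" using assms(1) card_order_on_well_order_on by (auto simp: singular_card_def)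
  interpret well_ord r by unfold_locales (rule wo)
  have "natLeq \<le>o |underS r l|"
    using ordLess_imp_ordLeq[OF assms(5)] ordIso_symmetric[OF card_of_underS_eq[OF assms(3)]]
    by (rule ordLeq_ordIso_trans)
  then have inf: "infinite (underS r l)" using infinite_iff_natLeq_ordLeq by blast
  have large: "\<exists>a. a \<prec> l \<and> l \<prec> k a"
    using assms(2,8) unfolding cofinal_def underS_def by blast
  interpret kappa_seq r l k
  proof
    show "Card_order (seg r l)" "infinite (underS r l)" "\<exists>a. a \<prec> l \<and> l \<prec> k a" by fact+
    show "regular_inf_card (seg r (k a))" if "a \<prec> l" for a using assms(6)[OF that] by blast
    show "k a \<prec> k b" if "b \<prec> l" "a \<prec> b" for a b
      using assms(7)[OF lt_trans[OF that(2,1)] that] .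
  qed
  have ne: "Laver_stat r l k \<noteq> {}" "Laver r l k \<noteq> {}" "Miller_stat r l k \<noteq> {}" "Miller r l k \<noteq> {}"
    using Laver_stat_nonempty Laver_stat_subset_Laver Laver_stat_subset_Miller_stat Miller_stat_subset_Miller
    by blast+
  consider "P = Miller r l k" | "P = Laver r l k" | "P = Miller_stat r l k" | "P = Laver_stat r l k"
    using assms(9) by blast
  then show ?thesis
  proof cases
    case 1
    then show ?thesis
      using not_distributive_rank_drop[OF ne(4) order_refl Miller_cone Miller_rank_drop] by simp
  next
    case 2
    then show ?thesis
      using not_distributive_rank_drop[OF ne(2) Laver_subset_Miller Laver_cone Laver_rank_drop] by simp
  next
    case 3
    then show ?thesis
      using not_distributive_constant_on[OF ne(3) order_refl Miller_stat_cone Miller_stat_constant_on] by simp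
  next
    case 4
    then show ?thesis
      using not_distributive_constant_on[OF ne(1) Laver_stat_subset_Miller_stat Laver_stat_cone Laver_stat_constant_on]
      by simp
  qed
qed

end
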